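(* Fix $\lambda>0$ and $z>0$. The local time $L^{\lambda,z}(\sigma_z^\lambda,z)$ of $\xi^{\lambda,z}$ at level $z$ up to time $\sigma_z^\lambda$ follows an exponential distribution with parameter $\lambda$, i.e. $\mathbb{P}(L^{\lambda,z}(\sigma_z^\lambda,z)>y)=e^{-\lambda y}$ for all $y\ge0$.
   Context: Let $B=(B_t)_{t\ge 0}$ be a standard Brownian motion started at $0$ on a complete probability space $(\Omega,\mathcal{F},\mathbb{P})$. For $\lambda>0$, $z>0$, put $B^\lambda_t=B_t+\lambda t$, $\sigma_z^\lambda=\sup\{t>0: B^\lambda_t=z\}$ (almost surely finite), and $\xi^{\lambda,z}_t=B^\lambda_{t\wedge\sigma_z^\lambda}$, $t\ge 0$. This is a continuous semimartingale in its own completed filtration with $\langle\xi^{\lambda,z}\rangle_t=t\wedge\sigma_z^\lambda$; $L^{\lambda,z}(t,x)$ denotes its semimartingale local time at level $x$ up to time $t$ (normalized by Tanaka's formula $|\xi_t-x|=|\xi_0-x|+\int_0^t\operatorname{sgn}(\xi_s-x)\,\mathrm{d}\xi_s+L(t,x)$, equivalently by the occupation formula $\int_0^t f(\xi_s)\,\mathrm{d}\langle\xi\rangle_s=\int_{\mathbb{R}}f(x)L(t,x)\,\mathrm{d}x$), in its version jointly continuous in $(t,x)$. *)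

theory Defs
  imports "HOL-Probability.Probability"
begin

text \<open>Processes are functions \<open>X t \<omega>\<close> of a real time \<open>t\<close>, of which only the times \<open>t \<ge> 0\<close> are
  ever constrained or used.\<close>

definition std_brownian_motion :: "'a measure \<Rightarrow> (real \<Rightarrow> 'a \<Rightarrow> real) \<Rightarrow> bool" where
  "std_brownian_motion M B \<longleftrightarrow>
     (\<forall>t\<ge>0. B t \<in> borel_measurable M) \<and>
     (AE \<omega> in M. B 0 \<omega> = 0) \<and>
     (AE \<omega> in M. continuous_on {0..} (\<lambda>t. B t \<omega>)) \<and>
     (\<forall>s t. 0 \<le> s \<and> s < t \<longrightarrow>
        distributed M lborel (\<lambda>\<omega>. B t \<omega> - B s \<omega>) (normal_density 0 (sqrt (t - s)))) \<and>
     (\<forall>(n::nat) (p::nat \<Rightarrow> real). 0 \<le> p 0 \<and> (\<forall>i<n. p i \<le> p (Suc i)) \<longrightarrow>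
        prob_space.indep_vars M (\<lambda>_. borel) (\<lambda>i \<omega>. B (p (Suc i)) \<omega> - B (p i) \<omega>) {..<n})"

definition drifted :: "real \<Rightarrow> (real \<Rightarrow> 'a \<Rightarrow> real) \<Rightarrow> real \<Rightarrow> 'a \<Rightarrow> real" where
  "drifted \<mu> B t \<omega> = B t \<omega> + \<mu> * t"

text \<open>The supremum is taken in the reals, so it is the intended one only where the set of times is
  nonempty and bounded; for a Brownian motion with positive drift and a positive level this is
  almost surely the case.\<close>

definition last_passage :: "(real \<Rightarrow> 'a \<Rightarrow> real) \<Rightarrow> real \<Rightarrow> 'a \<Rightarrow> real" where
  "last_passage X z \<omega> = Sup {t. 0 < t \<and> X t \<omega> = z}"

definition stopped :: "(real \<Rightarrow> 'a \<Rightarrow> real) \<Rightarrow> ('a \<Rightarrow> real) \<Rightarrow> real \<Rightarrow> 'a \<Rightarrow> real" where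
  "stopped X \<tau> t \<omega> = X (min t (\<tau> \<omega>)) \<omega>"

text \<open>\<open>Q\<close> is the bracket of \<open>X\<close>: at every time \<open>t\<close> it is the limit in probability of the sums of
  squared increments along the partitions \<open>0 = p 0 \<le> \<dots> \<le> p n = t\<close> as their mesh tends to 0.
  For a continuous semimartingale this limit exists and does not depend on the filtration.\<close>

definition quadratic_variation ::
    "'a measure \<Rightarrow> (real \<Rightarrow> 'a \<Rightarrow> real) \<Rightarrow> (real \<Rightarrow> 'a \<Rightarrow> real) \<Rightarrow> bool" where
  "quadratic_variation M X Q \<longleftrightarrow>
     (\<forall>t\<ge>0. X t \<in> borel_measurable M \<and> Q t \<in> borel_measurable M) \<and>
     (AE \<omega> in M. Q 0 \<omega> = 0 \<and> mono_on {0..} (\<lambda>t. Q t \<omega>) \<and> continuous_on {0..} (\<lambda>t. Q t \<omega>)) \<and>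
     (\<forall>t\<ge>0. \<forall>\<epsilon>>0. \<forall>\<eta>>0. \<exists>\<delta>>0. \<forall>(n::nat) (p::nat \<Rightarrow> real).
        p 0 = 0 \<and> p n = t \<and> (\<forall>i<n. p i \<le> p (Suc i) \<and> p (Suc i) - p i < \<delta>) \<longrightarrow>
        measure M {\<omega> \<in> space M. \<epsilon> < \<bar>(\<Sum>i<n. (X (p (Suc i)) \<omega> - X (p i) \<omega>)\<^sup>2) - Q t \<omega>\<bar>} < \<eta>)"

text \<open>\<open>L t x \<omega>\<close> is a jointly continuous version of the local time of \<open>X\<close> at level \<open>x\<close> up to time
  \<open>t\<close>, normalized by the occupation formula with respect to the bracket of \<open>X\<close>.  Extending
  the bracket by its value at 0 to negative times makes it a distribution function on the whole
  line whose Stieltjes measure is carried by the positive times.\<close>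

definition local_time ::
    "'a measure \<Rightarrow> (real \<Rightarrow> 'a \<Rightarrow> real) \<Rightarrow> (real \<Rightarrow> real \<Rightarrow> 'a \<Rightarrow> real) \<Rightarrow> bool" where
  "local_time M X L \<longleftrightarrow>
     (\<forall>t\<ge>0. \<forall>x. L t x \<in> borel_measurable M) \<and>
     (AE \<omega> in M. continuous_on ({0..} \<times> UNIV) (\<lambda>(t, x). L t x \<omega>)) \<and>
     (AE \<omega> in M. \<forall>t\<ge>0. \<forall>x. 0 \<le> L t x \<omega>) \<and>
     (\<exists>Q. quadratic_variation M X Q \<and>
        (AE \<omega> in M. \<forall>t\<ge>0. \<forall>f :: real \<Rightarrow> ennreal. f \<in> borel_measurable borel \<longrightarrow>
           (\<integral>\<^sup>+s\<in>{0..t}. f (X s \<omega>) \<partial>interval_measure (\<lambda>s. Q (max 0 s) \<omega>)) =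
           (\<integral>\<^sup>+x. f x * ennreal (L t x \<omega>) \<partial>lborel)))"

end

theory Submission
  imports Defs "HOL-Real_Asymp.Real_Asymp"
begin

text \<open>
  Write \<open>X t = B t + l * t\<close>.  After its last visit to \<open>z\<close> the path \<open>X\<close> stays above \<open>z\<close>, so for a function
  \<open>f\<close> carried by \<open>{z - e..z}\<close> the occupation formula at time \<open>\<sigma>\<close> reads
  \<open>A = \<integral>\<^sub>0\<^sup>\<infinity> f (X s) ds = \<integral> f x * L \<sigma> x dx\<close>.  Hence \<open>A / \<integral> f\<close> tends to \<open>L \<sigma> z\<close> as \<open>e\<close> tends to 0, and the
  random time \<open>\<sigma>\<close> has disappeared.  The Markov property at deterministic times expresses the moments
  of \<open>A\<close> through the potential density \<open>exp (min 0 (2 * l * y)) / l\<close> of \<open>X\<close>, which tends to \<open>1 / l\<close> as \<open>y\<close> tends to 0;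
  so the \<open>k\<close>-th moment of \<open>L \<sigma> z\<close> is \<open>k! / l\<^sup>k\<close>, and these moments determine the
  exponential distribution.
\<close>

section \<open>Determination of a distribution by its moments\<close>

text \<open>The moment recursion comes from ordered times: \<open>A ^ k / fact k\<close> is the
  integral of \<open>f (X s_1) * ... * f (X s_k)\<close> over \<open>0 < s_1 < ... < s_k\<close>.
  The largest time is integrated first; the Markov property at the time before it turns it into the
  potential of \<open>f\<close> at a point of the support of \<open>f\<close>. Two such points are
  at most \<open>e\<close> apart, so each step multiplies by a factor between
  \<open>exp (- 2 * l * e) * c / l\<close> and \<open>c / l\<close>, where \<open>c\<close> is the
  integral of \<open>f\<close>. The first moment is exactly \<open>c / l\<close>, because
  \<open>X\<close> starts below the support. The main obstacle is the bracket: it is given only by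
  limits in probability, and it has to be identified with \<open>min t \<sigma>\<close> before the
  occupation formula becomes a Lebesgue integral in time. Transience, from an exponential
  supermartingale, makes \<open>A\<close> finite and makes \<open>\<sigma>\<close> the supremum of a
  nonempty bounded set. Measurability of \<open>L \<sigma> z\<close> is not part of the data for a
  random time; it comes from completeness and almost sure convergence of the averages.\<close>

lemma power_le_fact_exp:
  fixes y :: real assumes "0 \<le> y" shows "y ^ k \<le> fact k * exp y"
proof -
  have "(\<Sum>n\<in>{k}. y ^ n /\<^sub>R fact n) \<le> (\<Sum>n. y ^ n /\<^sub>R fact n)"
    by (rule sum_le_suminf) (use assms summable_exp_generic[of y] in auto)
  then show ?thesis
    by (simp add: exp_def field_simps)
qed

text \<open>Expanding the exponential termwise turns the moment bounds into a geometric series of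
  ratio \<open>c / l < 1\<close>.\<close>

lemma integrable_exp_abs_if_moments:
  fixes N :: "real measure"
  assumes [measurable_cong]: "sets N = sets borel"
    and m: "\<And>k. (\<integral>\<^sup>+x. ennreal (\<bar>x\<bar> ^ k) \<partial>N) \<le> ennreal (fact k / l ^ k)"
    and c: "0 \<le> c" "c < l"
  shows "integrable N (\<lambda>x. exp (c * \<bar>x\<bar>))"
proof (rule integrableI_bounded)
  show "(\<lambda>x. exp (c * \<bar>x\<bar>)) \<in> borel_measurable N" by measurable
  have e: "ennreal (exp (c * \<bar>x\<bar>)) = (\<Sum>k. ennreal (c ^ k / fact k) * ennreal (\<bar>x\<bar> ^ k))" for x :: real
  proof -
    have s: "(\<lambda>n. (c * \<bar>x\<bar>) ^ n /\<^sub>R fact n) sums exp (c * \<bar>x\<bar>)" by (rule exp_converges)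
    have "(\<Sum>k. ennreal (c ^ k / fact k) * ennreal (\<bar>x\<bar> ^ k)) = (\<Sum>k. ennreal ((c * \<bar>x\<bar>) ^ k /\<^sub>R fact k))"
      using c by (intro suminf_cong) (simp add: ennreal_mult[symmetric] power_mult_distrib field_simps)
    also have "\<dots> = ennreal (exp (c * \<bar>x\<bar>))"
      using c s by (subst suminf_ennreal2) (auto simp: sums_iff)
    finally show ?thesis by simp
  qed
  have "(\<integral>\<^sup>+x. norm (exp (c * \<bar>x\<bar>)) \<partial>N) = (\<integral>\<^sup>+x. (\<Sum>k. ennreal (c ^ k / fact k) * ennreal (\<bar>x\<bar> ^ k)) \<partial>N)"
    by (simp add: e)
  also have "\<dots> = (\<Sum>k. ennreal (c ^ k / fact k) * (\<integral>\<^sup>+x. ennreal (\<bar>x\<bar> ^ k) \<partial>N))"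
    by (subst nn_integral_suminf) (auto simp: nn_integral_cmult)
  also have "\<dots> \<le> (\<Sum>k. ennreal (c ^ k / fact k) * ennreal (fact k / l ^ k))"
    by (intro suminf_le mult_left_mono m) auto
  also have "\<dots> = (\<Sum>k. ennreal ((c / l) ^ k))"
    using c by (intro suminf_cong) (simp add: ennreal_mult[symmetric] power_divide)
  also have "\<dots> < \<infinity>"
    using c by (subst suminf_ennreal2) (auto intro!: summable_geometric)
  finally show "(\<integral>\<^sup>+x. norm (exp (c * \<bar>x\<bar>)) \<partial>N) < \<infinity>" .
qed

lemma integrable_power_exp_abs_if_moments:
  fixes N :: "real measure"
  assumes s[measurable_cong]: "sets N = sets borel"
    and m: "\<And>k. (\<integral>\<^sup>+x. ennreal (\<bar>x\<bar> ^ k) \<partial>N) \<le> ennreal (fact k / l ^ k)"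
    and c: "0 \<le> c" "c < l"
  shows "integrable N (\<lambda>x. \<bar>x\<bar> ^ k * exp (c * \<bar>x\<bar>))"
proof -
  \<comment> \<open>Half of the gap to \<open>l\<close>: the exponent \<open>c + d\<close> stays
    below \<open>l\<close>, while the extra \<open>d\<close> absorbs the power of
    \<open>x\<close>.\<close>
  define d where "d = (l - c) / 2"
  have d: "0 < d" "c + d < l" using c by (auto simp: d_def field_simps)
  have "integrable N (\<lambda>x. (fact k / d ^ k) * exp ((c + d) * \<bar>x\<bar>))"
    by (intro integrable_mult_right integrable_exp_abs_if_moments[OF s m]) (use c d in auto)
  then show ?thesis
  proof (rule Bochner_Integration.integrable_bound)
    have "\<bar>x\<bar> ^ k * exp (c * \<bar>x\<bar>) \<le> (fact k / d ^ k) * exp ((c + d) * \<bar>x\<bar>)" for x :: real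
    proof -
      have "(d * \<bar>x\<bar>) ^ k \<le> fact k * exp (d * \<bar>x\<bar>)"
        using d by (intro power_le_fact_exp) auto
      then have "\<bar>x\<bar> ^ k \<le> (fact k / d ^ k) * exp (d * \<bar>x\<bar>)"
        using d by (simp add: field_simps power_mult_distrib)
      then have "\<bar>x\<bar> ^ k * exp (c * \<bar>x\<bar>) \<le> (fact k / d ^ k) * exp (d * \<bar>x\<bar>) * exp (c * \<bar>x\<bar>)"
        by (rule mult_right_mono) simp
      also have "\<dots> = (fact k / d ^ k) * exp ((c + d) * \<bar>x\<bar>)"
        by (simp add: exp_add[symmetric] algebra_simps)
      finally show ?thesis .
    qed
    then show "AE x in N. norm (\<bar>x\<bar> ^ k * exp (c * \<bar>x\<bar>)) \<le> norm ((fact k / d ^ k) * exp ((c + d) * \<bar>x\<bar>))"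
      using d by (simp add: abs_mult)
  qed measurable
qed

text \<open>Taylor expansion of the \<open>k\<close>-th derivative of the characteristic function around \<open>\<theta>\<close>; its
  radius of convergence does not depend on \<open>\<theta>\<close>.\<close>

lemma weighted_char_expansion:
  fixes N :: "real measure"
  assumes [measurable_cong]: "sets N = sets borel"
    and i: "\<And>k. integrable N (\<lambda>x. \<bar>x\<bar> ^ k * exp (c * \<bar>x\<bar>))"
    and h: "\<bar>h\<bar> \<le> c"
  shows "(\<lambda>n. \<Sum>j<n. (\<i> * h) ^ j / fact j * (CLINT x|N. complex_of_real x ^ (k + j) * iexp (\<theta> * x)))
    \<longlonglongrightarrow> (CLINT x|N. complex_of_real x ^ k * iexp ((\<theta> + h) * x))"
proof -
  have c: "0 \<le> c" using h by linarith
  have int: "complex_integrable N (\<lambda>x. complex_of_real x ^ m * iexp (\<theta> * x))" for m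
  proof (rule Bochner_Integration.integrable_bound[OF i[of m]])
    show "AE x in N. norm (complex_of_real x ^ m * iexp (\<theta> * x)) \<le> norm (\<bar>x\<bar> ^ m * exp (c * \<bar>x\<bar>))"
      using c by (auto simp: norm_mult norm_power abs_mult intro!: mult_right_le_one_le mult_left_le AE_I2 mult_le_cancel_left1[THEN iffD2])
  qed measurable
  define s where "s n x = (\<Sum>j<n. (\<i> * h) ^ j / fact j * (complex_of_real x ^ (k + j) * iexp (\<theta> * x)))" for n x
  have s: "s n x = complex_of_real x ^ k * iexp (\<theta> * x) * (\<Sum>j<n. (\<i> * h * x) ^ j /\<^sub>R fact j)" for n x
    by (simp add: s_def sum_distrib_left power_add power_mult_distrib scaleR_conv_of_real field_simps)
  have "(\<lambda>n. CLINT x|N. s n x) \<longlonglongrightarrow> (CLINT x|N. complex_of_real x ^ k * iexp ((\<theta> + h) * x))"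
  proof (rule integral_dominated_convergence[where w="\<lambda>x. \<bar>x\<bar> ^ k * exp (c * \<bar>x\<bar>)"])
    show "s n \<in> borel_measurable N" for n
      unfolding s_def by measurable
    show "AE x in N. (\<lambda>n. s n x) \<longlonglongrightarrow> complex_of_real x ^ k * iexp ((\<theta> + h) * x)"
    proof (rule AE_I2)
      fix x :: real
      have "(\<lambda>n. \<Sum>j<n. (\<i> * h * x) ^ j /\<^sub>R fact j) \<longlonglongrightarrow> exp (\<i> * h * x)"
        using exp_converges[of "\<i> * h * x"] by (simp add: sums_def)
      then have "(\<lambda>n. s n x) \<longlonglongrightarrow> complex_of_real x ^ k * iexp (\<theta> * x) * exp (\<i> * h * x)"
        unfolding s by (rule tendsto_mult_left)
      also have "complex_of_real x ^ k * iexp (\<theta> * x) * exp (\<i> * h * x) = complex_of_real x ^ k * iexp ((\<theta> + h) * x)"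
        by (simp add: exp_add[symmetric] algebra_simps)
      finally show "(\<lambda>n. s n x) \<longlonglongrightarrow> complex_of_real x ^ k * iexp ((\<theta> + h) * x)" .
    qed
    show "AE x in N. norm (s n x) \<le> \<bar>x\<bar> ^ k * exp (c * \<bar>x\<bar>)" for n
    proof (rule AE_I2)
      fix x :: real
      have "norm (\<Sum>j<n. (\<i> * h * x) ^ j /\<^sub>R fact j) \<le> (\<Sum>j<n. norm ((\<i> * h * x) ^ j /\<^sub>R fact j))"
        by (rule norm_sum)
      also have "\<dots> = (\<Sum>j<n. (\<bar>h\<bar> * \<bar>x\<bar>) ^ j /\<^sub>R fact j)"
        by (simp add: norm_mult norm_power power_mult_distrib)
      also have "\<dots> \<le> (\<Sum>j<n. (c * \<bar>x\<bar>) ^ j /\<^sub>R fact j)"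
        using h c by (intro sum_mono scaleR_left_mono power_mono mult_right_mono) auto
      also have "\<dots> \<le> (\<Sum>j. (c * \<bar>x\<bar>) ^ j /\<^sub>R fact j)"
        using c by (intro sum_le_suminf summable_exp_generic) auto
      finally have "norm (\<Sum>j<n. (\<i> * h * x) ^ j /\<^sub>R fact j) \<le> exp (c * \<bar>x\<bar>)"
        by (simp add: exp_def)
      then show "norm (s n x) \<le> \<bar>x\<bar> ^ k * exp (c * \<bar>x\<bar>)"
        unfolding s by (simp add: norm_mult norm_power mult_left_mono)
    qed
  qed (use i in auto)
  also have "(\<lambda>n. CLINT x|N. s n x) = (\<lambda>n. \<Sum>j<n. (\<i> * h) ^ j / fact j * (CLINT x|N. complex_of_real x ^ (k + j) * iexp (\<theta> * x)))"
    unfolding s_def using int by (subst Bochner_Integration.integral_sum) auto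
  finally show ?thesis .
qed

text \<open>Analytic continuation along the real line: the moments are the Taylor data of the
  characteristic functions at 0, and agreement of all derivatives at one point spreads to every
  point within distance \<open>l / 2\<close>.\<close>

lemma real_distribution_eqI_moments:
  assumes N: "real_distribution N1" "real_distribution N2"
    and l: "0 < l"
    and m1: "\<And>k. (\<integral>\<^sup>+x. ennreal (\<bar>x\<bar> ^ k) \<partial>N1) \<le> ennreal (fact k / l ^ k)"
    and m2: "\<And>k. (\<integral>\<^sup>+x. ennreal (\<bar>x\<bar> ^ k) \<partial>N2) \<le> ennreal (fact k / l ^ k)"
    and eq: "\<And>k. (\<integral>x. x ^ k \<partial>N1) = (\<integral>x. x ^ k \<partial>N2)"
  shows "N1 = N2"
proof (rule Levy_uniqueness[OF N])
  have s: "sets N1 = sets borel" "sets N2 = sets borel"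
    using N by (auto simp: real_distribution_def real_distribution_axioms_def)
  \<comment> \<open>Up to the factor \<open>\<i> ^ k\<close> this is the \<open>k\<close>-th
    derivative of the characteristic function at \<open>\<theta>\<close>. All orders
    \<open>k\<close> are carried along, since one continuation step uses every derivative at the old
    point.\<close>
  define g where "g N \<theta> k = (CLINT x|N. complex_of_real x ^ k * iexp (\<theta> * x))" for N \<theta> k
  have i1: "integrable N1 (\<lambda>x. \<bar>x\<bar> ^ k * exp (l / 2 * \<bar>x\<bar>))" for k
    by (rule integrable_power_exp_abs_if_moments[OF s(1) m1]) (use l in auto)
  have i2: "integrable N2 (\<lambda>x. \<bar>x\<bar> ^ k * exp (l / 2 * \<bar>x\<bar>))" for k
    by (rule integrable_power_exp_abs_if_moments[OF s(2) m2]) (use l in auto)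
  have step: "g N1 (\<theta> + h) k = g N2 (\<theta> + h) k" if "\<And>k. g N1 \<theta> k = g N2 \<theta> k" "\<bar>h\<bar> \<le> l / 2" for \<theta> h k
    using weighted_char_expansion[OF s(1) i1 that(2), of k \<theta>] weighted_char_expansion[OF s(2) i2 that(2), of k \<theta>] that(1)
    unfolding g_def by (auto intro: LIMSEQ_unique)
  have g: "\<forall>k. g N1 (real n * h) k = g N2 (real n * h) k" if "\<bar>h\<bar> \<le> l / 2" for n h
  proof (induction n)
    case 0
    show ?case
    proof
      fix k
      have "g N (real 0 * h) k = complex_of_real (\<integral>x. x ^ k \<partial>N)" for N
        by (simp add: g_def of_real_power[symmetric] del: of_real_power)
      then show "g N1 (real 0 * h) k = g N2 (real 0 * h) k" using eq by simp
    qed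
  next
    case (Suc n)
    show ?case using step[of "real n * h" h] Suc that by (simp add: algebra_simps)
  qed
  show "char N1 = char N2"
  proof
    fix t :: real
    \<comment> \<open>The way from 0 to \<open>t\<close> is cut into \<open>n\<close> steps, each no
      longer than the admissible \<open>l / 2\<close>.\<close>
    obtain n :: nat where n: "\<bar>t\<bar> / (l / 2) < real n" using reals_Archimedean2 by blast
    moreover have "0 \<le> \<bar>t\<bar> / (l / 2)" using l by simp
    ultimately have n0: "0 < real n" by linarith
    have "\<bar>t / real n\<bar> \<le> l / 2" using n n0 l by (simp add: field_simps)
    from g[OF this, of n, rule_format, of 0] n0 show "char N1 t = char N2 t"
      by (simp add: g_def char_def)
  qed
qed

section \<open>The potential density of Brownian motion with drift\<close>

text \<open>Exhausting the open half-line by \<open>{u n ..}\<close> and monotone convergence leave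
  only a right limit of \<open>F\<close> at \<open>a\<close> to be known. This suits Gaussian
  densities as functions of time, for which time 0 is degenerate.\<close>

lemma nn_integral_FTC_greaterThan:
  fixes f :: "real \<Rightarrow> real"
  assumes f_borel: "f \<in> borel_measurable borel"
    and f: "\<And>x. a < x \<Longrightarrow> DERIV F x :> f x"
    and nonneg: "\<And>x. a < x \<Longrightarrow> 0 \<le> f x"
    and lim: "(F \<longlongrightarrow> T) at_top" and lim0: "(F \<longlongrightarrow> S) (at_right a)"
  shows "(\<integral>\<^sup>+x. ennreal (f x) * indicator {a <..} x \<partial>lborel) = ennreal (T - S)"
proof -
  define u where "u n = a + 1 / Suc n" for n
  have u: "a < u n" for n by (simp add: u_def)
  have ud: "u (Suc n) \<le> u n" for n by (simp add: u_def field_simps)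
  have ulim: "u \<longlonglongrightarrow> a"
    unfolding u_def using tendsto_add[OF tendsto_const LIMSEQ_inverse_real_of_nat, of a] by (simp add: inverse_eq_divide)
  have ulim': "filterlim u (at_right a) sequentially"
    using ulim u by (auto simp: filterlim_at intro!: always_eventually)
  have "(\<lambda>n. \<integral>\<^sup>+x. ennreal (f x) * indicator {u n ..} x \<partial>lborel) \<longlonglongrightarrow>
     (\<integral>\<^sup>+x. ennreal (f x) * indicator {a <..} x \<partial>lborel)"
  proof (rule nn_integral_LIMSEQ)
    show "incseq (\<lambda>n x. ennreal (f x) * indicator {u n ..} x)"
      by (rule incseq_SucI) (auto simp: le_fun_def indicator_def intro: order_trans[OF ud])
    show "(\<lambda>x. ennreal (f x) * indicator {u n ..} x) \<in> borel_measurable lborel" for n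
      using f_borel by measurable
    show "(\<lambda>n. ennreal (f x) * indicator {u n ..} x) \<longlonglongrightarrow> ennreal (f x) * indicator {a <..} x" for x
    proof (cases "a < x")
      case True
      then have "eventually (\<lambda>n. u n < x) sequentially"
        using order_tendstoD(2)[OF ulim] by simp
      then show ?thesis using True
        by (intro tendsto_eventually) (auto elim!: eventually_mono)
    next
      case False
      then have "\<not> u n \<le> x" for n using u[of n] by linarith
      then show ?thesis using False by simp
    qed
  qed
  moreover have "(\<lambda>n. \<integral>\<^sup>+x. ennreal (f x) * indicator {u n ..} x \<partial>lborel) = (\<lambda>n. ennreal (T - F (u n)))"
  proof
    fix n
    show "(\<integral>\<^sup>+x. ennreal (f x) * indicator {u n ..} x \<partial>lborel) = ennreal (T - F (u n))"
    proof (rule nn_integral_FTC_atLeast[OF f_borel _ _ lim])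
      fix x assume "u n \<le> x"
      then have "a < x" using u[of n] by linarith
      then show "DERIV F x :> f x" "0 \<le> f x" using f nonneg by auto
    qed
  qed
  moreover have "(\<lambda>n. ennreal (T - F (u n))) \<longlonglongrightarrow> ennreal (T - S)"
    by (intro tendsto_ennrealI tendsto_diff tendsto_const filterlim_compose[OF lim0 ulim'])
  ultimately show ?thesis using LIMSEQ_unique by metis
qed

lemma std_normal_cdf_deriv:
  "DERIV (cdf (density lborel std_normal_density)) x :> std_normal_density x"
proof -
  let ?N = "density lborel std_normal_density"
  interpret N: real_distribution ?N
    by (simp add: real_distribution_def real_distribution_axioms_def prob_space_normal_density)
  \<comment> \<open>Starting the integral at \<open>x - 2\<close> makes every point of
    \<open>{x - 1..x + 1}\<close> interior to \<open>{x - 2..x + 2}\<close>, so the derivative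
    within that interval is two-sided.\<close>
  define G where "G y = integral {x - 2..y} std_normal_density" for y
  have cont: "continuous_on S std_normal_density" for S
    unfolding normal_density_def by (intro continuous_intros) auto
  have G: "DERIV G y :> std_normal_density y" if "y \<in> {x - 1..x + 1}" for y
  proof -
    have "(G has_real_derivative std_normal_density y) (at y within {x - 2..x + 2})"
      unfolding G_def using that by (intro integral_has_real_derivative cont) auto
    moreover have "at y within {x - 2..x + 2} = at y"
      using that by (intro at_within_Icc_at) auto
    ultimately show ?thesis by simp
  qed
  have eq: "cdf ?N y = cdf ?N (x - 1) + (G y - G (x - 1))" if "y \<in> {x - 1..x + 1}" for y
  proof -
    have "emeasure ?N {x - 1<..y} = (\<integral>\<^sup>+t. ennreal (std_normal_density t) * indicator {x - 1<..y} t \<partial>lborel)"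
      by (subst emeasure_density) auto
    also have "\<dots> = (\<integral>\<^sup>+t. ennreal (std_normal_density t) * indicator {x - 1..y} t \<partial>lborel)"
      using AE_lborel_singleton[of "x - 1"] by (intro nn_integral_cong_AE) (auto simp: indicator_def)
    also have "\<dots> = G y - G (x - 1)"
      by (rule nn_integral_FTC_Icc) (use that G in auto)
    finally have "emeasure ?N {x - 1<..y} = G y - G (x - 1)" .
    moreover have "G (x - 1) \<le> G y"
    proof (rule DERIV_nonneg_imp_nondecreasing[of "x - 1" y G])
      fix t assume "x - 1 \<le> t" "t \<le> y"
      then show "\<exists>d. DERIV G t :> d \<and> 0 \<le> d"
        using G[of t] that by (intro exI[of _ "std_normal_density t"]) auto
    qed (use that in auto)
    ultimately have "measure ?N {x - 1<..y} = G y - G (x - 1)"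
      unfolding measure_def by simp
    then show ?thesis
      using that N.cdf_diff_eq[of "x - 1" y] by (cases "x - 1 = y") auto
  qed
  have "((\<lambda>y. cdf ?N (x - 1) + (G y - G (x - 1))) has_real_derivative std_normal_density x) (at x)"
    using DERIV_add[OF DERIV_const DERIV_diff[OF G DERIV_const], of x] by simp
  then show ?thesis
    by (rule has_field_derivative_transform_within_open[where S="{x - 1<..<x + 1}"]) (simp_all, rule eq[symmetric], simp)
qed

text \<open>The antiderivative \<open>F\<close> is, up to a sign, the combination of normal distribution functions known from
  the first passage law of Brownian motion with drift.\<close>

lemma nn_integral_normal_density_time:
  fixes l w :: real
  assumes l: "0 < l" and w: "w \<noteq> 0"
  shows "(\<integral>\<^sup>+t. ennreal (normal_density (l * t) (sqrt t) w) * indicator {0 <..} t \<partial>lborel) =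
    ennreal (exp (min 0 (2 * l * w)) / l)"
proof -
  let ?N = "density lborel std_normal_density"
  interpret N: real_distribution ?N
    by (simp add: real_distribution_def real_distribution_axioms_def prob_space_normal_density)
  define F where "F t = (cdf ?N (l * sqrt t - w / sqrt t) - exp (2 * l * w) * cdf ?N (- w / sqrt t - l * sqrt t)) / l" for t
  \<comment> \<open>The limit of \<open>F\<close> at time 0: there both arguments of the
    distribution function tend to minus infinity if \<open>w > 0\<close> and to plus infinity if
    \<open>w < 0\<close>.\<close>
  define S where "S = (if w > 0 then 0 else (1 - exp (2 * l * w)) / l)"
  \<comment> \<open>The exponential weight makes the two Gaussian densities coincide. In the
    derivative of \<open>F\<close> the terms with \<open>w\<close> then cancel and those with
    \<open>l\<close> add up.\<close>
  have phi: "exp (2 * l * w) * std_normal_density (- w / sqrt t - l * sqrt t) = std_normal_density (l * sqrt t - w / sqrt t)"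
    if "0 < t" for t
  proof -
    have "2 * l * w - (- w / sqrt t - l * sqrt t)\<^sup>2 / 2 = - (l * sqrt t - w / sqrt t)\<^sup>2 / 2"
      using that by (simp add: power2_eq_square field_simps)
    then have "exp (2 * l * w) * exp (- (- w / sqrt t - l * sqrt t)\<^sup>2 / 2) = exp (- (l * sqrt t - w / sqrt t)\<^sup>2 / 2)"
      by (simp add: exp_add[symmetric])
    then show ?thesis
      by (simp add: std_normal_density_def)
  qed
  have nd: "normal_density (l * t) (sqrt t) w = std_normal_density (l * sqrt t - w / sqrt t) / sqrt t" if "0 < t" for t
  proof -
    have "(w - l * t)\<^sup>2 / (2 * t) = (l * sqrt t - w / sqrt t)\<^sup>2 / 2"
      using that by (simp add: power2_eq_square field_simps)
    then show ?thesis using that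
      by (simp add: normal_density_def real_sqrt_mult)
  qed
  have "(\<integral>\<^sup>+t. ennreal (normal_density (l * t) (sqrt t) w) * indicator {0 <..} t \<partial>lborel) = ennreal (1 / l - S)"
  proof (rule nn_integral_FTC_greaterThan)
    show "(\<lambda>t. normal_density (l * t) (sqrt t) w) \<in> borel_measurable borel"
      unfolding normal_density_def by measurable
    fix t :: real assume t: "0 < t"
    show "0 \<le> normal_density (l * t) (sqrt t) w" by simp
    have d1: "((\<lambda>t. l * sqrt t - w / sqrt t) has_real_derivative l / (2 * sqrt t) + w / (2 * t * sqrt t)) (at t)"
      using t by (auto intro!: derivative_eq_intros simp: field_simps)
    have d2: "((\<lambda>t. - w / sqrt t - l * sqrt t) has_real_derivative w / (2 * t * sqrt t) - l / (2 * sqrt t)) (at t)"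
      using t by (auto intro!: derivative_eq_intros simp: field_simps)
    have "(F has_real_derivative (std_normal_density (l * sqrt t - w / sqrt t) * (l / (2 * sqrt t) + w / (2 * t * sqrt t))
        - exp (2 * l * w) * (std_normal_density (- w / sqrt t - l * sqrt t) * (w / (2 * t * sqrt t) - l / (2 * sqrt t)))) / l) (at t)"
      unfolding F_def
      by (intro DERIV_cdivide DERIV_diff DERIV_cmult DERIV_chain2[OF std_normal_cdf_deriv] d1 d2)
    also have "(std_normal_density (l * sqrt t - w / sqrt t) * (l / (2 * sqrt t) + w / (2 * t * sqrt t))
        - exp (2 * l * w) * (std_normal_density (- w / sqrt t - l * sqrt t) * (w / (2 * t * sqrt t) - l / (2 * sqrt t)))) / l
      = (std_normal_density (l * sqrt t - w / sqrt t) * (l / (2 * sqrt t) + w / (2 * t * sqrt t))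
        - (exp (2 * l * w) * std_normal_density (- w / sqrt t - l * sqrt t)) * (w / (2 * t * sqrt t) - l / (2 * sqrt t))) / l"
      by (simp only: mult.assoc)
    also have "\<dots> = std_normal_density (l * sqrt t - w / sqrt t) / sqrt t"
      unfolding phi[OF t] using l t by (simp add: field_simps)
    also have "\<dots> = normal_density (l * t) (sqrt t) w" using nd[OF t] by simp
    finally show "(F has_real_derivative normal_density (l * t) (sqrt t) w) (at t)" .
  next
    have top: "(cdf ?N \<longlongrightarrow> 1) at_top" by (rule N.cdf_lim_at_top_prob)
    have bot: "(cdf ?N \<longlongrightarrow> 0) at_bot" by (rule N.cdf_lim_at_bot)
    have "filterlim (\<lambda>t. l * sqrt t - w / sqrt t) at_top at_top" "filterlim (\<lambda>t. - w / sqrt t - l * sqrt t) at_bot at_top"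
      using l by real_asymp+
    then have "(F \<longlongrightarrow> (1 - exp (2 * l * w) * 0) / l) at_top"
      unfolding F_def using l
      by (intro tendsto_divide tendsto_diff tendsto_mult tendsto_const filterlim_compose[OF top] filterlim_compose[OF bot]) auto
    then show "(F \<longlongrightarrow> 1 / l) at_top" by simp
    show "(F \<longlongrightarrow> S) (at_right 0)"
    proof (cases "w > 0")
      case True
      have "filterlim (\<lambda>t. l * sqrt t - w / sqrt t) at_bot (at_right 0)" "filterlim (\<lambda>t. - w / sqrt t - l * sqrt t) at_bot (at_right 0)"
        using l True by real_asymp+
      then have "(F \<longlongrightarrow> (0 - exp (2 * l * w) * 0) / l) (at_right 0)"
        unfolding F_def using l
        by (intro tendsto_divide tendsto_diff tendsto_mult tendsto_const filterlim_compose[OF bot]) auto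
      then show ?thesis using True by (simp add: S_def)
    next
      case False
      then have w: "w < 0" using w by simp
      have "filterlim (\<lambda>t. l * sqrt t - w / sqrt t) at_top (at_right 0)" "filterlim (\<lambda>t. - w / sqrt t - l * sqrt t) at_top (at_right 0)"
        using l w by real_asymp+
      then have "(F \<longlongrightarrow> (1 - exp (2 * l * w) * 1) / l) (at_right 0)"
        unfolding F_def using l
        by (intro tendsto_divide tendsto_diff tendsto_mult tendsto_const filterlim_compose[OF top]) auto
      then show ?thesis using False by (simp add: S_def)
    qed
  qed
  also have "1 / l - S = exp (min 0 (2 * l * w)) / l"
    using l w by (auto simp: S_def min_def field_simps zero_le_mult_iff mult_le_0_iff)
  finally show ?thesis .
qed

section \<open>Measurability and limits of moments\<close>

text \<open>A continuous path is the limit of its values at the grid times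
  \<open>\<lfloor>n * t\<rfloor> / n\<close>. These take countably many values, so each
  approximation is jointly measurable.\<close>

lemma borel_measurable_continuous_process:
  fixes X :: "real \<Rightarrow> 'a \<Rightarrow> real"
  assumes X[measurable]: "\<And>t. X t \<in> borel_measurable N"
    and cont: "\<And>\<omega>. \<omega> \<in> space N \<Longrightarrow> continuous_on UNIV (\<lambda>t. X t \<omega>)"
  shows "(\<lambda>(t, \<omega>). X t \<omega>) \<in> borel_measurable (borel \<Otimes>\<^sub>M N)"
proof (rule borel_measurable_LIMSEQ_real)
  fix n :: nat
  have "(\<lambda>p. X (real_of_int \<lfloor>real (Suc n) * fst p\<rfloor> / real (Suc n)) (snd p)) \<in> borel_measurable (borel \<Otimes>\<^sub>M N)"
    by (rule measurable_compose_countable[where g="\<lambda>p. \<lfloor>real (Suc n) * fst p\<rfloor>" and f="\<lambda>i p. X (real_of_int i / real (Suc n)) (snd p)"])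
      measurable
  then show "(\<lambda>p. X (real_of_int \<lfloor>real (Suc n) * fst p\<rfloor> / real (Suc n)) (snd p)) \<in> borel_measurable (borel \<Otimes>\<^sub>M N)" .
next
  fix p :: "real \<times> 'a" assume "p \<in> space (borel \<Otimes>\<^sub>M N)"
  then obtain t \<omega> where p: "p = (t, \<omega>)" "\<omega> \<in> space N" by (auto simp: space_pair_measure)
  have "(\<lambda>n. real_of_int \<lfloor>real (Suc n) * t\<rfloor> / real (Suc n)) \<longlonglongrightarrow> t"
  proof (rule tendsto_sandwich)
    show "(\<lambda>n. t - 1 / real (Suc n)) \<longlonglongrightarrow> t"
      using tendsto_diff[OF tendsto_const LIMSEQ_inverse_real_of_nat, of t] by (simp add: inverse_eq_divide)
    show "\<forall>\<^sub>F n in sequentially. t - 1 / real (Suc n) \<le> real_of_int \<lfloor>real (Suc n) * t\<rfloor> / real (Suc n)"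
    proof (rule always_eventually, rule allI)
      fix n
      have "real (Suc n) * t - 1 \<le> real_of_int \<lfloor>real (Suc n) * t\<rfloor>" by linarith
      then have "(real (Suc n) * t - 1) / real (Suc n) \<le> real_of_int \<lfloor>real (Suc n) * t\<rfloor> / real (Suc n)"
        by (rule divide_right_mono) simp
      then show "t - 1 / real (Suc n) \<le> real_of_int \<lfloor>real (Suc n) * t\<rfloor> / real (Suc n)"
        by (simp add: diff_divide_distrib del: of_nat_Suc)
    qed
    show "\<forall>\<^sub>F n in sequentially. real_of_int \<lfloor>real (Suc n) * t\<rfloor> / real (Suc n) \<le> t"
      by (intro always_eventually allI) (simp add: pos_divide_le_eq mult.commute del: of_nat_Suc)
  qed simp
  then show "(\<lambda>n. X (real_of_int \<lfloor>real (Suc n) * fst p\<rfloor> / real (Suc n)) (snd p)) \<longlonglongrightarrow> (case p of (t, \<omega>) \<Rightarrow> X t \<omega>)"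
    unfolding p using continuous_on_tendsto_compose[OF cont[OF p(2)], of "\<lambda>n. real_of_int \<lfloor>real (Suc n) * t\<rfloor> / real (Suc n)" t sequentially]
    by simp
qed

text \<open>The truncation \<open>y\<^sup>k \<le> (min y K)\<^sup>k + y\<^sup>k\<^sup>+\<^sup>1 / K\<close> shows that no mass is lost in the limit.\<close>

lemma (in finite_measure) nn_integral_power_limit:
  fixes Y :: "nat \<Rightarrow> 'a \<Rightarrow> real"
  assumes Y[measurable]: "\<And>n. Y n \<in> borel_measurable M" and l[measurable]: "l \<in> borel_measurable M"
    and nn: "\<And>n \<omega>. \<omega> \<in> space M \<Longrightarrow> 0 \<le> Y n \<omega>"
    and lim: "AE \<omega> in M. (\<lambda>n. Y n \<omega>) \<longlonglongrightarrow> l \<omega>"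
    and conv: "(\<lambda>n. \<integral>\<^sup>+\<omega>. ennreal (Y n \<omega> ^ k) \<partial>M) \<longlonglongrightarrow> ennreal c"
    and bd: "\<And>n. (\<integral>\<^sup>+\<omega>. ennreal (Y n \<omega> ^ Suc k) \<partial>M) \<le> ennreal C"
    and C: "0 \<le> c" "0 \<le> C"
  shows "(\<integral>\<^sup>+\<omega>. ennreal (l \<omega> ^ k) \<partial>M) = ennreal c"
proof (rule antisym)
  have l0: "AE \<omega> in M. 0 \<le> l \<omega>"
    using lim AE_space by eventually_elim (rule LIMSEQ_le_const, use nn in auto)
  have "(\<integral>\<^sup>+\<omega>. ennreal (l \<omega> ^ k) \<partial>M) = (\<integral>\<^sup>+\<omega>. liminf (\<lambda>n. ennreal (Y n \<omega> ^ k)) \<partial>M)"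
    using lim by (intro nn_integral_cong_AE, eventually_elim)
      (auto intro!: lim_imp_Liminf[symmetric] tendsto_intros)
  also have "\<dots> \<le> liminf (\<lambda>n. \<integral>\<^sup>+\<omega>. ennreal (Y n \<omega> ^ k) \<partial>M)"
    by (rule nn_integral_liminf) measurable
  also have "\<dots> = ennreal c"
    using conv by (intro lim_imp_Liminf) auto
  finally show "(\<integral>\<^sup>+\<omega>. ennreal (l \<omega> ^ k) \<partial>M) \<le> ennreal c" .
  \<comment> \<open>Fatou gave the upper bound. Below, the truncations at \<open>K\<close> converge
    by dominated convergence, and what they miss is at most \<open>C / K\<close> uniformly in
    \<open>n\<close>; finally \<open>K\<close> tends to infinity.\<close>
  have K: "ennreal c \<le> (\<integral>\<^sup>+\<omega>. ennreal (l \<omega> ^ k) \<partial>M) + ennreal (C / K)" if K: "0 < K" for K :: real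
  proof -
    have b: "(\<integral>\<^sup>+\<omega>. ennreal (Y n \<omega> ^ k) \<partial>M) \<le> (\<integral>\<^sup>+\<omega>. ennreal (min (Y n \<omega>) K ^ k) \<partial>M) + ennreal (C / K)" for n
    proof -
      have "(\<integral>\<^sup>+\<omega>. ennreal (Y n \<omega> ^ k) \<partial>M) \<le> (\<integral>\<^sup>+\<omega>. ennreal (min (Y n \<omega>) K ^ k) + ennreal (1 / K) * ennreal (Y n \<omega> ^ Suc k) \<partial>M)"
      proof (rule nn_integral_mono)
        fix \<omega> assume w: "\<omega> \<in> space M"
        have "Y n \<omega> ^ k \<le> min (Y n \<omega>) K ^ k + 1 / K * Y n \<omega> ^ Suc k"
        proof (cases "Y n \<omega> \<le> K")
          case True
          then show ?thesis using nn[OF w, of n] K by (simp add: min_def)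
        next
          case False
          then have "1 * Y n \<omega> ^ k \<le> (Y n \<omega> / K) * Y n \<omega> ^ k"
            using nn[OF w, of n] K by (intro mult_right_mono) (auto simp: field_simps)
          then have "Y n \<omega> ^ k \<le> 1 / K * Y n \<omega> ^ Suc k" by (simp add: field_simps)
          moreover have "0 \<le> min (Y n \<omega>) K ^ k" using nn[OF w, of n] K by simp
          ultimately show ?thesis by linarith
        qed
        then show "ennreal (Y n \<omega> ^ k) \<le> ennreal (min (Y n \<omega>) K ^ k) + ennreal (1 / K) * ennreal (Y n \<omega> ^ Suc k)"
          using nn[OF w, of n] K by (subst ennreal_mult[symmetric]) (auto simp: ennreal_plus[symmetric] simp del: ennreal_plus power_Suc)
      qed
      also have "\<dots> = (\<integral>\<^sup>+\<omega>. ennreal (min (Y n \<omega>) K ^ k) \<partial>M) + ennreal (1 / K) * (\<integral>\<^sup>+\<omega>. ennreal (Y n \<omega> ^ Suc k) \<partial>M)"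
        by (subst nn_integral_add) (auto simp: nn_integral_cmult)
      also have "\<dots> \<le> (\<integral>\<^sup>+\<omega>. ennreal (min (Y n \<omega>) K ^ k) \<partial>M) + ennreal (1 / K) * ennreal C"
        by (intro add_left_mono mult_left_mono bd) auto
      also have "ennreal (1 / K) * ennreal C = ennreal (C / K)"
        using K C by (simp add: ennreal_mult[symmetric])
      finally show ?thesis .
    qed
    have "(\<lambda>n. \<integral>\<^sup>+\<omega>. ennreal (min (Y n \<omega>) K ^ k) \<partial>M) \<longlonglongrightarrow> (\<integral>\<^sup>+\<omega>. ennreal (min (l \<omega>) K ^ k) \<partial>M)"
    proof (rule nn_integral_dominated_convergence[where w="\<lambda>_. ennreal (K ^ k)"])
      show "AE \<omega> in M. ennreal (min (Y n \<omega>) K ^ k) \<le> ennreal (K ^ k)" for n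
        using nn K by (intro AE_I2 ennreal_leI power_mono) auto
      show "AE \<omega> in M. (\<lambda>n. ennreal (min (Y n \<omega>) K ^ k)) \<longlonglongrightarrow> ennreal (min (l \<omega>) K ^ k)"
        using lim by eventually_elim (intro tendsto_intros)
      show "(\<integral>\<^sup>+\<omega>. ennreal (K ^ k) \<partial>M) < \<infinity>"
        using emeasure_finite[of "space M"] by (simp add: less_top[symmetric] ennreal_mult_eq_top_iff)
    qed measurable
    then have "(\<lambda>n. (\<integral>\<^sup>+\<omega>. ennreal (min (Y n \<omega>) K ^ k) \<partial>M) + ennreal (C / K)) \<longlonglongrightarrow> (\<integral>\<^sup>+\<omega>. ennreal (min (l \<omega>) K ^ k) \<partial>M) + ennreal (C / K)"
      by (intro tendsto_add tendsto_const)
    then have "ennreal c \<le> (\<integral>\<^sup>+\<omega>. ennreal (min (l \<omega>) K ^ k) \<partial>M) + ennreal (C / K)"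
      by (rule LIMSEQ_le[OF conv]) (use b in auto)
    also have "\<dots> \<le> (\<integral>\<^sup>+\<omega>. ennreal (l \<omega> ^ k) \<partial>M) + ennreal (C / K)"
      using l0 K by (intro add_right_mono nn_integral_mono_AE) (auto elim!: eventually_mono intro!: ennreal_leI power_mono)
    finally show ?thesis .
  qed
  have "(\<lambda>n. (\<integral>\<^sup>+\<omega>. ennreal (l \<omega> ^ k) \<partial>M) + ennreal (C * (1 / real (Suc n)))) \<longlonglongrightarrow> (\<integral>\<^sup>+\<omega>. ennreal (l \<omega> ^ k) \<partial>M) + ennreal (C * 0)"
    using LIMSEQ_inverse_real_of_nat by (intro tendsto_intros) (simp add: inverse_eq_divide)
  then have "ennreal c \<le> (\<integral>\<^sup>+\<omega>. ennreal (l \<omega> ^ k) \<partial>M) + ennreal (C * 0)"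
    by (rule LIMSEQ_le_const) (use K[of "real (Suc _)"] in auto)
  then show "ennreal c \<le> (\<integral>\<^sup>+\<omega>. ennreal (l \<omega> ^ k) \<partial>M)" by simp
qed

section \<open>Continuous Brownian motion and its history\<close>

text \<open>Along such a grid, the values of a path at the times in \<open>J\<close> are partial
  sums of the increments numbered below \<open>n\<close>, and the increment from \<open>s\<close> to
  \<open>u\<close> is the one numbered \<open>n\<close>.\<close>

lemma sorted_grid:
  fixes J :: "real set"
  assumes J: "finite J" "J \<subseteq> {0..s}" and s: "0 \<le> s" "s < u"
  obtains n :: nat and p where "p 0 = 0" "p n = s" "p (Suc n) = u" "\<And>i. i \<le> n \<Longrightarrow> p i \<le> p (Suc i)"
    "J \<subseteq> p ` {..n}"
proof -
  define xs where "xs = sorted_list_of_set (J \<union> {0, s})"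
  have fin: "finite (J \<union> {0, s})" using J by simp
  have set: "set xs = J \<union> {0, s}" unfolding xs_def using fin by (rule set_sorted_list_of_set)
  have sorted: "sorted xs" unfolding xs_def by simp
  have ne: "xs \<noteq> []" using set by auto
  define n where "n = length xs - 1"
  have len: "length xs = Suc n" using ne by (simp add: n_def)
  define p where "p i = (if i \<le> n then xs ! i else u)" for i
  have in_set: "xs ! i \<in> {0..s}" if "i \<le> n" for i
    using nth_mem[of i xs] that len set J s by auto
  have "p ` {..n} = (\<lambda>i. xs ! i) ` {..<length xs}"
    unfolding len lessThan_Suc_atMost by (rule image_cong) (auto simp: p_def)
  also have "\<dots> = set xs"
    unfolding set_conv_nth by blast
  finally have img: "p ` {..n} = J \<union> {0, s}" unfolding set .
  have mono: "p i \<le> p j" if "i \<le> j" "j \<le> n" for i j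
    using that sorted len by (auto simp: p_def intro: sorted_nth_mono)
  have "0 \<in> p ` {..n}" "s \<in> p ` {..n}" using img by auto
  then obtain i j where ij: "i \<le> n" "p i = 0" "j \<le> n" "p j = s" by (metis atMost_iff imageE)
  show thesis
  proof (rule that[of p n])
    show "p 0 = 0" using mono[of 0 i] ij in_set[of 0] by (auto simp: p_def)
    show "p n = s" using mono[of j n] ij in_set[of n] by (auto simp: p_def)
    show "p (Suc n) = u" by (simp add: p_def)
    show "p i \<le> p (Suc i)" if "i \<le> n" for i
      using that mono[of i "Suc i"] in_set[of i] s by (cases "i = n") (auto simp: p_def)
    show "J \<subseteq> p ` {..n}" using img by auto
  qed
qed

text \<open>Continuity and the starting value hold at every sample point and measurability at every
  real time, so path arguments carry no exceptional sets. \<open>continuous_modification\<close>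
  provides such a process.\<close>

locale continuous_brownian_motion = prob_space M for M :: "'a measure" +
  fixes B :: "real \<Rightarrow> 'a \<Rightarrow> real"
  assumes B_measurable[measurable]: "B t \<in> borel_measurable M"
    and B_continuous: "\<omega> \<in> space M \<Longrightarrow> continuous_on UNIV (\<lambda>t. B t \<omega>)"
    and B_0: "\<omega> \<in> space M \<Longrightarrow> B 0 \<omega> = 0"
    and B_increment: "0 \<le> s \<Longrightarrow> s < t \<Longrightarrow>
      distributed M lborel (\<lambda>\<omega>. B t \<omega> - B s \<omega>) (normal_density 0 (sqrt (t - s)))"
    and B_indep: "0 \<le> p 0 \<Longrightarrow> (\<And>i. i < n \<Longrightarrow> p i \<le> p (Suc i)) \<Longrightarrow>
      indep_vars (\<lambda>_. borel) (\<lambda>i \<omega>. B (p (Suc i)) \<omega> - B (p i) \<omega>) {..<n::nat}"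
begin

definition cylinders :: "real \<Rightarrow> 'a set set" where
  "cylinders s = {{\<omega> \<in> space M. \<forall>r\<in>J. B r \<omega> \<in> A r} | J A. finite J \<and> J \<subseteq> {0..s} \<and> (\<forall>r\<in>J. A r \<in> sets borel)}"

text \<open>The natural filtration, without null sets added. Its generator is closed under
  intersection, so independence can be checked on cylinders.\<close>

definition hist :: "real \<Rightarrow> 'a measure" where
  "hist s = sigma (space M) (cylinders s)"

lemma cylinders_subset: "cylinders s \<subseteq> sets M"
proof
  fix E assume "E \<in> cylinders s"
  then obtain J A where E: "E = {\<omega> \<in> space M. \<forall>r\<in>J. B r \<omega> \<in> A r}" "finite J" "\<And>r. r \<in> J \<Longrightarrow> A r \<in> sets borel"
    unfolding cylinders_def by blast
  show "E \<in> sets M"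
    unfolding E(1)
  proof (rule sets.sets_Collect_finite_All[OF _ E(2)])
    fix r assume "r \<in> J"
    from measurable_sets_Collect[OF B_measurable, of "\<lambda>x. x \<in> A r" r] E(3)[OF this]
    show "{\<omega> \<in> space M. B r \<omega> \<in> A r} \<in> sets M" by simp
  qed
qed

lemma space_hist[simp]: "space (hist s) = space M"
  using cylinders_subset sets.space_closed unfolding hist_def by (intro space_measure_of) blast

lemma sets_hist: "sets (hist s) = sigma_sets (space M) (cylinders s)"
  using cylinders_subset sets.space_closed unfolding hist_def by (intro sets_measure_of) blast

lemma sets_hist_subset: "sets (hist s) \<subseteq> sets M"
  unfolding sets_hist using cylinders_subset by (rule sets.sigma_sets_subset)

lemma measurable_hist: "f \<in> hist s \<rightarrow>\<^sub>M N \<Longrightarrow> f \<in> M \<rightarrow>\<^sub>M N"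
  using sets_hist_subset by (auto simp: measurable_def)

lemma B_measurable_hist:
  assumes "0 \<le> r" "r \<le> s"
  shows "B r \<in> borel_measurable (hist s)"
proof (rule measurableI)
  fix A :: "real set" assume A: "A \<in> sets borel"
  have "B r -` A \<inter> space M \<in> cylinders s"
    unfolding cylinders_def using assms A
    by (intro CollectI exI[of _ "{r}"] exI[of _ "\<lambda>_. A"]) auto
  then show "B r -` A \<inter> space (hist s) \<in> sets (hist s)"
    by (simp add: sets_hist)
qed simp

lemma Int_stable_cylinders: "Int_stable (cylinders s)"
proof (rule Int_stableI)
  fix a b assume "a \<in> cylinders s" "b \<in> cylinders s"
  then obtain J A K C where
    a: "a = {\<omega> \<in> space M. \<forall>r\<in>J. B r \<omega> \<in> A r}" "finite J" "J \<subseteq> {0..s}" "\<forall>r\<in>J. A r \<in> sets borel" and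
    b: "b = {\<omega> \<in> space M. \<forall>r\<in>K. B r \<omega> \<in> C r}" "finite K" "K \<subseteq> {0..s}" "\<forall>r\<in>K. C r \<in> sets borel"
    unfolding cylinders_def by blast
  define D where "D r = (if r \<in> J then A r else UNIV) \<inter> (if r \<in> K then C r else UNIV)" for r
  have "a \<inter> b = {\<omega> \<in> space M. \<forall>r\<in>J \<union> K. B r \<omega> \<in> D r}"
    unfolding a(1) b(1) D_def by auto
  moreover have "\<forall>r\<in>J \<union> K. D r \<in> sets borel"
    using a(4) b(4) by (simp add: D_def)
  ultimately show "a \<inter> b \<in> cylinders s"
    unfolding cylinders_def using a(2,3) b(2,3) by (intro CollectI exI[of _ "J \<union> K"] exI[of _ D] conjI) simp_all
qed

text \<open>On a grid through the times of the cylinder, \<open>E\<close> depends only on the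
  increments numbered below \<open>n\<close>, while \<open>B u - B s\<close> is the increment
  numbered \<open>n\<close>; disjoint blocks of independent increments are independent.\<close>

lemma prob_cylinder_increment:
  assumes E: "E \<in> cylinders s" and s: "0 \<le> s" "s < u" and C: "C \<in> sets borel"
  shows "prob (E \<inter> ((\<lambda>\<omega>. B u \<omega> - B s \<omega>) -` C \<inter> space M)) = prob E * prob ((\<lambda>\<omega>. B u \<omega> - B s \<omega>) -` C \<inter> space M)"
proof -
  obtain J A where
    J: "E = {\<omega> \<in> space M. \<forall>r\<in>J. B r \<omega> \<in> A r}" "finite J" "J \<subseteq> {0..s}" "\<And>r. r \<in> J \<Longrightarrow> A r \<in> sets borel"
    using E unfolding cylinders_def by blast
  obtain n :: nat and p where p: "p 0 = 0" "p n = s" "p (Suc n) = u" "\<And>i. i \<le> n \<Longrightarrow> p i \<le> p (Suc i)"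
    "J \<subseteq> p ` {..n}"
    by (rule sorted_grid[OF J(2,3) s], rule that, assumption+)
  have "\<exists>j. \<forall>r\<in>J. j r \<le> n \<and> p (j r) = r"
    using p(5) by (intro bchoice) blast
  then obtain j where j: "\<And>r. r \<in> J \<Longrightarrow> j r \<le> n" "\<And>r. r \<in> J \<Longrightarrow> p (j r) = r" by blast
  define D where "D i \<omega> = B (p (Suc i)) \<omega> - B (p i) \<omega>" for i \<omega>
  have "indep_vars (\<lambda>_. borel) D {..<Suc n}"
    unfolding D_def by (rule B_indep) (simp_all add: p(1,4))
  then have ind: "indep_var (PiM {..<n} (\<lambda>_. borel)) (\<lambda>\<omega>. restrict (\<lambda>i. D i \<omega>) {..<n})
      (PiM {n} (\<lambda>_. borel)) (\<lambda>\<omega>. restrict (\<lambda>i. D i \<omega>) {n})"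
    by (rule indep_var_restrict) auto
  define E' where "E' = {y \<in> space (PiM {..<n} (\<lambda>_. borel :: real measure)). \<forall>r\<in>J. (\<Sum>i<j r. y i) \<in> A r}"
  define C' where "C' = {y \<in> space (PiM {n} (\<lambda>_. borel :: real measure)). y n \<in> C}"
  have E': "E' \<in> sets (PiM {..<n} (\<lambda>_. borel))"
    unfolding E'_def
  proof (rule sets.sets_Collect_finite_All[OF _ J(2)])
    fix r assume r: "r \<in> J"
    have "(\<lambda>y. \<Sum>i<j r. y i) \<in> borel_measurable (PiM {..<n} (\<lambda>_. borel :: real measure))"
      using j(1)[OF r] by (intro borel_measurable_sum measurable_component_singleton) auto
    from measurable_sets_Collect[OF this, of "\<lambda>x. x \<in> A r"] J(4)[OF r]
    show "{y \<in> space (PiM {..<n} (\<lambda>_. borel :: real measure)). (\<Sum>i<j r. y i) \<in> A r} \<in> sets (PiM {..<n} (\<lambda>_. borel))"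
      by simp
  qed
  have C': "C' \<in> sets (PiM {n} (\<lambda>_. borel))"
    unfolding C'_def using measurable_sets_Collect[OF measurable_component_singleton[of n "{n}" "\<lambda>_. borel :: real measure"], of "\<lambda>x. x \<in> C"] C
    by simp
  have B_sum: "B r \<omega> = (\<Sum>i<j r. D i \<omega>)" if "r \<in> J" "\<omega> \<in> space M" for r \<omega>
    using sum_lessThan_telescope[of "\<lambda>i. B (p i) \<omega>" "j r"] j(2)[OF that(1)] p(1) B_0[OF that(2)]
    unfolding D_def by simp
  have D_sum: "(\<Sum>i<j r. restrict (\<lambda>i. D i \<omega>) {..<n} i) = (\<Sum>i<j r. D i \<omega>)" if "r \<in> J" for r \<omega>
    using j(1)[OF that] by (intro sum.cong) auto
  have 1: "E = (\<lambda>\<omega>. restrict (\<lambda>i. D i \<omega>) {..<n}) -` E' \<inter> space M"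
  proof (intro set_eqI)
    fix \<omega>
    have "restrict (\<lambda>i. D i \<omega>) {..<n} \<in> space (PiM {..<n} (\<lambda>_. borel :: real measure))"
      by (simp add: space_PiM)
    then show "\<omega> \<in> E \<longleftrightarrow> \<omega> \<in> (\<lambda>\<omega>. restrict (\<lambda>i. D i \<omega>) {..<n}) -` E' \<inter> space M"
      unfolding J(1) E'_def using B_sum D_sum by (simp add: conj_commute cong: conj_cong ball_cong del: restrict_apply)
  qed
  have 2: "(\<lambda>\<omega>. B u \<omega> - B s \<omega>) -` C \<inter> space M = (\<lambda>\<omega>. restrict (\<lambda>i. D i \<omega>) {n}) -` C' \<inter> space M"
    unfolding C'_def by (auto simp: space_PiM D_def p(2,3))
  have "E \<inter> ((\<lambda>\<omega>. B u \<omega> - B s \<omega>) -` C \<inter> space M) =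
      (\<lambda>\<omega>. (restrict (\<lambda>i. D i \<omega>) {..<n}, restrict (\<lambda>i. D i \<omega>) {n})) -` (E' \<times> C') \<inter> space M"
    unfolding 1 2 by blast
  then show ?thesis
    using indep_varD[OF ind E' C'] 1 2 by simp
qed

text \<open>The cylinders and the preimages under the increment are both closed under intersection,
  so their independence passes to the generated sigma-algebras.\<close>

lemma prob_hist_increment:
  assumes E: "E \<in> sets (hist s)" and s: "0 \<le> s" "s < u" and C: "C \<in> sets borel"
  shows "prob (E \<inter> ((\<lambda>\<omega>. B u \<omega> - B s \<omega>) -` C \<inter> space M)) = prob E * prob ((\<lambda>\<omega>. B u \<omega> - B s \<omega>) -` C \<inter> space M)"
proof -
  let ?Y = "{(\<lambda>\<omega>. B u \<omega> - B s \<omega>) -` A \<inter> space M | A. A \<in> sets borel}"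
  have "indep_set (cylinders s) ?Y"
  proof (rule indep_setI)
    show "cylinders s \<subseteq> events" by (rule cylinders_subset)
    show "?Y \<subseteq> events" by (auto intro!: measurable_sets)
  qed (use prob_cylinder_increment[OF _ s] in auto)
  moreover have "Int_stable ?Y"
  proof (rule Int_stableI, safe)
    fix A A' :: "real set" assume "A \<in> sets borel" "A' \<in> sets borel"
    then show "\<exists>D. (\<lambda>\<omega>. B u \<omega> - B s \<omega>) -` A \<inter> space M \<inter> ((\<lambda>\<omega>. B u \<omega> - B s \<omega>) -` A' \<inter> space M) =
      (\<lambda>\<omega>. B u \<omega> - B s \<omega>) -` D \<inter> space M \<and> D \<in> sets borel"
      by (intro exI[of _ "A \<inter> A'"]) auto
  qed
  ultimately have "indep_set (sigma_sets (space M) (cylinders s)) (sigma_sets (space M) ?Y)"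
    by (intro indep_set_sigma_sets Int_stable_cylinders)
  then show ?thesis
    by (rule indep_setD) (use E C in \<open>auto simp: sets_hist intro!: sigma_sets.Basic\<close>)
qed

text \<open>Freezing the past: the history, taken as the identity map from \<open>M\<close> into the
  coarser space \<open>hist s\<close>, and the increment have a product measure as joint law, so
  Tonelli integrates the increment first.\<close>

lemma nn_integral_hist_increment:
  assumes s: "0 \<le> s" "s < u" and h[measurable]: "h \<in> borel_measurable (hist s \<Otimes>\<^sub>M borel)"
  shows "(\<integral>\<^sup>+\<omega>. h (\<omega>, B u \<omega> - B s \<omega>) \<partial>M) =
    (\<integral>\<^sup>+\<omega>. (\<integral>\<^sup>+w. h (\<omega>, w) * ennreal (normal_density 0 (sqrt (u - s)) w) \<partial>lborel) \<partial>M)"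
proof -
  let ?Y = "\<lambda>\<omega>. B u \<omega> - B s \<omega>"
  have id[measurable]: "(\<lambda>\<omega>. \<omega>) \<in> M \<rightarrow>\<^sub>M hist s" by (rule measurable_hist[of _ s]) simp
  interpret Y: prob_space "distr M borel ?Y" by (rule prob_space_distr) measurable
  have dY: "distr M borel ?Y = density lborel (\<lambda>w. ennreal (normal_density 0 (sqrt (u - s)) w))"
    using distributed_distr_eq_density[OF B_increment[OF s]] by (simp cong: distr_cong)
  have eq: "distr M (hist s) (\<lambda>\<omega>. \<omega>) \<Otimes>\<^sub>M distr M borel ?Y = distr M (hist s \<Otimes>\<^sub>M borel) (\<lambda>\<omega>. (\<omega>, ?Y \<omega>))"
  proof (rule pair_measure_eqI)
    show "sigma_finite_measure (distr M (hist s) (\<lambda>\<omega>. \<omega>))"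
      by (intro prob_space_imp_sigma_finite prob_space_distr id)
    show "sigma_finite_measure (distr M borel ?Y)" by unfold_locales
    fix E C assume "E \<in> sets (distr M (hist s) (\<lambda>\<omega>. \<omega>))" and "C \<in> sets (distr M borel ?Y)"
    then have EC[measurable]: "E \<in> sets (hist s)" "C \<in> sets borel" by simp_all
    have "E \<subseteq> space M" using sets.sets_into_space[OF EC(1)] by simp
    then have "emeasure (distr M (hist s \<Otimes>\<^sub>M borel) (\<lambda>\<omega>. (\<omega>, ?Y \<omega>))) (E \<times> C) = emeasure M (E \<inter> (?Y -` C \<inter> space M))"
      by (subst emeasure_distr) (auto intro!: arg_cong[where f="emeasure M"])
    moreover have "emeasure (distr M (hist s) (\<lambda>\<omega>. \<omega>)) E = emeasure M E"
      using \<open>E \<subseteq> space M\<close> by (subst emeasure_distr) (auto simp: Int_absorb2)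
    moreover have "emeasure (distr M borel ?Y) C = emeasure M (?Y -` C \<inter> space M)"
      by (subst emeasure_distr) auto
    ultimately show "emeasure (distr M (hist s) (\<lambda>\<omega>. \<omega>)) E * emeasure (distr M borel ?Y) C =
      emeasure (distr M (hist s \<Otimes>\<^sub>M borel) (\<lambda>\<omega>. (\<omega>, ?Y \<omega>))) (E \<times> C)"
      using prob_hist_increment[OF EC(1) s EC(2)] by (simp add: emeasure_eq_measure ennreal_mult[symmetric])
  qed simp
  have "(\<integral>\<^sup>+\<omega>. h (\<omega>, ?Y \<omega>) \<partial>M) = (\<integral>\<^sup>+p. h p \<partial>distr M (hist s \<Otimes>\<^sub>M borel) (\<lambda>\<omega>. (\<omega>, ?Y \<omega>)))"
    by (subst nn_integral_distr) auto
  also have "\<dots> = (\<integral>\<^sup>+p. h p \<partial>(distr M (hist s) (\<lambda>\<omega>. \<omega>) \<Otimes>\<^sub>M distr M borel ?Y))"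
    by (simp add: eq)
  also have "\<dots> = (\<integral>\<^sup>+\<omega>. (\<integral>\<^sup>+w. h (\<omega>, w) \<partial>distr M borel ?Y) \<partial>distr M (hist s) (\<lambda>\<omega>. \<omega>))"
    by (subst Y.nn_integral_fst[symmetric]) auto
  also have "\<dots> = (\<integral>\<^sup>+\<omega>. (\<integral>\<^sup>+w. h (\<omega>, w) \<partial>distr M borel ?Y) \<partial>M)"
    by (subst nn_integral_distr) (auto intro!: Y.borel_measurable_nn_integral)
  also have "\<dots> = (\<integral>\<^sup>+\<omega>. (\<integral>\<^sup>+w. h (\<omega>, w) * ennreal (normal_density 0 (sqrt (u - s)) w) \<partial>lborel) \<partial>M)"
    unfolding dY by (intro nn_integral_cong) (subst nn_integral_density, auto simp: mult.commute)
  finally show ?thesis .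
qed

end

section \<open>The Markov property\<close>

locale drifted_brownian_motion = continuous_brownian_motion M B for M :: "'a measure" and B +
  fixes l :: real
  assumes l_pos: "0 < l"
begin

definition X :: "real \<Rightarrow> 'a \<Rightarrow> real" where
  "X t \<omega> = B t \<omega> + l * t"

lemma X_measurable[measurable]: "X t \<in> borel_measurable M"
  unfolding X_def by measurable

lemma X_0: "\<omega> \<in> space M \<Longrightarrow> X 0 \<omega> = 0"
  by (simp add: X_def B_0)

lemma X_continuous: "\<omega> \<in> space M \<Longrightarrow> continuous_on UNIV (\<lambda>t. X t \<omega>)"
  unfolding X_def by (intro continuous_intros B_continuous)

lemma X_measurable_hist: "0 \<le> r \<Longrightarrow> r \<le> s \<Longrightarrow> X r \<in> borel_measurable (hist s)"
  unfolding X_def by (intro borel_measurable_add B_measurable_hist) auto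

lemma X_measurable_pair: "(\<lambda>(t, \<omega>). X t \<omega>) \<in> borel_measurable (borel \<Otimes>\<^sub>M M)"
  by (intro borel_measurable_continuous_process X_continuous) auto

text \<open>\<open>X u\<close> is \<open>X s\<close> plus an increment of \<open>B\<close> plus
  \<open>l * (u - s)\<close>; a translation moves this last term into the mean of the normal
  density.\<close>

lemma nn_integral_X_markov:
  assumes s: "0 \<le> s" "s < u" and Z[measurable]: "Z \<in> borel_measurable (hist s)"
    and f[measurable]: "f \<in> borel_measurable borel"
  shows "(\<integral>\<^sup>+\<omega>. Z \<omega> * f (X u \<omega>) \<partial>M) =
    (\<integral>\<^sup>+\<omega>. Z \<omega> * (\<integral>\<^sup>+y. f (X s \<omega> + y) * ennreal (normal_density (l * (u - s)) (sqrt (u - s)) y) \<partial>lborel) \<partial>M)"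
proof -
  note [measurable] = X_measurable_hist[OF s(1) order_refl]
  have "(\<integral>\<^sup>+\<omega>. Z \<omega> * f (X u \<omega>) \<partial>M) =
      (\<integral>\<^sup>+\<omega>. (\<lambda>p. Z (fst p) * f (X s (fst p) + (snd p + l * (u - s)))) (\<omega>, B u \<omega> - B s \<omega>) \<partial>M)"
    by (simp add: X_def algebra_simps)
  also have "\<dots> = (\<integral>\<^sup>+\<omega>. (\<integral>\<^sup>+w. (\<lambda>p. Z (fst p) * f (X s (fst p) + (snd p + l * (u - s)))) (\<omega>, w)
      * ennreal (normal_density 0 (sqrt (u - s)) w) \<partial>lborel) \<partial>M)"
    by (rule nn_integral_hist_increment[OF s]) measurable
  also have "\<dots> = (\<integral>\<^sup>+\<omega>. Z \<omega> * (\<integral>\<^sup>+w. f (X s \<omega> + (w + l * (u - s))) * ennreal (normal_density 0 (sqrt (u - s)) w) \<partial>lborel) \<partial>M)"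
    by (simp add: mult.assoc nn_integral_cmult)
  also have "\<dots> = (\<integral>\<^sup>+\<omega>. Z \<omega> * (\<integral>\<^sup>+y. f (X s \<omega> + y) * ennreal (normal_density (l * (u - s)) (sqrt (u - s)) y) \<partial>lborel) \<partial>M)"
  proof (rule nn_integral_cong)
    fix \<omega>
    have "(\<integral>\<^sup>+y. f (X s \<omega> + y) * ennreal (normal_density (l * (u - s)) (sqrt (u - s)) y) \<partial>lborel) =
        (\<integral>\<^sup>+w. f (X s \<omega> + (w + l * (u - s))) * ennreal (normal_density 0 (sqrt (u - s)) w) \<partial>lborel)"
      by (subst nn_integral_real_affine[where c=1 and t="l * (u - s)"])
        (auto simp: normal_density_def add.commute)
    then show "Z \<omega> * (\<integral>\<^sup>+w. f (X s \<omega> + (w + l * (u - s))) * ennreal (normal_density 0 (sqrt (u - s)) w) \<partial>lborel) =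
      Z \<omega> * (\<integral>\<^sup>+y. f (X s \<omega> + y) * ennreal (normal_density (l * (u - s)) (sqrt (u - s)) y) \<partial>lborel)"
      by simp
  qed
  finally show ?thesis .
qed

text \<open>The potential (Green) operator of \<open>X\<close>: the expected integral of
  \<open>f\<close> along the path started at \<open>x\<close>. Its kernel is the time integral of
  the transition density found in \<open>nn_integral_normal_density_time\<close>.\<close>

definition potential :: "(real \<Rightarrow> ennreal) \<Rightarrow> real \<Rightarrow> ennreal" where
  "potential f x = (\<integral>\<^sup>+y. f (x + y) * ennreal (exp (min 0 (2 * l * y)) / l) \<partial>lborel)"

lemma potential_measurable[measurable]:
  assumes [measurable]: "f \<in> borel_measurable borel"
  shows "potential f \<in> borel_measurable borel"
  unfolding potential_def by measurable

text \<open>Tonelli lets the time integral act on the transition density alone. Its closed form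
  excludes displacement 0, a Lebesgue null set.\<close>

lemma nn_integral_semigroup:
  assumes f[measurable]: "f \<in> borel_measurable borel"
  shows "(\<integral>\<^sup>+u. (\<integral>\<^sup>+y. f (x + y) * ennreal (normal_density (l * (u - s)) (sqrt (u - s)) y) \<partial>lborel) * indicator {s<..} u \<partial>lborel) = potential f x"
proof -
  have [measurable]: "(\<lambda>(u, y). normal_density (l * u) (sqrt u) y) \<in> borel_measurable (borel \<Otimes>\<^sub>M borel)"
    unfolding normal_density_def by measurable
  have "(\<integral>\<^sup>+u. (\<integral>\<^sup>+y. f (x + y) * ennreal (normal_density (l * (u - s)) (sqrt (u - s)) y) \<partial>lborel) * indicator {s<..} u \<partial>lborel)
      = (\<integral>\<^sup>+u. (\<integral>\<^sup>+y. f (x + y) * ennreal (normal_density (l * u) (sqrt u) y) \<partial>lborel) * indicator {0<..} u \<partial>lborel)"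
    by (subst nn_integral_real_affine[where c=1 and t=s]) (auto simp: indicator_def)
  also have "\<dots> = (\<integral>\<^sup>+u. (\<integral>\<^sup>+y. f (x + y) * (ennreal (normal_density (l * u) (sqrt u) y) * indicator {0<..} u) \<partial>lborel) \<partial>lborel)"
    by (simp add: nn_integral_multc[symmetric] mult.assoc)
  also have "\<dots> = (\<integral>\<^sup>+y. (\<integral>\<^sup>+u. f (x + y) * (ennreal (normal_density (l * u) (sqrt u) y) * indicator {0<..} u) \<partial>lborel) \<partial>lborel)"
    by (rule lborel_pair.Fubini') measurable
  also have "\<dots> = (\<integral>\<^sup>+y. f (x + y) * (\<integral>\<^sup>+u. ennreal (normal_density (l * u) (sqrt u) y) * indicator {0<..} u \<partial>lborel) \<partial>lborel)"
    by (intro nn_integral_cong nn_integral_cmult) measurable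
  also have "\<dots> = potential f x"
    unfolding potential_def using AE_lborel_singleton[of 0]
    by (intro nn_integral_cong_AE) (auto elim!: eventually_mono simp: nn_integral_normal_density_time[OF l_pos])
  finally show ?thesis .
qed

text \<open>Given the history up to \<open>s\<close>, the expected future integral of
  \<open>f\<close> depends on \<open>X s\<close> only and is its potential there. The weight
  \<open>Z\<close> stands for the earlier times of a moment.\<close>

lemma nn_integral_markov_potential:
  assumes s: "0 \<le> s" and Z[measurable]: "Z \<in> borel_measurable (hist s)"
    and f[measurable]: "f \<in> borel_measurable borel"
  shows "(\<integral>\<^sup>+u. (\<integral>\<^sup>+\<omega>. Z \<omega> * f (X u \<omega>) \<partial>M) * indicator {s<..} u \<partial>lborel) = (\<integral>\<^sup>+\<omega>. Z \<omega> * potential f (X s \<omega>) \<partial>M)"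
proof -
  have [measurable]: "Z \<in> borel_measurable M" by (rule measurable_hist[OF Z])
  have [measurable]: "(\<lambda>(u, y). normal_density (l * u) (sqrt u) y) \<in> borel_measurable (borel \<Otimes>\<^sub>M borel)"
    unfolding normal_density_def by measurable
  interpret P: pair_sigma_finite M lborel ..
  let ?k = "\<lambda>\<omega> u. \<integral>\<^sup>+y. f (X s \<omega> + y) * ennreal (normal_density (l * (u - s)) (sqrt (u - s)) y) \<partial>lborel"
  have "(\<integral>\<^sup>+u. (\<integral>\<^sup>+\<omega>. Z \<omega> * f (X u \<omega>) \<partial>M) * indicator {s<..} u \<partial>lborel) =
      (\<integral>\<^sup>+u. (\<integral>\<^sup>+\<omega>. Z \<omega> * ?k \<omega> u \<partial>M) * indicator {s<..} u \<partial>lborel)"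
    using nn_integral_X_markov[OF s _ Z f] by (intro nn_integral_cong) (auto simp: indicator_def)
  also have "\<dots> = (\<integral>\<^sup>+u. (\<integral>\<^sup>+\<omega>. Z \<omega> * (?k \<omega> u * indicator {s<..} u) \<partial>M) \<partial>lborel)"
    by (simp add: nn_integral_multc[symmetric] mult.assoc)
  also have "\<dots> = (\<integral>\<^sup>+\<omega>. (\<integral>\<^sup>+u. Z \<omega> * (?k \<omega> u * indicator {s<..} u) \<partial>lborel) \<partial>M)"
    by (rule P.Fubini') measurable
  also have "\<dots> = (\<integral>\<^sup>+\<omega>. Z \<omega> * potential f (X s \<omega>) \<partial>M)"
    by (intro nn_integral_cong) (subst nn_integral_cmult, measurable, simp add: nn_integral_semigroup)
  finally show ?thesis .
qed

text \<open>Tonelli on the triangle \<open>0 < s < u\<close>: the later time is integrated first and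
  is absorbed into the potential at the earlier one. This removes one time from the iterated
  integral behind a moment.\<close>

lemma nn_integral_occupation_step:
  fixes Z :: "real \<Rightarrow> 'a \<Rightarrow> ennreal"
  assumes Z: "\<And>s. 0 \<le> s \<Longrightarrow> Z s \<in> borel_measurable (hist s)"
    and [measurable]: "(\<lambda>(s, \<omega>). Z s \<omega>) \<in> borel_measurable (borel \<Otimes>\<^sub>M M)"
    and f[measurable]: "f \<in> borel_measurable borel"
  shows "(\<integral>\<^sup>+\<omega>. (\<integral>\<^sup>+u. (\<integral>\<^sup>+s. Z s \<omega> * indicator {0<..<u} s \<partial>lborel) * f (X u \<omega>) * indicator {0<..} u \<partial>lborel) \<partial>M) =
    (\<integral>\<^sup>+s. (\<integral>\<^sup>+\<omega>. Z s \<omega> * potential f (X s \<omega>) \<partial>M) * indicator {0<..} s \<partial>lborel)"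
proof -
  note X_measurable_pair[measurable]
  interpret P: pair_sigma_finite M lborel ..
  let ?h = "\<lambda>\<omega> s u. Z s \<omega> * f (X u \<omega>) * indicator {0<..} s * indicator {s<..} u"
  have "(\<integral>\<^sup>+\<omega>. (\<integral>\<^sup>+u. (\<integral>\<^sup>+s. Z s \<omega> * indicator {0<..<u} s \<partial>lborel) * f (X u \<omega>) * indicator {0<..} u \<partial>lborel) \<partial>M) =
      (\<integral>\<^sup>+\<omega>. (\<integral>\<^sup>+u. (\<integral>\<^sup>+s. ?h \<omega> s u \<partial>lborel) \<partial>lborel) \<partial>M)"
  proof (intro nn_integral_cong)
    fix \<omega> u assume [measurable]: "\<omega> \<in> space M"
    have "(\<integral>\<^sup>+s. Z s \<omega> * indicator {0<..<u} s \<partial>lborel) * f (X u \<omega>) * indicator {0<..} u =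
        (\<integral>\<^sup>+s. Z s \<omega> * indicator {0<..<u} s * (f (X u \<omega>) * indicator {0<..} u) \<partial>lborel)"
      by (subst nn_integral_multc) (auto simp: mult.assoc)
    also have "\<dots> = (\<integral>\<^sup>+s. ?h \<omega> s u \<partial>lborel)"
      by (intro nn_integral_cong) (auto simp: indicator_def)
    finally show "(\<integral>\<^sup>+s. Z s \<omega> * indicator {0<..<u} s \<partial>lborel) * f (X u \<omega>) * indicator {0<..} u = (\<integral>\<^sup>+s. ?h \<omega> s u \<partial>lborel)" .
  qed
  also have "\<dots> = (\<integral>\<^sup>+\<omega>. (\<integral>\<^sup>+s. (\<integral>\<^sup>+u. ?h \<omega> s u \<partial>lborel) \<partial>lborel) \<partial>M)"
    by (intro nn_integral_cong lborel_pair.Fubini') (unfold indicator_def greaterThan_iff, measurable)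
  also have "\<dots> = (\<integral>\<^sup>+s. (\<integral>\<^sup>+\<omega>. (\<integral>\<^sup>+u. ?h \<omega> s u \<partial>lborel) \<partial>M) \<partial>lborel)"
    by (rule P.Fubini'[symmetric]) (unfold indicator_def greaterThan_iff, measurable)
  also have "\<dots> = (\<integral>\<^sup>+s. (\<integral>\<^sup>+u. (\<integral>\<^sup>+\<omega>. ?h \<omega> s u \<partial>M) \<partial>lborel) \<partial>lborel)"
    by (intro nn_integral_cong P.Fubini'[symmetric]) (unfold indicator_def greaterThan_iff, measurable)
  also have "\<dots> = (\<integral>\<^sup>+s. (\<integral>\<^sup>+\<omega>. Z s \<omega> * potential f (X s \<omega>) \<partial>M) * indicator {0<..} s \<partial>lborel)"
  proof (intro nn_integral_cong)
    fix s :: real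
    have "(\<integral>\<^sup>+u. (\<integral>\<^sup>+\<omega>. ?h \<omega> s u \<partial>M) \<partial>lborel) = (\<integral>\<^sup>+u. (\<integral>\<^sup>+\<omega>. Z s \<omega> * f (X u \<omega>) \<partial>M) * indicator {s<..} u \<partial>lborel)" if "0 < s"
      using that by (simp add: nn_integral_multc)
    then show "(\<integral>\<^sup>+u. (\<integral>\<^sup>+\<omega>. ?h \<omega> s u \<partial>M) \<partial>lborel) = (\<integral>\<^sup>+\<omega>. Z s \<omega> * potential f (X s \<omega>) \<partial>M) * indicator {0<..} s"
      using nn_integral_markov_potential[OF _ Z f, of s] by (cases "0 < s") auto
  qed
  finally show ?thesis .
qed

end

section \<open>Transience\<close>

context drifted_brownian_motion begin

text \<open>Completing the square: with \<open>h = u - s\<close>, the weight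
  \<open>exp (- l * y)\<close> removes the mean \<open>l * h\<close> of the Gaussian and leaves the
  factor \<open>exp (- (l\<^sup>2 * h / 2))\<close>.\<close>

lemma nn_integral_exp_X:
  assumes s: "0 \<le> s" "s < u" and Z[measurable]: "Z \<in> borel_measurable (hist s)"
  shows "(\<integral>\<^sup>+\<omega>. Z \<omega> * ennreal (exp (- l * X u \<omega>)) \<partial>M) =
    ennreal (exp (- (l\<^sup>2 * (u - s) / 2))) * (\<integral>\<^sup>+\<omega>. Z \<omega> * ennreal (exp (- l * X s \<omega>)) \<partial>M)"
proof -
  let ?e = "exp (- (l\<^sup>2 * (u - s) / 2))"
  have [measurable]: "Z \<in> borel_measurable M" by (rule measurable_hist[OF Z])
  have nd: "exp (- l * (x + y)) * normal_density (l * (u - s)) (sqrt (u - s)) y =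
      ?e * exp (- l * x) * normal_density 0 (sqrt (u - s)) y" for x y
  proof -
    have "- l * (x + y) + - (y - l * (u - s))\<^sup>2 / (2 * (u - s)) = - (l\<^sup>2 * (u - s) / 2) + - l * x + - y\<^sup>2 / (2 * (u - s))"
      using s by (simp add: field_simps power2_eq_square)
    then have "exp (- l * (x + y)) * exp (- (y - l * (u - s))\<^sup>2 / (2 * (u - s))) = ?e * exp (- l * x) * exp (- y\<^sup>2 / (2 * (u - s)))"
      by (simp add: exp_add[symmetric])
    then show ?thesis using s by (simp add: normal_density_def)
  qed
  have one: "(\<integral>\<^sup>+y. ennreal (normal_density 0 (sqrt (u - s)) y) \<partial>lborel) = 1"
    using prob_space.emeasure_space_1[OF prob_space_normal_density[of "sqrt (u - s)" 0]] s
    by (simp add: emeasure_density)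
  have "(\<integral>\<^sup>+\<omega>. Z \<omega> * ennreal (exp (- l * X u \<omega>)) \<partial>M) =
    (\<integral>\<^sup>+\<omega>. Z \<omega> * (\<integral>\<^sup>+y. ennreal (exp (- l * (X s \<omega> + y))) * ennreal (normal_density (l * (u - s)) (sqrt (u - s)) y) \<partial>lborel) \<partial>M)"
    by (rule nn_integral_X_markov[OF s Z]) measurable
  also have "\<dots> = (\<integral>\<^sup>+\<omega>. Z \<omega> * (\<integral>\<^sup>+y. ennreal (?e * exp (- l * X s \<omega>)) * ennreal (normal_density 0 (sqrt (u - s)) y) \<partial>lborel) \<partial>M)"
    by (simp only: ennreal_mult[symmetric] exp_ge_zero normal_density_nonneg nd mult_nonneg_nonneg)
  also have "\<dots> = (\<integral>\<^sup>+\<omega>. ennreal ?e * (Z \<omega> * ennreal (exp (- l * X s \<omega>))) \<partial>M)"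
    by (subst nn_integral_cmult) (auto simp: one ennreal_mult mult_ac)
  also have "\<dots> = ennreal ?e * (\<integral>\<^sup>+\<omega>. Z \<omega> * ennreal (exp (- l * X s \<omega>)) \<partial>M)"
    by (rule nn_integral_cmult) measurable
  finally show ?thesis .
qed

text \<open>This is the maximal inequality for the supermartingale \<open>exp (- l * X t)\<close>, whose mean decays like
  \<open>exp (- l\<^sup>2 * t / 2)\<close>; the full exponent \<open>2 * l\<close> would give a martingale and no decay.\<close>

lemma emeasure_grid_below:
  assumes T: "0 \<le> T" and h: "0 < h"
  shows "emeasure M {\<omega> \<in> space M. \<exists>i<n. X (T + real i * h) \<omega> < b} \<le> ennreal (exp (l * b - l\<^sup>2 * T / 2))"
proof -
  define t where "t i = T + real i * h" for i
  have t0: "0 \<le> t i" for i using T h by (simp add: t_def)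
  have tS: "t i < t (Suc i)" for i using h by (simp add: t_def algebra_simps)
  have tmono: "i \<le> j \<Longrightarrow> t i \<le> t j" for i j using h by (simp add: t_def)
  define S where "S i \<omega> = ennreal (exp (- l * X (t i) \<omega>))" for i \<omega>
  have S[measurable]: "S i \<in> borel_measurable M" for i unfolding S_def by measurable
  define N where "N n = {\<omega> \<in> space M. \<forall>i<n. b \<le> X (t i) \<omega>}" for n
  define E where "E n = {\<omega> \<in> space M. \<exists>i<n. X (t i) \<omega> < b}" for n
  have N[measurable]: "N n \<in> sets M" and E[measurable]: "E n \<in> sets M" for n unfolding N_def E_def by measurable
  \<comment> \<open>Survival through index \<open>n\<close> is decided at time \<open>t n\<close>,
    so it may serve as the weight when passing from \<open>t n\<close> to
    \<open>t (Suc n)\<close>.\<close>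
  have Nhist: "N (Suc n) \<in> sets (hist (t n))" for n
  proof -
    have Xm: "X (t i) \<in> borel_measurable (hist (t n))" if "i \<le> n" for i
      using that tmono t0 by (intro X_measurable_hist) auto
    have "{\<omega> \<in> space (hist (t n)). b \<le> X (t i) \<omega>} \<in> sets (hist (t n))" if "i \<in> {..n}" for i
      using Xm[of i] that by (intro borel_measurable_le) auto
    moreover have "finite {..n}" by simp
    ultimately have "{\<omega> \<in> space (hist (t n)). \<forall>i\<in>{..n}. b \<le> X (t i) \<omega>} \<in> sets (hist (t n))"
      by (rule sets.sets_Collect_finite_All)
    also have "{\<omega> \<in> space (hist (t n)). \<forall>i\<in>{..n}. b \<le> X (t i) \<omega>} = N (Suc n)"
      by (auto simp: N_def)
    finally show ?thesis .
  qed
  \<comment> \<open>Optional stopping by hand: the mean of \<open>S\<close> on the surviving paths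
    plus \<open>exp (- l * b)\<close> for each path that has crossed never exceeds the initial
    mean.\<close>
  have "(\<integral>\<^sup>+\<omega>. indicator (N n) \<omega> * S n \<omega> \<partial>M) + ennreal (exp (- l * b)) * emeasure M (E n) \<le> (\<integral>\<^sup>+\<omega>. S 0 \<omega> \<partial>M)" for n
  proof (induction n)
    case 0
    have "E 0 = {}" "N 0 = space M" by (auto simp: E_def N_def)
    moreover have "(\<integral>\<^sup>+\<omega>. indicator (space M) \<omega> * S 0 \<omega> \<partial>M) = (\<integral>\<^sup>+\<omega>. S 0 \<omega> \<partial>M)"
      by (intro nn_integral_cong) simp
    ultimately show ?case by simp
  next
    case (Suc n)
    \<comment> \<open>The paths whose first grid value below \<open>b\<close> has index
      \<open>n\<close>; on them \<open>S n\<close> is at least \<open>exp (- l * b)\<close>.\<close>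
    define C where "C = N n \<inter> {\<omega> \<in> space M. X (t n) \<omega> < b}"
    have C[measurable]: "C \<in> sets M" unfolding C_def by measurable
    have "E (Suc n) = E n \<union> C" "E n \<inter> C = {}"
      by (auto simp: E_def C_def N_def less_Suc_eq not_less)
    then have em: "emeasure M (E (Suc n)) = emeasure M (E n) + emeasure M C"
      by (metis plus_emeasure E C)
    have "(\<integral>\<^sup>+\<omega>. indicator (N (Suc n)) \<omega> * S (Suc n) \<omega> \<partial>M) =
        ennreal (exp (- (l\<^sup>2 * (t (Suc n) - t n) / 2))) * (\<integral>\<^sup>+\<omega>. indicator (N (Suc n)) \<omega> * S n \<omega> \<partial>M)"
      unfolding S_def by (rule nn_integral_exp_X[OF t0 tS]) (use Nhist in auto)
    also have "\<dots> \<le> 1 * (\<integral>\<^sup>+\<omega>. indicator (N (Suc n)) \<omega> * S n \<omega> \<partial>M)"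
      using tS[of n] by (intro mult_right_mono) (auto simp: ennreal_le_1)
    finally have 1: "(\<integral>\<^sup>+\<omega>. indicator (N (Suc n)) \<omega> * S (Suc n) \<omega> \<partial>M) \<le> (\<integral>\<^sup>+\<omega>. indicator (N (Suc n)) \<omega> * S n \<omega> \<partial>M)"
      by simp
    have "ennreal (exp (- l * b)) * emeasure M C = (\<integral>\<^sup>+\<omega>. ennreal (exp (- l * b)) * indicator C \<omega> \<partial>M)"
      by (simp add: nn_integral_cmult_indicator)
    also have "\<dots> \<le> (\<integral>\<^sup>+\<omega>. indicator C \<omega> * S n \<omega> \<partial>M)"
      using l_pos by (intro nn_integral_mono) (auto simp: indicator_def C_def S_def intro!: ennreal_leI)
    finally have 2: "ennreal (exp (- l * b)) * emeasure M C \<le> (\<integral>\<^sup>+\<omega>. indicator C \<omega> * S n \<omega> \<partial>M)" .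
    have "(\<integral>\<^sup>+\<omega>. indicator (N n) \<omega> * S n \<omega> \<partial>M) = (\<integral>\<^sup>+\<omega>. indicator (N (Suc n)) \<omega> * S n \<omega> + indicator C \<omega> * S n \<omega> \<partial>M)"
      by (intro nn_integral_cong) (auto simp: indicator_def N_def C_def less_Suc_eq)
    also have "\<dots> = (\<integral>\<^sup>+\<omega>. indicator (N (Suc n)) \<omega> * S n \<omega> \<partial>M) + (\<integral>\<^sup>+\<omega>. indicator C \<omega> * S n \<omega> \<partial>M)"
      by (rule nn_integral_add) measurable
    finally have 3: "(\<integral>\<^sup>+\<omega>. indicator (N n) \<omega> * S n \<omega> \<partial>M) =
      (\<integral>\<^sup>+\<omega>. indicator (N (Suc n)) \<omega> * S n \<omega> \<partial>M) + (\<integral>\<^sup>+\<omega>. indicator C \<omega> * S n \<omega> \<partial>M)" .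
    have "(\<integral>\<^sup>+\<omega>. indicator (N (Suc n)) \<omega> * S (Suc n) \<omega> \<partial>M) + ennreal (exp (- l * b)) * emeasure M (E (Suc n)) \<le>
      (\<integral>\<^sup>+\<omega>. indicator (N (Suc n)) \<omega> * S n \<omega> \<partial>M) + (ennreal (exp (- l * b)) * emeasure M (E n) + (\<integral>\<^sup>+\<omega>. indicator C \<omega> * S n \<omega> \<partial>M))"
      unfolding em distrib_left by (intro add_mono 1 2 order_refl)
    also have "\<dots> = (\<integral>\<^sup>+\<omega>. indicator (N n) \<omega> * S n \<omega> \<partial>M) + ennreal (exp (- l * b)) * emeasure M (E n)"
      unfolding 3 by (simp add: add_ac)
    also note Suc.IH
    finally show ?case .
  qed
  from order_trans[OF add_increasing[OF zero_le order_refl] this]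
  have "ennreal (exp (- l * b)) * emeasure M (E n) \<le> (\<integral>\<^sup>+\<omega>. S 0 \<omega> \<partial>M)" .
  also have "(\<integral>\<^sup>+\<omega>. S 0 \<omega> \<partial>M) = ennreal (exp (- (l\<^sup>2 * T / 2)))"
  proof (cases "T = 0")
    case True
    have "(\<integral>\<^sup>+\<omega>. S 0 \<omega> \<partial>M) = (\<integral>\<^sup>+\<omega>. 1 \<partial>M)"
      by (intro nn_integral_cong) (simp add: S_def t_def True X_0)
    then show ?thesis using True by (simp add: emeasure_space_1)
  next
    case False
    have "(\<integral>\<^sup>+\<omega>. 1 * ennreal (exp (- l * X T \<omega>)) \<partial>M) = ennreal (exp (- (l\<^sup>2 * (T - 0) / 2))) * (\<integral>\<^sup>+\<omega>. 1 * ennreal (exp (- l * X 0 \<omega>)) \<partial>M)"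
      using False T by (intro nn_integral_exp_X) auto
    also have "(\<integral>\<^sup>+\<omega>. 1 * ennreal (exp (- l * X 0 \<omega>)) \<partial>M) = (\<integral>\<^sup>+\<omega>. 1 \<partial>M)"
      by (intro nn_integral_cong) (simp add: X_0)
    finally show ?thesis by (simp add: S_def t_def emeasure_space_1)
  qed
  finally have "ennreal (exp (l * b)) * (ennreal (exp (- l * b)) * emeasure M (E n)) \<le> ennreal (exp (l * b)) * ennreal (exp (- (l\<^sup>2 * T / 2)))"
    by (rule mult_left_mono) simp
  moreover have "ennreal (exp (l * b)) * (ennreal (exp (- l * b)) * emeasure M (E n)) = emeasure M (E n)"
    by (simp add: mult.assoc[symmetric] ennreal_mult[symmetric] exp_add[symmetric])
  moreover have "ennreal (exp (l * b)) * ennreal (exp (- (l\<^sup>2 * T / 2))) = ennreal (exp (l * b - l\<^sup>2 * T / 2))"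
    by (simp add: ennreal_mult[symmetric] exp_add[symmetric])
  ultimately show ?thesis by (simp add: E_def t_def)
qed

text \<open>A continuous path below \<open>b\<close> at some time after \<open>T\<close> is seen
  there by all fine grids, so \<open>g T\<close> is 1. By Fatou and
  \<open>emeasure_grid_below\<close> the mean of \<open>g T\<close> decays exponentially in
  \<open>T\<close>, so almost surely some \<open>g T\<close> is below 1.\<close>

lemma X_eventually_ge: "AE \<omega> in M. \<exists>T\<ge>0. \<forall>t\<ge>T. b \<le> X t \<omega>"
proof -
  \<comment> \<open>With \<open>(Suc m)\<^sup>2\<close> points of mesh \<open>1 / Suc m\<close> the
    grid becomes finer and its horizon grows at the same time.\<close>
  define E where "E T m = {\<omega> \<in> space M. \<exists>i<(Suc m)\<^sup>2. X (real T + real i * (1 / real (Suc m))) \<omega> < b}" for T m :: nat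
  have E[measurable]: "E T m \<in> sets M" for T m unfolding E_def by measurable
  define g where "g T \<omega> = liminf (\<lambda>m. indicator (E T m) \<omega> :: ennreal)" for T \<omega>
  have g[measurable]: "g T \<in> borel_measurable M" for T unfolding g_def by measurable
  have gb: "(\<integral>\<^sup>+\<omega>. g T \<omega> \<partial>M) \<le> ennreal (exp (l * b - l\<^sup>2 * real T / 2))" for T
  proof -
    have "(\<integral>\<^sup>+\<omega>. g T \<omega> \<partial>M) \<le> liminf (\<lambda>m. \<integral>\<^sup>+\<omega>. indicator (E T m) \<omega> \<partial>M)"
      unfolding g_def by (rule nn_integral_liminf) measurable
    also have "\<dots> = liminf (\<lambda>m. emeasure M (E T m))" by simp
    also have "\<dots> \<le> liminf (\<lambda>m. ennreal (exp (l * b - l\<^sup>2 * real T / 2)))"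
      unfolding E_def by (intro Liminf_mono always_eventually allI emeasure_grid_below) auto
    finally show ?thesis by (simp add: Liminf_const)
  qed
  have "(\<lambda>T. ennreal (exp (l * b - l\<^sup>2 * real T / 2))) \<longlonglongrightarrow> ennreal 0"
    using l_pos by (intro tendsto_ennrealI) real_asymp
  then have "(\<integral>\<^sup>+\<omega>. (INF T. g T \<omega>) \<partial>M) \<le> ennreal 0"
  proof (rule LIMSEQ_le_const)
    show "\<exists>N. \<forall>T\<ge>N. (\<integral>\<^sup>+\<omega>. (INF T. g T \<omega>) \<partial>M) \<le> ennreal (exp (l * b - l\<^sup>2 * real T / 2))"
      by (intro exI allI impI order_trans[OF nn_integral_mono gb] INF_lower) simp
  qed
  then have "(\<integral>\<^sup>+\<omega>. (INF T. g T \<omega>) \<partial>M) = 0" by simp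
  then have "AE \<omega> in M. (INF T. g T \<omega>) = 0"
    by (subst (asm) nn_integral_0_iff_AE) auto
  then show ?thesis
    using AE_space
  proof eventually_elim
    fix \<omega> assume \<omega>: "(INF T. g T \<omega>) = 0" "\<omega> \<in> space M"
    then have "(INF T. g T \<omega>) < 1" by simp
    then obtain T where T: "g T \<omega> < 1" unfolding INF_less_iff by auto
    have "b \<le> X t \<omega>" if t: "real T \<le> t" for t
    proof (rule ccontr)
      assume "\<not> b \<le> X t \<omega>"
      then have lt: "X t \<omega> < b" by simp
      \<comment> \<open>Rounding up gives grid times just to the right of \<open>t\<close>, hence
        not before \<open>T\<close>; they are within the horizon once \<open>m\<close> exceeds
        \<open>t - T\<close>.\<close>
      define i where "i m = nat \<lceil>(t - real T) * real (Suc m)\<rceil>" for m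
      have lim: "(\<lambda>m. real T + real (i m) * (1 / real (Suc m))) \<longlonglongrightarrow> t"
      proof (rule tendsto_sandwich)
        have i: "(t - real T) * real (Suc m) \<le> real (i m)" "real (i m) \<le> (t - real T) * real (Suc m) + 1" for m
        proof -
          have "0 \<le> (t - real T) * real (Suc m)" using t by simp
          then show "(t - real T) * real (Suc m) \<le> real (i m)" "real (i m) \<le> (t - real T) * real (Suc m) + 1"
            unfolding i_def by linarith+
        qed
        show "\<forall>\<^sub>F m in sequentially. t \<le> real T + real (i m) * (1 / real (Suc m))"
          using i(1) by (intro always_eventually allI) (simp add: field_simps del: of_nat_Suc)
        show "\<forall>\<^sub>F m in sequentially. real T + real (i m) * (1 / real (Suc m)) \<le> t + 1 / real (Suc m)"
        proof (intro always_eventually allI)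
          fix m
          have "real (i m) * (1 / real (Suc m)) \<le> ((t - real T) * real (Suc m) + 1) * (1 / real (Suc m))"
            by (rule mult_right_mono[OF i(2)]) simp
          then show "real T + real (i m) * (1 / real (Suc m)) \<le> t + 1 / real (Suc m)"
            by (simp add: add_divide_distrib del: of_nat_Suc)
        qed
        show "(\<lambda>m. t + 1 / real (Suc m)) \<longlonglongrightarrow> t"
          using tendsto_add[OF tendsto_const LIMSEQ_inverse_real_of_nat, of t] by (simp add: inverse_eq_divide)
      qed simp
      have "(\<lambda>m. X (real T + real (i m) * (1 / real (Suc m))) \<omega>) \<longlonglongrightarrow> X t \<omega>"
        by (rule continuous_on_tendsto_compose[OF X_continuous[OF \<omega>(2)] lim]) auto
      then have ev1: "\<forall>\<^sub>F m in sequentially. X (real T + real (i m) * (1 / real (Suc m))) \<omega> < b"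
        using lt by (rule order_tendstoD)
      have ev2: "\<forall>\<^sub>F m in sequentially. i m < (Suc m)\<^sup>2"
        using eventually_gt_at_top[of "nat \<lceil>t - real T\<rceil>"]
      proof eventually_elim
        case (elim m)
        then have "t - real T \<le> real m" by linarith
        then have "(t - real T) * real (Suc m) \<le> real m * real (Suc m)" by (intro mult_right_mono) auto
        also have "\<dots> = real_of_int (int (m * Suc m))" by (simp add: algebra_simps)
        finally have "\<lceil>(t - real T) * real (Suc m)\<rceil> \<le> int (m * Suc m)" by (rule ceiling_le)
        then have "i m \<le> m * Suc m" unfolding i_def by linarith
        also have "\<dots> < (Suc m)\<^sup>2" by (simp add: power2_eq_square)
        finally show ?case .
      qed
      have "\<forall>\<^sub>F m in sequentially. indicator (E T m) \<omega> = (1 :: ennreal)"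
        using ev1 ev2 by eventually_elim (use \<omega> in \<open>auto simp: E_def indicator_def\<close>)
      then have "g T \<omega> = 1"
        unfolding g_def by (intro lim_imp_Liminf tendsto_eventually) auto
      then show False using T by simp
    qed
    then show "\<exists>T\<ge>0. \<forall>t\<ge>T. b \<le> X t \<omega>" by (intro exI[of _ "real T"]) auto
  qed
qed
end

section \<open>Moments of occupation functionals\<close>

text \<open>Continuity of \<open>f\<close> makes the occupation integral differentiable in time. The
  condition \<open>e < z\<close> keeps the support above the starting point 0, where the potential
  is then exact.\<close>

locale occupation_bump = drifted_brownian_motion M B l for M :: "'a measure" and B and l +
  fixes f :: "real \<Rightarrow> real" and z e c :: real
  assumes f_continuous: "continuous_on UNIV f"
    and f_nonneg: "0 \<le> f x"
    and f_support: "f x \<noteq> 0 \<Longrightarrow> x \<in> {z - e..z}"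
    and e: "0 < e" "e < z"
    and f_integral: "(\<integral>\<^sup>+x. ennreal (f x) \<partial>lborel) = ennreal c" and c: "0 \<le> c"
begin

lemma f_measurable[measurable]: "f \<in> borel_measurable borel"
  using f_continuous by (rule borel_measurable_continuous_onI)

text \<open>The oriented integral makes sense for negative \<open>s\<close> too, so the derivative
  is two-sided everywhere, including at time 0.\<close>

definition occ :: "real \<Rightarrow> 'a \<Rightarrow> real" where
  "occ s \<omega> = (LBINT r=0..s. f (X r \<omega>))"

lemma fX_continuous: "\<omega> \<in> space M \<Longrightarrow> continuous_on UNIV (\<lambda>t. f (X t \<omega>))"
  using continuous_on_compose2[OF f_continuous X_continuous] by auto

lemma occ_deriv:
  assumes "\<omega> \<in> space M"
  shows "DERIV (\<lambda>s. occ s \<omega>) s :> f (X s \<omega>)"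
proof -
  have "((\<lambda>s. occ s \<omega>) has_vector_derivative f (X s \<omega>)) (at s within {- \<bar>s\<bar> - 1..\<bar>s\<bar> + 1})"
    unfolding occ_def zero_ereal_def
    by (rule interval_integral_FTC2) (auto intro: continuous_on_subset[OF fX_continuous[OF assms]])
  moreover have "at s within {- \<bar>s\<bar> - 1..\<bar>s\<bar> + 1} = at s"
    by (rule at_within_Icc_at) auto
  ultimately show ?thesis
    by (simp add: has_real_derivative_iff_has_vector_derivative)
qed

lemma occ_0: "occ 0 \<omega> = 0"
  by (simp add: occ_def zero_ereal_def[symmetric])

lemma occ_nonneg:
  assumes "\<omega> \<in> space M" "0 \<le> s"
  shows "0 \<le> occ s \<omega>"
proof -
  have "occ 0 \<omega> \<le> occ s \<omega>"
    by (rule DERIV_nonneg_imp_nondecreasing[of 0 s "\<lambda>s. occ s \<omega>"]) (use assms occ_deriv f_nonneg in auto)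
  then show ?thesis by (simp add: occ_0)
qed

lemma occ_continuous: "\<omega> \<in> space M \<Longrightarrow> continuous_on UNIV (\<lambda>s. occ s \<omega>)"
  by (rule DERIV_continuous_on[where D="\<lambda>s. f (X s \<omega>)"]) (simp add: occ_deriv)

lemma occ_measurable_aux:
  fixes Y :: "real \<Rightarrow> 'a \<Rightarrow> real"
  assumes "\<And>r. Y r \<in> borel_measurable N" "\<And>\<omega>. \<omega> \<in> space N \<Longrightarrow> continuous_on UNIV (\<lambda>r. Y r \<omega>)"
  shows "(\<lambda>\<omega>. LBINT r=0..ereal s. f (Y r \<omega>)) \<in> borel_measurable N"
proof -
  have [measurable]: "(\<lambda>(r, \<omega>). Y r \<omega>) \<in> borel_measurable (borel \<Otimes>\<^sub>M N)"
    using assms by (rule borel_measurable_continuous_process)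
  show ?thesis
    unfolding interval_lebesgue_integral_def set_lebesgue_integral_def by measurable
qed

lemma occ_measurable_hist:
  assumes "0 \<le> s"
  shows "occ s \<in> borel_measurable (hist s)"
proof -
  \<comment> \<open>Clamping the time to \<open>{0..s}\<close> leaves the integral unchanged and
    makes every value of the process measurable for \<open>hist s\<close>.\<close>
  have "occ s = (\<lambda>\<omega>. LBINT r=0..ereal s. f (X (max 0 (min r s)) \<omega>))"
  proof
    fix \<omega>
    show "occ s \<omega> = (LBINT r=0..ereal s. f (X (max 0 (min r s)) \<omega>))"
      unfolding occ_def using assms by (intro interval_integral_cong) (auto simp: einterval_def min_def max_def)
  qed
  also have "\<dots> \<in> borel_measurable (hist s)"
  proof (rule occ_measurable_aux)
    show "X (max 0 (min r s)) \<in> borel_measurable (hist s)" for r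
      using assms by (intro X_measurable_hist) auto
    show "continuous_on UNIV (\<lambda>r. X (max 0 (min r s)) \<omega>)" if "\<omega> \<in> space (hist s)" for \<omega>
      using that by (intro continuous_on_compose2[OF X_continuous] continuous_intros) auto
  qed
  finally show ?thesis .
qed

lemma occ_measurable[measurable]: "occ s \<in> borel_measurable M"
  unfolding occ_def by (intro occ_measurable_aux X_continuous) auto

lemma occ_measurable_pair: "(\<lambda>(s, \<omega>). occ s \<omega>) \<in> borel_measurable (borel \<Otimes>\<^sub>M M)"
  by (intro borel_measurable_continuous_process occ_continuous) auto

text \<open>The time derivative of \<open>occ s \<omega> ^ Suc k / fact (Suc k)\<close>: the
  integral over \<open>k\<close> ordered times before \<open>s\<close>, with a further time placed
  at \<open>s\<close>.\<close>

definition occ_rate :: "nat \<Rightarrow> real \<Rightarrow> 'a \<Rightarrow> real" where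
  "occ_rate k s \<omega> = occ s \<omega> ^ k / fact k * f (X s \<omega>)"

lemma occ_rate_nonneg: "\<omega> \<in> space M \<Longrightarrow> 0 \<le> s \<Longrightarrow> 0 \<le> occ_rate k s \<omega>"
  unfolding occ_rate_def by (intro mult_nonneg_nonneg divide_nonneg_nonneg zero_le_power occ_nonneg f_nonneg) auto

lemma occ_rate_measurable_pair[measurable]: "(\<lambda>(s, \<omega>). occ_rate k s \<omega>) \<in> borel_measurable (borel \<Otimes>\<^sub>M M)"
proof -
  note [measurable] = occ_measurable_pair X_measurable_pair
  show ?thesis unfolding occ_rate_def by measurable
qed

lemma occ_rate_measurable_hist: "0 \<le> s \<Longrightarrow> occ_rate k s \<in> borel_measurable (hist s)"
  unfolding occ_rate_def
  by (intro borel_measurable_times borel_measurable_divide borel_measurable_power occ_measurable_hist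
    measurable_compose[OF X_measurable_hist f_measurable]) auto

lemma occ_rate_measurable_time: "\<omega> \<in> space M \<Longrightarrow> (\<lambda>s. occ_rate k s \<omega>) \<in> borel_measurable borel"
  unfolding occ_rate_def
  by (intro borel_measurable_continuous_onI continuous_intros occ_continuous fX_continuous) auto

lemma occ_power_deriv:
  assumes "\<omega> \<in> space M"
  shows "DERIV (\<lambda>s. occ s \<omega> ^ Suc k / fact (Suc k)) s :> occ_rate k s \<omega>"
proof -
  have "fact (Suc k) = (1 + real k) * fact k" by simp
  then have "(1 + real k) * (f (X s \<omega>) * occ s \<omega> ^ k) / fact (Suc k) = occ_rate k s \<omega>"
    by (simp add: occ_rate_def divide_simps del: fact_Suc)
  with DERIV_cdivide[OF DERIV_power_Suc[OF occ_deriv[OF assms, of s], of k], of "fact (Suc k)"]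
  show ?thesis by simp
qed

lemma nn_integral_occ_rate:
  assumes "\<omega> \<in> space M" "0 < u"
  shows "(\<integral>\<^sup>+s. ennreal (occ_rate k s \<omega>) * indicator {0<..<u} s \<partial>lborel) = ennreal (occ u \<omega> ^ Suc k / fact (Suc k))"
proof -
  have "(\<integral>\<^sup>+s. ennreal (occ_rate k s \<omega>) * indicator {0<..<u} s \<partial>lborel) =
      (\<integral>\<^sup>+s. ennreal (occ_rate k s \<omega>) * indicator {0..u} s \<partial>lborel)"
  proof (rule nn_integral_cong_AE)
    show "AE s in lborel. ennreal (occ_rate k s \<omega>) * indicator {0<..<u} s = ennreal (occ_rate k s \<omega>) * indicator {0..u} s"
      using AE_lborel_singleton[of 0] AE_lborel_singleton[of u] by eventually_elim (auto simp: indicator_def)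
  qed
  also have "\<dots> = ennreal (occ u \<omega> ^ Suc k / fact (Suc k) - occ 0 \<omega> ^ Suc k / fact (Suc k))"
    using assms by (intro nn_integral_FTC_Icc occ_power_deriv occ_rate_nonneg occ_rate_measurable_time) auto
  finally show ?thesis by (simp add: occ_0)
qed

text \<open>\<open>enn2real\<close> would turn an infinite integral into 0; by
  \<open>occ_total_finite\<close> the integral is almost surely finite.\<close>

definition occ_total :: "'a \<Rightarrow> real" where
  "occ_total \<omega> = enn2real (\<integral>\<^sup>+s. ennreal (f (X s \<omega>)) * indicator {0<..} s \<partial>lborel)"

lemma occ_total_measurable[measurable]: "occ_total \<in> borel_measurable M"
proof -
  note [measurable] = X_measurable_pair
  show ?thesis unfolding occ_total_def by measurable
qed

text \<open>By transience the path eventually stays above the support of \<open>f\<close>. From then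
  on \<open>occ\<close> is constant, so the antiderivative has the limit that the fundamental
  theorem on the half-line asks for.\<close>

lemma nn_integral_occ_rate_total:
  "AE \<omega> in M. \<forall>k. (\<integral>\<^sup>+s. ennreal (occ_rate k s \<omega>) * indicator {0<..} s \<partial>lborel) = ennreal (occ_total \<omega> ^ Suc k / fact (Suc k))"
  using X_eventually_ge[of "z + 1"] AE_space
proof eventually_elim
  fix \<omega> assume "\<exists>T\<ge>0. \<forall>t\<ge>T. z + 1 \<le> X t \<omega>" and \<omega>: "\<omega> \<in> space M"
  then obtain T where T: "0 \<le> T" "\<And>t. T \<le> t \<Longrightarrow> z + 1 \<le> X t \<omega>" by blast
  have f0: "f (X t \<omega>) = 0" if "T \<le> t" for t
  proof (rule ccontr)
    assume "f (X t \<omega>) \<noteq> 0"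
    from f_support[OF this] T(2)[OF that] show False by simp
  qed
  have const: "occ t \<omega> = occ T \<omega>" if "T \<le> t" for t
  proof (rule antisym)
    show "occ t \<omega> \<le> occ T \<omega>"
    proof (rule DERIV_nonpos_imp_nonincreasing[of T t "\<lambda>s. occ s \<omega>"])
      fix s assume "T \<le> s"
      then show "\<exists>d. DERIV (\<lambda>s. occ s \<omega>) s :> d \<and> d \<le> 0"
        using occ_deriv[OF \<omega>, of s] f0[of s] by (intro exI[of _ 0]) simp
    qed (rule that)
    show "occ T \<omega> \<le> occ t \<omega>"
    proof (rule DERIV_nonneg_imp_nondecreasing[of T t "\<lambda>s. occ s \<omega>"])
      fix s
      show "\<exists>d. DERIV (\<lambda>s. occ s \<omega>) s :> d \<and> 0 \<le> d"
        using occ_deriv[OF \<omega>, of s] f_nonneg[of "X s \<omega>"] by (intro exI[of _ "f (X s \<omega>)"]) simp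
    qed (rule that)
  qed
  have total: "(\<integral>\<^sup>+s. ennreal (occ_rate k s \<omega>) * indicator {0<..} s \<partial>lborel) = ennreal (occ T \<omega> ^ Suc k / fact (Suc k) - 0)" for k
  proof (rule nn_integral_FTC_greaterThan[OF occ_rate_measurable_time[OF \<omega>] occ_power_deriv[OF \<omega>] occ_rate_nonneg[OF \<omega>]])
    show "((\<lambda>s. occ s \<omega> ^ Suc k / fact (Suc k)) \<longlongrightarrow> occ T \<omega> ^ Suc k / fact (Suc k)) at_top"
    proof (rule tendsto_eventually)
      show "\<forall>\<^sub>F s in at_top. occ s \<omega> ^ Suc k / fact (Suc k) = occ T \<omega> ^ Suc k / fact (Suc k)"
        using eventually_ge_at_top[of T]
      proof eventually_elim
        case (elim s)
        show ?case by (simp only: const[OF elim])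
      qed
    qed
    have "isCont (\<lambda>s. occ s \<omega> ^ Suc k / fact (Suc k)) 0"
      using occ_power_deriv[OF \<omega>] by (rule DERIV_isCont)
    then have "((\<lambda>s. occ s \<omega> ^ Suc k / fact (Suc k)) \<longlongrightarrow> occ 0 \<omega> ^ Suc k / fact (Suc k)) (at_right 0)"
      unfolding isCont_def by (rule filterlim_mono[OF _ order_refl at_le]) simp
    then show "((\<lambda>s. occ s \<omega> ^ Suc k / fact (Suc k)) \<longlongrightarrow> 0) (at_right 0)"
      by (simp add: occ_0)
  qed auto
  have "occ_total \<omega> = occ T \<omega>"
    using total[of 0] occ_nonneg[OF \<omega> T(1)] unfolding occ_total_def occ_rate_def by simp
  then show "\<forall>k. (\<integral>\<^sup>+s. ennreal (occ_rate k s \<omega>) * indicator {0<..} s \<partial>lborel) = ennreal (occ_total \<omega> ^ Suc k / fact (Suc k))"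
    using total by (metis diff_zero)
qed

lemma occ_total_finite:
  "AE \<omega> in M. (\<integral>\<^sup>+s. ennreal (f (X s \<omega>)) * indicator {0<..} s \<partial>lborel) = ennreal (occ_total \<omega>)"
  using nn_integral_occ_rate_total
proof eventually_elim
  case (elim \<omega>)
  from this[rule_format, of 0] show ?case by (simp add: occ_rate_def)
qed

text \<open>The division by \<open>fact k\<close> corresponds to ordering the \<open>k\<close>
  times, and frees the recursion of combinatorial factors.\<close>

definition occ_moment :: "nat \<Rightarrow> ennreal" where
  "occ_moment k = (\<integral>\<^sup>+\<omega>. ennreal (occ_total \<omega> ^ k / fact k) \<partial>M)"

lemma occ_moment_Suc:
  "occ_moment (Suc k) = (\<integral>\<^sup>+s. (\<integral>\<^sup>+\<omega>. ennreal (occ_rate k s \<omega>) \<partial>M) * indicator {0<..} s \<partial>lborel)"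
proof -
  interpret P: pair_sigma_finite M lborel ..
  have "occ_moment (Suc k) = (\<integral>\<^sup>+\<omega>. (\<integral>\<^sup>+s. ennreal (occ_rate k s \<omega>) * indicator {0<..} s \<partial>lborel) \<partial>M)"
    unfolding occ_moment_def using nn_integral_occ_rate_total by (intro nn_integral_cong_AE) (auto elim!: eventually_mono)
  also have "\<dots> = (\<integral>\<^sup>+s. (\<integral>\<^sup>+\<omega>. ennreal (occ_rate k s \<omega>) * indicator {0<..} s \<partial>M) \<partial>lborel)"
    by (rule P.Fubini'[symmetric]) measurable
  finally show ?thesis by (simp add: nn_integral_multc)
qed

text \<open>The largest of the ordered times is integrated out by the Markov property at the time
  preceding it, which is the \<open>s\<close> of the formula.\<close>

lemma occ_moment_Suc_Suc:
  "occ_moment (Suc (Suc k)) =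
    (\<integral>\<^sup>+s. (\<integral>\<^sup>+\<omega>. ennreal (occ_rate k s \<omega>) * potential (\<lambda>x. ennreal (f x)) (X s \<omega>) \<partial>M) * indicator {0<..} s \<partial>lborel)"
proof -
  have "occ_moment (Suc (Suc k)) = (\<integral>\<^sup>+\<omega>. (\<integral>\<^sup>+u. ennreal (occ_rate (Suc k) u \<omega>) * indicator {0<..} u \<partial>lborel) \<partial>M)"
    unfolding occ_moment_def using nn_integral_occ_rate_total by (intro nn_integral_cong_AE) (auto elim!: eventually_mono)
  also have "\<dots> = (\<integral>\<^sup>+\<omega>. (\<integral>\<^sup>+u. (\<integral>\<^sup>+s. ennreal (occ_rate k s \<omega>) * indicator {0<..<u} s \<partial>lborel) * ennreal (f (X u \<omega>)) * indicator {0<..} u \<partial>lborel) \<partial>M)"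
  proof (intro nn_integral_cong)
    fix \<omega> u assume \<omega>: "\<omega> \<in> space M"
    show "ennreal (occ_rate (Suc k) u \<omega>) * indicator {0<..} u =
      (\<integral>\<^sup>+s. ennreal (occ_rate k s \<omega>) * indicator {0<..<u} s \<partial>lborel) * ennreal (f (X u \<omega>)) * indicator {0<..} u"
    proof (cases "0 < u")
      case True
      then have "0 \<le> occ u \<omega> ^ Suc k / fact (Suc k)"
        using occ_nonneg[OF \<omega>, of u] by (intro divide_nonneg_nonneg zero_le_power) auto
      then show ?thesis
        using True f_nonneg[of "X u \<omega>"] unfolding nn_integral_occ_rate[OF \<omega> True]
        by (simp add: occ_rate_def ennreal_mult[symmetric] del: power_Suc fact_Suc)
    qed simp
  qed
  also have "\<dots> = (\<integral>\<^sup>+s. (\<integral>\<^sup>+\<omega>. ennreal (occ_rate k s \<omega>) * potential (\<lambda>x. ennreal (f x)) (X s \<omega>) \<partial>M) * indicator {0<..} s \<partial>lborel)"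
  proof (rule nn_integral_occupation_step)
    show "(\<lambda>\<omega>. ennreal (occ_rate k s \<omega>)) \<in> borel_measurable (hist s)" if "0 \<le> s" for s
      using occ_rate_measurable_hist[OF that] by (rule measurable_compose) simp
  qed measurable
  finally show ?thesis .
qed

lemma nn_integral_f_shift: "(\<integral>\<^sup>+y. ennreal (f (x + y)) * ennreal a \<partial>lborel) = ennreal c * ennreal a"
  using nn_integral_real_affine[of "\<lambda>y. ennreal (f y)" 1 x] f_integral by (simp add: nn_integral_multc)

lemma potential_le: "potential (\<lambda>x. ennreal (f x)) x \<le> ennreal (c / l)"
proof -
  have "potential (\<lambda>x. ennreal (f x)) x \<le> (\<integral>\<^sup>+y. ennreal (f (x + y)) * ennreal (1 / l) \<partial>lborel)"
    unfolding potential_def using l_pos by (intro nn_integral_mono mult_left_mono ennreal_leI divide_right_mono) auto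
  then show ?thesis using c l_pos by (simp add: nn_integral_f_shift ennreal_mult[symmetric])
qed

text \<open>Two points of \<open>{z - e..z}\<close> are at most \<open>e\<close> apart, so only
  displacements \<open>y \<ge> - e\<close> matter, and for them the kernel is at least
  \<open>exp (- 2 * l * e) / l\<close>.\<close>

lemma potential_ge:
  assumes "x \<in> {z - e..z}"
  shows "ennreal (exp (- 2 * l * e) * (c / l)) \<le> potential (\<lambda>x. ennreal (f x)) x"
proof -
  have "(\<integral>\<^sup>+y. ennreal (f (x + y)) * ennreal (exp (- 2 * l * e) / l) \<partial>lborel) \<le> potential (\<lambda>x. ennreal (f x)) x"
    unfolding potential_def
  proof (rule nn_integral_mono)
    fix y
    show "ennreal (f (x + y)) * ennreal (exp (- 2 * l * e) / l) \<le> ennreal (f (x + y)) * ennreal (exp (min 0 (2 * l * y)) / l)"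
    proof (cases "f (x + y) = 0")
      case False
      then have "- e \<le> y" using f_support[of "x + y"] assms by auto
      then have "- (l * e) \<le> l * y" using l_pos mult_left_mono[of "- e" y l] by (simp add: mult.commute)
      then have "- 2 * l * e \<le> min 0 (2 * l * y)" using l_pos e by (simp add: mult.commute)
      then show ?thesis
        using l_pos by (intro mult_left_mono ennreal_leI divide_right_mono) auto
    qed simp
  qed
  then show ?thesis using c l_pos by (simp add: nn_integral_f_shift ennreal_mult[symmetric] mult.commute)
qed

text \<open>From 0 the support of \<open>f\<close> is reached by upward displacements only, where
  the kernel is constantly \<open>1 / l\<close>. This anchors the moment recursion with an exact
  value.\<close>

lemma potential_0: "potential (\<lambda>x. ennreal (f x)) 0 = ennreal (c / l)"
proof -
  have "potential (\<lambda>x. ennreal (f x)) 0 = (\<integral>\<^sup>+y. ennreal (f (0 + y)) * ennreal (1 / l) \<partial>lborel)"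
    unfolding potential_def
  proof (rule nn_integral_cong)
    fix y
    show "ennreal (f (0 + y)) * ennreal (exp (min 0 (2 * l * y)) / l) = ennreal (f (0 + y)) * ennreal (1 / l)"
    proof (cases "f y = 0")
      case False
      then have "0 \<le> y" using f_support[of y] e by auto
      then show ?thesis using l_pos by (simp add: min_def)
    qed simp
  qed
  then show ?thesis using c l_pos by (simp only: nn_integral_f_shift) (simp add: ennreal_mult[symmetric])
qed

lemma occ_moment_1: "occ_moment (Suc 0) = ennreal (c / l)"
proof -
  have "occ_moment (Suc 0) = (\<integral>\<^sup>+s. (\<integral>\<^sup>+\<omega>. 1 * ennreal (f (X s \<omega>)) \<partial>M) * indicator {0<..} s \<partial>lborel)"
    unfolding occ_moment_Suc by (simp add: occ_rate_def)
  also have "\<dots> = (\<integral>\<^sup>+\<omega>. 1 * potential (\<lambda>x. ennreal (f x)) (X 0 \<omega>) \<partial>M)"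
    by (rule nn_integral_markov_potential) auto
  also have "\<dots> = (\<integral>\<^sup>+\<omega>. ennreal (c / l) \<partial>M)"
    by (intro nn_integral_cong) (simp add: X_0 potential_0)
  finally show ?thesis by (simp add: emeasure_space_1)
qed

lemma occ_moment_step_le: "occ_moment (Suc (Suc k)) \<le> ennreal (c / l) * occ_moment (Suc k)"
proof -
  have m: "(\<lambda>s. \<integral>\<^sup>+\<omega>. ennreal (occ_rate k s \<omega>) \<partial>M) \<in> borel_measurable lborel" by measurable
  have ms: "occ_rate k s \<in> borel_measurable M" if "0 < s" for s
    using that by (intro measurable_hist[OF occ_rate_measurable_hist]) auto
  have "occ_moment (Suc (Suc k)) \<le> (\<integral>\<^sup>+s. ennreal (c / l) * ((\<integral>\<^sup>+\<omega>. ennreal (occ_rate k s \<omega>) \<partial>M) * indicator {0<..} s) \<partial>lborel)"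
    unfolding occ_moment_Suc_Suc
  proof (rule nn_integral_mono)
    fix s :: real
    have "(\<integral>\<^sup>+\<omega>. ennreal (occ_rate k s \<omega>) * potential (\<lambda>x. ennreal (f x)) (X s \<omega>) \<partial>M) \<le> ennreal (c / l) * (\<integral>\<^sup>+\<omega>. ennreal (occ_rate k s \<omega>) \<partial>M)" if "0 < s"
    proof -
      have "(\<integral>\<^sup>+\<omega>. ennreal (occ_rate k s \<omega>) * potential (\<lambda>x. ennreal (f x)) (X s \<omega>) \<partial>M) \<le> (\<integral>\<^sup>+\<omega>. ennreal (occ_rate k s \<omega>) * ennreal (c / l) \<partial>M)"
        by (intro nn_integral_mono mult_left_mono potential_le) simp
      also have "\<dots> = (\<integral>\<^sup>+\<omega>. ennreal (occ_rate k s \<omega>) \<partial>M) * ennreal (c / l)"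
        using ms[OF that] by (intro nn_integral_multc) measurable
      finally show ?thesis by (simp add: mult.commute)
    qed
    then show "(\<integral>\<^sup>+\<omega>. ennreal (occ_rate k s \<omega>) * potential (\<lambda>x. ennreal (f x)) (X s \<omega>) \<partial>M) * indicator {0<..} s \<le>
      ennreal (c / l) * ((\<integral>\<^sup>+\<omega>. ennreal (occ_rate k s \<omega>) \<partial>M) * indicator {0<..} s)"
      by (simp add: indicator_def)
  qed
  also have "\<dots> = ennreal (c / l) * occ_moment (Suc k)"
    unfolding occ_moment_Suc using m by (intro nn_integral_cmult) measurable
  finally show ?thesis .
qed

text \<open>\<open>potential_ge\<close> speaks only of starting points near \<open>z\<close>, and
  this suffices: \<open>occ_rate k s\<close> contains the factor \<open>f (X s)\<close> and vanishes
  elsewhere.\<close>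

lemma occ_moment_step_ge: "ennreal (exp (- 2 * l * e) * (c / l)) * occ_moment (Suc k) \<le> occ_moment (Suc (Suc k))"
proof -
  let ?a = "ennreal (exp (- 2 * l * e) * (c / l))"
  have m: "(\<lambda>s. \<integral>\<^sup>+\<omega>. ennreal (occ_rate k s \<omega>) \<partial>M) \<in> borel_measurable lborel" by measurable
  have ms: "occ_rate k s \<in> borel_measurable M" if "0 < s" for s
    using that by (intro measurable_hist[OF occ_rate_measurable_hist]) auto
  have "?a * occ_moment (Suc k) = (\<integral>\<^sup>+s. ?a * ((\<integral>\<^sup>+\<omega>. ennreal (occ_rate k s \<omega>) \<partial>M) * indicator {0<..} s) \<partial>lborel)"
    unfolding occ_moment_Suc using m by (intro nn_integral_cmult[symmetric]) measurable
  also have "\<dots> \<le> occ_moment (Suc (Suc k))"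
    unfolding occ_moment_Suc_Suc
  proof (rule nn_integral_mono)
    fix s :: real
    have "?a * (\<integral>\<^sup>+\<omega>. ennreal (occ_rate k s \<omega>) \<partial>M) \<le> (\<integral>\<^sup>+\<omega>. ennreal (occ_rate k s \<omega>) * potential (\<lambda>x. ennreal (f x)) (X s \<omega>) \<partial>M)" if s: "0 < s"
    proof -
      have "?a * (\<integral>\<^sup>+\<omega>. ennreal (occ_rate k s \<omega>) \<partial>M) = (\<integral>\<^sup>+\<omega>. ?a * ennreal (occ_rate k s \<omega>) \<partial>M)"
        using ms[OF s] by (intro nn_integral_cmult[symmetric]) measurable
      also have "\<dots> \<le> (\<integral>\<^sup>+\<omega>. ennreal (occ_rate k s \<omega>) * potential (\<lambda>x. ennreal (f x)) (X s \<omega>) \<partial>M)"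
      proof (rule nn_integral_mono)
        fix \<omega>
        show "?a * ennreal (occ_rate k s \<omega>) \<le> ennreal (occ_rate k s \<omega>) * potential (\<lambda>x. ennreal (f x)) (X s \<omega>)"
        proof (cases "f (X s \<omega>) = 0")
          case True
          then show ?thesis by (simp add: occ_rate_def)
        next
          case False
          from mult_left_mono[OF potential_ge[OF f_support[OF False]], of "ennreal (occ_rate k s \<omega>)"]
          show ?thesis by (simp only: mult.commute zero_le simp_thms)
        qed
      qed
      finally show ?thesis .
    qed
    then show "?a * ((\<integral>\<^sup>+\<omega>. ennreal (occ_rate k s \<omega>) \<partial>M) * indicator {0<..} s) \<le>
      (\<integral>\<^sup>+\<omega>. ennreal (occ_rate k s \<omega>) * potential (\<lambda>x. ennreal (f x)) (X s \<omega>) \<partial>M) * indicator {0<..} s"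
      by (simp add: indicator_def)
  qed
  finally show ?thesis .
qed

lemma occ_moment_le: "occ_moment (Suc k) \<le> ennreal ((c / l) ^ Suc k)"
proof (induction k)
  case 0 then show ?case by (simp add: occ_moment_1)
next
  case (Suc k)
  have "occ_moment (Suc (Suc k)) \<le> ennreal (c / l) * ennreal ((c / l) ^ Suc k)"
    by (rule order_trans[OF occ_moment_step_le mult_left_mono[OF Suc]]) simp
  also have "\<dots> = ennreal ((c / l) ^ Suc (Suc k))"
    using c l_pos by (simp add: ennreal_mult[symmetric] del: times_divide_eq_left times_divide_eq_right)
  finally show ?case .
qed

lemma occ_moment_ge: "ennreal (exp (- 2 * l * e) ^ k * (c / l) ^ Suc k) \<le> occ_moment (Suc k)"
proof (induction k)
  case 0 then show ?case by (simp add: occ_moment_1)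
next
  case (Suc k)
  have "ennreal (exp (- 2 * l * e) ^ Suc k * (c / l) ^ Suc (Suc k)) =
      ennreal (exp (- 2 * l * e) * (c / l)) * ennreal (exp (- 2 * l * e) ^ k * (c / l) ^ Suc k)"
    using c l_pos by (subst ennreal_mult[symmetric]) (auto simp: mult_ac)
  also have "\<dots> \<le> occ_moment (Suc (Suc k))"
    by (rule order_trans[OF mult_left_mono[OF Suc] occ_moment_step_ge]) simp
  finally show ?case .
qed

end

section \<open>Quadratic variation\<close>

text \<open>The points where \<open>P\<close> fails, up to the null set where \<open>R\<close>
  fails, are trapped in events of arbitrarily small probability. \<open>P\<close> itself need not be
  measurable, which allows it to mention the random time \<open>\<sigma>\<close>.\<close>

lemma (in prob_space) AE_I_small:
  assumes R: "AE \<omega> in M. R \<omega>"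
    and small: "\<And>\<eta>. 0 < \<eta> \<Longrightarrow> \<exists>H\<in>events. prob H < \<eta> \<and> (\<forall>\<omega>\<in>space M. R \<omega> \<longrightarrow> \<not> P \<omega> \<longrightarrow> \<omega> \<in> H)"
  shows "AE \<omega> in M. P \<omega>"
proof -
  have "\<exists>H. H \<in> events \<and> prob H < 1 / real (Suc n) \<and> (\<forall>\<omega>\<in>space M. R \<omega> \<longrightarrow> \<not> P \<omega> \<longrightarrow> \<omega> \<in> H)" for n
    using small[of "1 / real (Suc n)"] by auto
  then obtain H where H: "\<And>n. H n \<in> events" "\<And>n. prob (H n) < 1 / real (Suc n)"
    "\<And>n \<omega>. \<omega> \<in> space M \<Longrightarrow> R \<omega> \<Longrightarrow> \<not> P \<omega> \<Longrightarrow> \<omega> \<in> H n"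
    by metis
  have ev: "(\<Inter>n. H n) \<in> events" using H(1) by auto
  have "prob (\<Inter>n. H n) \<le> 0"
  proof (rule LIMSEQ_le_const[OF LIMSEQ_inverse_real_of_nat])
    have "prob (\<Inter>n. H n) \<le> prob (H n)" for n
      using H(1) by (intro finite_measure_mono) auto
    then show "\<exists>N. \<forall>n\<ge>N. prob (\<Inter>n. H n) \<le> inverse (real (Suc n))"
      using order_trans[OF _ less_imp_le[OF H(2)]] by (intro exI[of _ 0]) (simp add: inverse_eq_divide del: of_nat_Suc)
  qed
  then have "(\<Inter>n. H n) \<in> null_sets M"
    using ev by (simp add: null_sets_def emeasure_eq_measure measure_le_0_iff)
  then have "AE \<omega> in M. \<omega> \<notin> (\<Inter>n. H n)" by (rule AE_not_in)
  then show ?thesis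
    using R AE_space by eventually_elim (use H(3) in blast)
qed

lemma (in prob_space) indep_sum_second_moment:
  fixes Y :: "nat \<Rightarrow> 'a \<Rightarrow> real"
  assumes ind: "indep_vars (\<lambda>_. borel) Y {..<n}"
    and i2: "\<And>i. i < n \<Longrightarrow> integrable M (\<lambda>\<omega>. (Y i \<omega>)\<^sup>2)"
    and Y0: "\<And>i. i < n \<Longrightarrow> expectation (Y i) = 0"
    and Y2: "\<And>i. i < n \<Longrightarrow> expectation (\<lambda>\<omega>. (Y i \<omega>)\<^sup>2) = v"
  shows "integrable M (\<lambda>\<omega>. (\<Sum>i<n. Y i \<omega>)\<^sup>2)" "expectation (\<lambda>\<omega>. (\<Sum>i<n. Y i \<omega>)\<^sup>2) = real n * v"
proof -
  have rv[measurable]: "Y i \<in> borel_measurable M" if "i < n" for i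
    using ind that unfolding indep_vars_def by auto
  have i1: "integrable M (Y i)" if "i < n" for i
    using square_integrable_imp_integrable[OF rv[OF that] i2[OF that]] .
  have off: "integrable M (\<lambda>\<omega>. Y i \<omega> * Y j \<omega>) \<and> expectation (\<lambda>\<omega>. Y i \<omega> * Y j \<omega>) = 0"
    if "i < n" "j < n" "i \<noteq> j" for i j
  proof -
    have "indep_vars (\<lambda>_. borel) Y {i, j}" by (rule indep_vars_subset[OF ind]) (use that in auto)
    moreover have "integrable M (Y k)" if "k \<in> {i, j}" for k
      using that \<open>i < n\<close> \<open>j < n\<close> i1 by auto
    ultimately have "integrable M (\<lambda>\<omega>. \<Prod>k\<in>{i, j}. Y k \<omega>)"
      "expectation (\<lambda>\<omega>. \<Prod>k\<in>{i, j}. Y k \<omega>) = (\<Prod>k\<in>{i, j}. expectation (Y k))"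
      by (intro indep_vars_integrable indep_vars_lebesgue_integral; simp)+
    then show ?thesis using that Y0 by simp
  qed
  have int: "integrable M (\<lambda>\<omega>. Y i \<omega> * Y j \<omega>)" if "i < n" "j < n" for i j
    using off[OF that] i2[OF that(1)] by (cases "i = j") (auto simp: power2_eq_square)
  have ex: "expectation (\<lambda>\<omega>. Y i \<omega> * Y j \<omega>) = (if i = j then v else 0)" if "i < n" "j < n" for i j
    using off[OF that] Y2[OF that(1)] by (auto simp: power2_eq_square)
  have sq: "(\<Sum>i<n. Y i \<omega>)\<^sup>2 = (\<Sum>i<n. \<Sum>j<n. Y i \<omega> * Y j \<omega>)" for \<omega>
    by (simp add: power2_eq_square sum_product)
  show "integrable M (\<lambda>\<omega>. (\<Sum>i<n. Y i \<omega>)\<^sup>2)"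
    unfolding sq using int by (intro Bochner_Integration.integrable_sum) auto
  have "expectation (\<lambda>\<omega>. (\<Sum>i<n. Y i \<omega>)\<^sup>2) = (\<Sum>i<n. \<Sum>j<n. expectation (\<lambda>\<omega>. Y i \<omega> * Y j \<omega>))"
    unfolding sq using int
    by (subst Bochner_Integration.integral_sum) (auto intro!: sum.cong Bochner_Integration.integral_sum)
  also have "\<dots> = (\<Sum>i<n. \<Sum>j<n. if i = j then v else 0)"
    using ex by (intro sum.cong) auto
  also have "\<dots> = real n * v" by simp
  finally show "expectation (\<lambda>\<omega>. (\<Sum>i<n. Y i \<omega>)\<^sup>2) = real n * v" .
qed

context continuous_brownian_motion begin

lemma B_increment_moments:
  assumes "0 \<le> s" "s < t"
  shows "integrable M (\<lambda>\<omega>. (B t \<omega> - B s \<omega>) ^ (2 * k))"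
    and "expectation (\<lambda>\<omega>. (B t \<omega> - B s \<omega>) ^ (2 * k)) = fact (2 * k) * (t - s) ^ k / (2 ^ k * fact k)"
proof -
  note D = B_increment[OF assms]
  have m: "has_bochner_integral lborel (\<lambda>x. normal_density 0 (sqrt (t - s)) x * x ^ (2 * k)) (fact (2 * k) / ((2 / (t - s)) ^ k * fact k))"
  proof -
    have "(sqrt (t - s))\<^sup>2 = t - s" using assms by simp
    then show ?thesis
      using normal_moment_even[where \<mu>=0 and \<sigma>="sqrt (t - s)" and k=k] assms
      by (simp only: diff_zero) simp
  qed
  show "integrable M (\<lambda>\<omega>. (B t \<omega> - B s \<omega>) ^ (2 * k))"
    using distributed_integrable[OF D, of "\<lambda>x. x ^ (2 * k)"] m by (auto simp: has_bochner_integral_iff)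
  show "expectation (\<lambda>\<omega>. (B t \<omega> - B s \<omega>) ^ (2 * k)) = fact (2 * k) * (t - s) ^ k / (2 ^ k * fact k)"
    using distributed_integral[OF D, of "\<lambda>x. x ^ (2 * k)"] m by (auto simp: has_bochner_integral_iff power_divide)
qed

lemma B_square_variation_second_moment:
  assumes q: "0 < q" and n: "0 < n"
  defines "p \<equiv> \<lambda>i. real i * q / real n"
  shows "integrable M (\<lambda>\<omega>. ((\<Sum>i<n. (B (p (Suc i)) \<omega> - B (p i) \<omega>)\<^sup>2) - q)\<^sup>2)" (is "integrable M (\<lambda>\<omega>. (?V \<omega>)\<^sup>2)")
    and "expectation (\<lambda>\<omega>. ((\<Sum>i<n. (B (p (Suc i)) \<omega> - B (p i) \<omega>)\<^sup>2) - q)\<^sup>2) = 2 * q\<^sup>2 / real n"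
proof -
  define d where "d = q / real n"
  have d: "0 < d" using q n by (simp add: d_def)
  have p: "0 \<le> p i" "p i < p (Suc i)" "p (Suc i) - p i = d" for i
    using q n by (auto simp: p_def d_def divide_simps algebra_simps)
  define Y where "Y i \<omega> = (B (p (Suc i)) \<omega> - B (p i) \<omega>)\<^sup>2 - d" for i \<omega>
  have V: "?V \<omega> = (\<Sum>i<n. Y i \<omega>)" for \<omega>
    using n by (simp add: Y_def sum_subtractf d_def)
  have m2: "integrable M (\<lambda>\<omega>. (B (p (Suc i)) \<omega> - B (p i) \<omega>)\<^sup>2)" "expectation (\<lambda>\<omega>. (B (p (Suc i)) \<omega> - B (p i) \<omega>)\<^sup>2) = d" for i
    using B_increment_moments[OF p(1,2)[of i], of 1] by (simp_all add: p(3))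
  have m4: "integrable M (\<lambda>\<omega>. (B (p (Suc i)) \<omega> - B (p i) \<omega>) ^ 4)" "expectation (\<lambda>\<omega>. (B (p (Suc i)) \<omega> - B (p i) \<omega>) ^ 4) = 3 * d\<^sup>2" for i
    using B_increment_moments[OF p(1,2)[of i], of 2] by (simp_all add: p(3) fact_numeral)
  have Y2: "(Y i \<omega>)\<^sup>2 = (B (p (Suc i)) \<omega> - B (p i) \<omega>) ^ 4 - 2 * d * (B (p (Suc i)) \<omega> - B (p i) \<omega>)\<^sup>2 + d\<^sup>2" for i \<omega>
    by (simp add: Y_def power2_eq_square power4_eq_xxxx algebra_simps)
  have ind: "indep_vars (\<lambda>_. borel) Y {..<n}"
    unfolding Y_def
    by (rule indep_vars_compose2[OF B_indep, where Y="\<lambda>_ x. x\<^sup>2 - d"]) (use p in \<open>auto intro: less_imp_le\<close>)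
  \<comment> \<open>The fourth Gaussian moment \<open>3 * d\<^sup>2\<close> gives the variance
    \<open>3 * d\<^sup>2 - 2 * d * d + d\<^sup>2\<close>.\<close>
  have *: "integrable M (\<lambda>\<omega>. (Y i \<omega>)\<^sup>2)" "expectation (Y i) = 0" "expectation (\<lambda>\<omega>. (Y i \<omega>)\<^sup>2) = 2 * d\<^sup>2" for i
    using m2[of i] m4[of i] unfolding Y2 by (auto simp: Y_def[abs_def] prob_space power2_eq_square)
  note S = indep_sum_second_moment[OF ind *]
  show "integrable M (\<lambda>\<omega>. (?V \<omega>)\<^sup>2)" "expectation (\<lambda>\<omega>. (?V \<omega>)\<^sup>2) = 2 * q\<^sup>2 / real n"
    using S n unfolding V by (auto simp: d_def power2_eq_square)
qed

end

context drifted_brownian_motion begin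

text \<open>On a uniform partition the increments of \<open>B\<close> telescope in the cross term,
  so the drift changes the sum by exactly
  \<open>2 * l * q / n * B q + l\<^sup>2 * q\<^sup>2 / n\<close>. The second moment of the error is
  of order \<open>1 / n\<close>, and Chebyshev's inequality applies.\<close>

lemma X_square_variation:
  assumes q: "0 < q" and \<epsilon>: "0 < \<epsilon>"
  shows "(\<lambda>n. prob {\<omega> \<in> space M. \<epsilon> < \<bar>(\<Sum>i<n. (X (real (Suc i) * q / real n) \<omega> - X (real i * q / real n) \<omega>)\<^sup>2) - q\<bar>}) \<longlonglongrightarrow> 0"
proof -
  define V where "V n \<omega> = (\<Sum>i<n. (X (real (Suc i) * q / real n) \<omega> - X (real i * q / real n) \<omega>)\<^sup>2) - q" for n \<omega>
  define W where "W n \<omega> = (\<Sum>i<n. (B (real (Suc i) * q / real n) \<omega> - B (real i * q / real n) \<omega>)\<^sup>2) - q" for n \<omega>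
  have V: "V n \<omega> = W n \<omega> + (2 * l * q / real n * B q \<omega> + l\<^sup>2 * q\<^sup>2 / real n)" if n: "0 < n" and \<omega>: "\<omega> \<in> space M" for n \<omega>
  proof -
    let ?d = "q / real n"
    let ?D = "\<lambda>i. B (real (Suc i) * q / real n) \<omega> - B (real i * q / real n) \<omega>"
    have dX: "X (real (Suc i) * q / real n) \<omega> - X (real i * q / real n) \<omega> = ?D i + l * ?d" for i
      using n by (simp add: X_def divide_simps) (simp add: algebra_simps)
    have "(X (real (Suc i) * q / real n) \<omega> - X (real i * q / real n) \<omega>)\<^sup>2 = (?D i)\<^sup>2 + 2 * l * ?d * ?D i + l\<^sup>2 * ?d\<^sup>2" for i
      unfolding dX by (simp add: power2_eq_square algebra_simps del: of_nat_Suc)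
    then have "V n \<omega> = (\<Sum>i<n. (?D i)\<^sup>2) + 2 * l * ?d * (\<Sum>i<n. ?D i) + real n * (l\<^sup>2 * ?d\<^sup>2) - q"
      by (simp add: V_def sum.distrib sum_distrib_left del: of_nat_Suc)
    also have "(\<Sum>i<n. ?D i) = B q \<omega>"
      using sum_lessThan_telescope[of "\<lambda>i. B (real i * q / real n) \<omega>" n] n B_0[OF \<omega>] by simp
    also have "real n * (l\<^sup>2 * ?d\<^sup>2) = l\<^sup>2 * q\<^sup>2 / real n"
      using n by (simp add: power2_eq_square)
    finally show ?thesis by (simp add: W_def)
  qed
  \<comment> \<open>The bound on the second moment of \<open>V n\<close> from applying
    \<open>(a + b)\<^sup>2 \<le> 2 * a\<^sup>2 + 2 * b\<^sup>2\<close> twice.\<close>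
  define K where "K n = 2 * (2 * q\<^sup>2 / real n) + 2 * (2 * (2 * l * q / real n)\<^sup>2 * q + 2 * (l\<^sup>2 * q\<^sup>2 / real n)\<^sup>2)" for n
  have bound: "prob {\<omega> \<in> space M. \<epsilon> < \<bar>V n \<omega>\<bar>} \<le> K n / \<epsilon>\<^sup>2" if n: "0 < n" for n
  proof -
    have [measurable]: "V n \<in> borel_measurable M" unfolding V_def by measurable
    have Bq: "integrable M (\<lambda>\<omega>. (B q \<omega>)\<^sup>2)" "expectation (\<lambda>\<omega>. (B q \<omega>)\<^sup>2) = q"
    proof -
      have "integrable M (\<lambda>\<omega>. (B q \<omega> - B 0 \<omega>)\<^sup>2)" "expectation (\<lambda>\<omega>. (B q \<omega> - B 0 \<omega>)\<^sup>2) = q"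
        using B_increment_moments[of 0 q 1] q by simp_all
      moreover have "integrable M (\<lambda>\<omega>. (B q \<omega> - B 0 \<omega>)\<^sup>2) = integrable M (\<lambda>\<omega>. (B q \<omega>)\<^sup>2)"
        "expectation (\<lambda>\<omega>. (B q \<omega> - B 0 \<omega>)\<^sup>2) = expectation (\<lambda>\<omega>. (B q \<omega>)\<^sup>2)"
        by (auto intro!: Bochner_Integration.integrable_cong Bochner_Integration.integral_cong simp: B_0)
      ultimately show "integrable M (\<lambda>\<omega>. (B q \<omega>)\<^sup>2)" "expectation (\<lambda>\<omega>. (B q \<omega>)\<^sup>2) = q" by auto
    qed
    have W: "integrable M (\<lambda>\<omega>. (W n \<omega>)\<^sup>2)" "expectation (\<lambda>\<omega>. (W n \<omega>)\<^sup>2) = 2 * q\<^sup>2 / real n"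
      using B_square_variation_second_moment[OF q n] unfolding W_def by auto
    let ?R = "\<lambda>\<omega>. 2 * (W n \<omega>)\<^sup>2 + 2 * (2 * (2 * l * q / real n)\<^sup>2 * (B q \<omega>)\<^sup>2 + 2 * (l\<^sup>2 * q\<^sup>2 / real n)\<^sup>2)"
    have sq: "(a + b)\<^sup>2 \<le> 2 * a\<^sup>2 + 2 * b\<^sup>2" for a b :: real
      using sum_squares_ge_zero[of "a - b" 0] by (simp add: power2_eq_square algebra_simps)
    have le: "(V n \<omega>)\<^sup>2 \<le> ?R \<omega>" if "\<omega> \<in> space M" for \<omega>
    proof -
      have "(V n \<omega>)\<^sup>2 \<le> 2 * (W n \<omega>)\<^sup>2 + 2 * (2 * l * q / real n * B q \<omega> + l\<^sup>2 * q\<^sup>2 / real n)\<^sup>2"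
        unfolding V[OF n that] by (rule sq)
      also have "(2 * l * q / real n * B q \<omega> + l\<^sup>2 * q\<^sup>2 / real n)\<^sup>2 \<le> 2 * (2 * l * q / real n * B q \<omega>)\<^sup>2 + 2 * (l\<^sup>2 * q\<^sup>2 / real n)\<^sup>2"
        by (rule sq)
      finally show ?thesis unfolding power_mult_distrib[of _ "B q \<omega>"] by simp
    qed
    have R: "integrable M ?R" using W Bq by simp
    have iV: "integrable M (\<lambda>\<omega>. (V n \<omega>)\<^sup>2)"
      by (rule Bochner_Integration.integrable_bound[OF R]) (auto intro!: AE_I2 order_trans[OF le])
    have "prob {\<omega> \<in> space M. \<epsilon> < \<bar>V n \<omega>\<bar>} \<le> prob {\<omega> \<in> space M. \<epsilon> \<le> \<bar>V n \<omega>\<bar>}"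
      by (intro finite_measure_mono) auto
    also have "\<dots> \<le> expectation (\<lambda>\<omega>. (V n \<omega>)\<^sup>2) / \<epsilon>\<^sup>2"
      using iV \<epsilon> by (intro second_moment_method) auto
    also have "\<dots> \<le> expectation ?R / \<epsilon>\<^sup>2"
      by (intro divide_right_mono integral_mono iV R le) auto
    also have "expectation ?R = K n"
      using W Bq by (simp add: K_def prob_space)
    finally show ?thesis .
  qed
  show ?thesis
    unfolding V_def[symmetric]
  proof (rule tendsto_sandwich[OF _ _ tendsto_const])
    show "(\<lambda>n. K n / \<epsilon>\<^sup>2) \<longlonglongrightarrow> 0"
      unfolding K_def using q \<epsilon> l_pos by real_asymp
    show "\<forall>\<^sub>F n in sequentially. prob {\<omega> \<in> space M. \<epsilon> < \<bar>V n \<omega>\<bar>} \<le> K n / \<epsilon>\<^sup>2"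
      using eventually_gt_at_top[of 0] by eventually_elim (rule bound)
  qed simp
qed

end

section \<open>The bracket of the stopped process\<close>

text \<open>Almost sure identities for countably many times determine the bracket at rational times
  only. Monotonicity carries them to real times on either side of \<open>s\<close>, and continuity
  joins the two sides at \<open>s\<close>.\<close>

lemma stopped_clock:
  fixes Q :: "real \<Rightarrow> real"
  assumes mono: "mono_on {0..} Q" and cont: "continuous_on {0..} Q" and Q0: "Q 0 = 0" and s: "0 < s"
    and before: "\<And>q. q \<in> \<rat> \<Longrightarrow> 0 < q \<Longrightarrow> q \<le> s \<Longrightarrow> Q q = q"
    and after: "\<And>q t. q \<in> \<rat> \<Longrightarrow> t \<in> \<rat> \<Longrightarrow> s \<le> q \<Longrightarrow> q \<le> t \<Longrightarrow> Q t = Q q"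
    and t: "0 \<le> t"
  shows "Q t = min t s"
proof -
  have lt: "Q t = t" if t: "0 \<le> t" "t < s" for t
  proof (rule antisym)
    show "Q t \<le> t"
    proof (rule dense_ge_bounded[OF t(2)])
      fix w assume w: "t < w" "w < s"
      obtain q where q: "q \<in> \<rat>" "t < q" "q < w" using Rats_dense_in_real[OF w(1)] by blast
      have "Q t \<le> Q q" using mono_onD[OF mono, of t q] t q by auto
      also have "Q q = q" using before[OF q(1)] t q w by auto
      finally show "Q t \<le> w" using q by simp
    qed
    show "t \<le> Q t"
    proof (cases "t = 0")
      case False
      with t have t0: "0 < t" by simp
      show ?thesis
      proof (rule dense_le_bounded[OF t0])
        fix w assume w: "0 < w" "w < t"
        obtain q where q: "q \<in> \<rat>" "w < q" "q < t" using Rats_dense_in_real[OF w(2)] by blast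
        have "w \<le> Q q" using before[OF q(1)] t q w by auto
        also have "Q q \<le> Q t" using mono_onD[OF mono, of q t] w t q by auto
        finally show "w \<le> Q t" .
      qed
    qed (simp add: Q0)
  qed
  have tend: "(\<lambda>n. Q (u n)) \<longlonglongrightarrow> Q a" if "u \<longlonglongrightarrow> a" "0 \<le> a" "\<And>n. 0 \<le> u n" for u a
    by (rule continuous_on_tendsto_compose[OF cont that(1)]) (use that in auto)
  have at: "Q s = s"
  proof (rule LIMSEQ_unique)
    let ?u = "\<lambda>n. s - s / real (Suc n)"
    have u: "0 \<le> ?u n" "?u n < s" for n using s by (auto simp: field_simps)
    have lim: "?u \<longlonglongrightarrow> s" using s by real_asymp
    show "(\<lambda>n. Q (?u n)) \<longlonglongrightarrow> Q s" using s by (intro tend[OF lim] u) auto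
    show "(\<lambda>n. Q (?u n)) \<longlonglongrightarrow> s" using lim lt[OF u] by simp
  qed
  have gt: "Q t = s" if t: "s < t" for t
  proof -
    have eq: "Q w = Q t" if w: "s < w" "w < t" for w
    proof (rule antisym)
      show "Q w \<le> Q t" using mono_onD[OF mono, of w t] w s by auto
      obtain q where q: "q \<in> \<rat>" "s < q" "q < w" using Rats_dense_in_real[OF w(1)] by blast
      obtain r where r: "r \<in> \<rat>" "t < r" using Rats_dense_in_real[of t "t + 1"] by auto
      have "Q t \<le> Q r" using mono_onD[OF mono, of t r] w s r by auto
      also have "Q r = Q q" using after[OF q(1) r(1)] q w r by auto
      also have "Q q \<le> Q w" using mono_onD[OF mono, of q w] s q by auto
      finally show "Q t \<le> Q w" .
    qed
    \<comment> \<open>Dividing by at least 2 keeps all these points strictly between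
      \<open>s\<close> and \<open>t\<close>, where \<open>Q\<close> already has the value
      \<open>Q t\<close>.\<close>
    let ?u = "\<lambda>n. s + (t - s) / real (Suc (Suc n))"
    have "0 < (t - s) / real (Suc (Suc n))" "(t - s) / real (Suc (Suc n)) < t - s" for n
      using t by (auto simp: divide_less_eq simp del: of_nat_Suc)
    then have u: "s < ?u n" "?u n < t" for n by (smt (verit))+
    have lim: "?u \<longlonglongrightarrow> s" by real_asymp
    have "(\<lambda>n. Q (?u n)) \<longlonglongrightarrow> Q s"
      by (rule tend[OF lim less_imp_le[OF s]]) (rule less_imp_le[OF less_trans[OF s u(1)]])
    moreover have "(\<lambda>n. Q (?u n)) \<longlonglongrightarrow> Q t" using eq[OF u] by simp
    ultimately show ?thesis using at LIMSEQ_unique by metis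
  qed
  show ?thesis using lt[of t] gt[of t] at t by (cases t s rule: linorder_cases) auto
qed

text \<open>The clock runs at unit speed on \<open>{0..a}\<close> and stands still elsewhere;
  half-open intervals generate the Borel sets and are closed under intersection.\<close>

lemma interval_measure_stopped_clock:
  fixes a :: real
  assumes a: "0 \<le> a"
  shows "interval_measure (\<lambda>s. min (max 0 s) a) = density lborel (indicator {0..a})" (is "?M1 = ?M2")
proof (rule measure_eqI_generator_eq[where \<Omega>=UNIV and E="range (\<lambda>(a, b). {a<..b::real})"])
  let ?F = "\<lambda>s. min (max 0 s) a"
  have cont: "continuous (at_right x) ?F" for x
    by (intro continuous_intros)
  have M1: "emeasure ?M1 {x<..y} = ennreal (?F y - ?F x)" if "x \<le> y" for x y
    using that cont by (intro emeasure_interval_measure_Ioc) (auto simp: min_def max_def)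
  fix E assume "E \<in> range (\<lambda>(a, b). {a<..b::real})"
  then obtain x y where E: "E = {x<..y}" by auto
  have "{0..a} \<inter> {x<..y} = (if x < 0 then {0..min y a} else {x<..min y a})"
    by auto
  moreover have "emeasure ?M2 E = emeasure lborel ({0..a} \<inter> {x<..y})"
    unfolding E by (simp add: emeasure_density indicator_inter_arith[symmetric])
  moreover have "emeasure ?M1 E = (if x \<le> y then ennreal (?F y - ?F x) else 0)"
    unfolding E using M1 by simp
  ultimately show "emeasure ?M1 E = emeasure ?M2 E"
    using a by (auto simp: min_def max_def)
next
  show "(\<Union>i. {- real (i::nat)<..real i}) = UNIV" by (rule UN_Ioc_eq_UNIV)
  have cont: "continuous (at_right x) (\<lambda>s. min (max 0 s) a)" for x
    by (intro continuous_intros)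
  show "emeasure ?M1 {- real i<..real i} \<noteq> \<infinity>" for i
    using cont by (subst emeasure_interval_measure_Ioc) (auto simp: min_def max_def)
qed (auto simp: borel_sigma_sets_Ioc Int_stable_def)

text \<open>The intermediate value theorem gives a visit to \<open>z\<close> between 0 and
  \<open>T\<close>. A value at or below \<open>z\<close> after \<open>s\<close> would, by the same
  theorem, force a visit later than the supremum of all visits.\<close>

lemma last_passage_path:
  fixes x :: "real \<Rightarrow> real"
  assumes cont: "continuous_on UNIV x" and x0: "x 0 = 0" and z: "0 < z"
    and T: "0 \<le> T" "\<And>t. T \<le> t \<Longrightarrow> z + 1 \<le> x t" and s: "s = Sup {t. 0 < t \<and> x t = z}"
  shows "0 < s" "\<And>t. s < t \<Longrightarrow> z < x t"
proof -
  let ?S = "{t. 0 < t \<and> x t = z}"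
  have "\<exists>t. 0 \<le> t \<and> t \<le> T \<and> x t = z"
    using z T(1) T(2)[of T] x0 by (intro IVT') (auto intro: continuous_on_subset[OF cont])
  then obtain t0 where "0 \<le> t0" "x t0 = z" by blast
  then have t0: "t0 \<in> ?S" using x0 z by (cases "t0 = 0") auto
  have bdd: "bdd_above ?S"
  proof (rule bdd_aboveI[of _ T])
    fix t assume "t \<in> ?S"
    then show "t \<le> T" using T(2)[of t] by (cases "T \<le> t") auto
  qed
  have le: "t \<le> s" if "t \<in> ?S" for t unfolding s using that bdd by (rule cSup_upper)
  show s0: "0 < s" using le[OF t0] t0 by auto
  show "z < x t" if t: "s < t" for t
  proof (rule ccontr)
    assume "\<not> z < x t"
    then have "\<exists>u. t \<le> u \<and> u \<le> max t T \<and> x u = z"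
      using z T(2)[of "max t T"] by (intro IVT') (auto intro: continuous_on_subset[OF cont])
    then obtain u where "t \<le> u" "x u = z" by blast
    then show False using le[of u] t s0 by auto
  qed
qed

text \<open>The mesh condition ranges over all indices, also those beyond \<open>n\<close>: the
  partitions used below are given by formulas that satisfy it everywhere.\<close>

lemma quadratic_variationD:
  assumes "quadratic_variation M X Q" and "0 \<le> t" "0 < \<epsilon>" "0 < \<eta>"
  shows "\<exists>\<delta>>0. \<forall>(n::nat) p. p 0 = 0 \<and> p n = t \<and> (\<forall>i. p i \<le> p (Suc i) \<and> p (Suc i) - p i < \<delta>) \<longrightarrow>
    measure M {\<omega> \<in> space M. \<epsilon> < \<bar>(\<Sum>i<n. (X (p (Suc i)) \<omega> - X (p i) \<omega>)\<^sup>2) - Q t \<omega>\<bar>} < \<eta>"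
proof -
  from assms(1)[unfolded quadratic_variation_def, THEN conjunct2, THEN conjunct2, rule_format, OF assms(2-4)]
  obtain \<delta> where \<delta>: "0 < \<delta>" "\<forall>(n::nat) p. p 0 = 0 \<and> p n = t \<and> (\<forall>i<n. p i \<le> p (Suc i) \<and> p (Suc i) - p i < \<delta>) \<longrightarrow>
    measure M {\<omega> \<in> space M. \<epsilon> < \<bar>(\<Sum>i<n. (X (p (Suc i)) \<omega> - X (p i) \<omega>)\<^sup>2) - Q t \<omega>\<bar>} < \<eta>"
    by (elim exE conjE)
  show ?thesis
    by (intro exI[of _ \<delta>] conjI \<delta>(1) allI impI, rule \<delta>(2)[rule_format]) simp
qed

context drifted_brownian_motion begin

text \<open>Deterministic partitions suffice although \<open>\<sigma>\<close> is random and not a stopping time: for a fixed \<open>q\<close> the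
  sums of \<open>\<xi>\<close> up to \<open>q\<close> are those of \<open>X\<close> where \<open>q \<le> \<sigma>\<close>, and have no contribution after \<open>q\<close> where
  \<open>\<sigma> \<le> q\<close>.  Rational \<open>q\<close> and the continuity of \<open>Q\<close> do the rest.\<close>

lemma bracket_before:
  assumes QV: "quadratic_variation M \<xi> Q" and R: "AE \<omega> in M. \<forall>t\<ge>0. \<xi> t \<omega> = X (min t (\<sigma> \<omega>)) \<omega>"
    and q: "0 < q"
  shows "AE \<omega> in M. q \<le> \<sigma> \<omega> \<longrightarrow> Q q \<omega> = q"
proof -
  have [measurable]: "\<xi> t \<in> borel_measurable M" "Q t \<in> borel_measurable M" if "0 \<le> t" for t
    using QV that unfolding quadratic_variation_def by auto
  note [measurable] = \<open>\<And>t. 0 \<le> t \<Longrightarrow> Q t \<in> borel_measurable M\<close>[OF less_imp_le[OF q]]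
  have "AE \<omega> in M. \<forall>m. q \<le> \<sigma> \<omega> \<longrightarrow> \<bar>Q q \<omega> - q\<bar> \<le> 2 / real (Suc m)"
    unfolding AE_all_countable
  proof (intro allI AE_I_small[OF R])
    fix m :: nat and \<eta> :: real assume \<eta>: "0 < \<eta>"
    define \<epsilon> where "\<epsilon> = 1 / real (Suc m)"
    have \<epsilon>: "0 < \<epsilon>" by (simp add: \<epsilon>_def)
    from quadratic_variationD[OF QV less_imp_le[OF q] \<epsilon> half_gt_zero[OF \<eta>]]
    obtain \<delta> where \<delta>: "0 < \<delta>" and D: "\<forall>(n::nat) p. p 0 = 0 \<and> p n = q \<and> (\<forall>i. p i \<le> p (Suc i) \<and> p (Suc i) - p i < \<delta>) \<longrightarrow>
        measure M {\<omega> \<in> space M. \<epsilon> < \<bar>(\<Sum>i<n. (\<xi> (p (Suc i)) \<omega> - \<xi> (p i) \<omega>)\<^sup>2) - Q q \<omega>\<bar>} < \<eta> / 2"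
      by (elim exE conjE)
    have "\<forall>\<^sub>F n in sequentially. q / real n < \<delta>"
      by (rule order_tendstoD(2)[OF _ \<delta>]) real_asymp
    moreover have "\<forall>\<^sub>F n in sequentially. prob {\<omega> \<in> space M. \<epsilon> < \<bar>(\<Sum>i<n. (X (real (Suc i) * q / real n) \<omega> - X (real i * q / real n) \<omega>)\<^sup>2) - q\<bar>} < \<eta> / 2"
      using order_tendstoD(2)[OF X_square_variation[OF q \<epsilon>], of "\<eta> / 2"] \<eta> by simp
    ultimately have "\<forall>\<^sub>F n in sequentially. 0 < n \<and> q / real n < \<delta> \<and>
      prob {\<omega> \<in> space M. \<epsilon> < \<bar>(\<Sum>i<n. (X (real (Suc i) * q / real n) \<omega> - X (real i * q / real n) \<omega>)\<^sup>2) - q\<bar>} < \<eta> / 2"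
      using eventually_gt_at_top[of 0] by eventually_elim auto
    from eventually_happens'[OF sequentially_bot this] obtain n where n: "0 < n" "q / real n < \<delta>"
      "prob {\<omega> \<in> space M. \<epsilon> < \<bar>(\<Sum>i<n. (X (real (Suc i) * q / real n) \<omega> - X (real i * q / real n) \<omega>)\<^sup>2) - q\<bar>} < \<eta> / 2"
      by (elim exE conjE)
    define p where "p i = real i * q / real n" for i
    have "p (Suc i) - p i = q / real n" for i by (simp add: p_def add_divide_distrib algebra_simps)
    moreover have "0 \<le> q / real n" using q by simp
    ultimately have p3: "p i \<le> p (Suc i) \<and> p (Suc i) - p i < \<delta>" for i
      using n(2) by (metis diff_ge_0_iff_ge)
    have p: "p 0 = 0" "p n = q" "0 \<le> p i" for i
      using n(1) q by (simp_all add: p_def)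
    have pq: "p i \<le> q" if "i \<le> n" for i
      using that n q by (simp add: p_def divide_simps)
    \<comment> \<open>Outside both events, and where \<open>q \<le> \<sigma>\<close>, one and the
      same sum is within \<open>\<epsilon>\<close> of \<open>Q q\<close> and of \<open>q\<close>,
      whence the tolerance \<open>2 * \<epsilon>\<close>.\<close>
    let ?H1 = "{\<omega> \<in> space M. \<epsilon> < \<bar>(\<Sum>i<n. (\<xi> (p (Suc i)) \<omega> - \<xi> (p i) \<omega>)\<^sup>2) - Q q \<omega>\<bar>}"
    let ?H2 = "{\<omega> \<in> space M. \<epsilon> < \<bar>(\<Sum>i<n. (X (p (Suc i)) \<omega> - X (p i) \<omega>)\<^sup>2) - q\<bar>}"
    have [measurable]: "\<xi> (p i) \<in> borel_measurable M" for i using p(3) by simp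
    have H: "?H1 \<in> events" "?H2 \<in> events" by measurable
    show "\<exists>H\<in>events. prob H < \<eta> \<and> (\<forall>\<omega>\<in>space M. (\<forall>t\<ge>0. \<xi> t \<omega> = X (min t (\<sigma> \<omega>)) \<omega>) \<longrightarrow>
        \<not> (q \<le> \<sigma> \<omega> \<longrightarrow> \<bar>Q q \<omega> - q\<bar> \<le> 2 / real (Suc m)) \<longrightarrow> \<omega> \<in> H)"
    proof (intro bexI[of _ "?H1 \<union> ?H2"] conjI ballI impI)
      have "prob (?H1 \<union> ?H2) \<le> prob ?H1 + prob ?H2"
        by (rule measure_Un_le[OF H])
      moreover have "prob ?H1 < \<eta> / 2" by (rule D[rule_format]) (simp only: p(1,2) p3 simp_thms)
      moreover have "prob ?H2 < \<eta> / 2" using n(3) unfolding p_def .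
      ultimately show "prob (?H1 \<union> ?H2) < \<eta>" by linarith
    next
      fix \<omega> assume \<omega>: "\<omega> \<in> space M" "\<forall>t\<ge>0. \<xi> t \<omega> = X (min t (\<sigma> \<omega>)) \<omega>" "\<not> (q \<le> \<sigma> \<omega> \<longrightarrow> \<bar>Q q \<omega> - q\<bar> \<le> 2 / real (Suc m))"
      have "\<xi> (p i) \<omega> = X (p i) \<omega>" if "i \<le> n" for i
        using \<omega> p(3)[of i] pq[OF that] by (simp add: min_absorb1)
      then have "(\<Sum>i<n. (\<xi> (p (Suc i)) \<omega> - \<xi> (p i) \<omega>)\<^sup>2) = (\<Sum>i<n. (X (p (Suc i)) \<omega> - X (p i) \<omega>)\<^sup>2)"
        by (intro sum.cong) auto
      moreover have "2 * \<epsilon> < \<bar>Q q \<omega> - q\<bar>" using \<omega>(3) by (simp add: \<epsilon>_def)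
      ultimately show "\<omega> \<in> ?H1 \<union> ?H2" using \<omega>(1) by auto
    qed (use H in auto)
  qed
  then show ?thesis
  proof eventually_elim
    case (elim \<omega>)
    show ?case
    proof
      assume "q \<le> \<sigma> \<omega>"
      then have "\<bar>Q q \<omega> - q\<bar> \<le> 2 * inverse (real (Suc m))" for m using elim by (simp add: divide_inverse)
      then have "\<bar>Q q \<omega> - q\<bar> \<le> 2 * 0"
        by (intro LIMSEQ_le_const[OF tendsto_mult_left[OF LIMSEQ_inverse_real_of_nat]]) auto
      then show "Q q \<omega> = q" by simp
    qed
  qed
qed

lemma bracket_after:
  assumes QV: "quadratic_variation M \<xi> Q" and R: "AE \<omega> in M. \<forall>t\<ge>0. \<xi> t \<omega> = X (min t (\<sigma> \<omega>)) \<omega>"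
    and q: "0 < q" "q \<le> t"
  shows "AE \<omega> in M. \<sigma> \<omega> \<le> q \<longrightarrow> Q t \<omega> = Q q \<omega>"
proof -
  have \<xi>[measurable]: "\<xi> t \<in> borel_measurable M" and Q: "Q t \<in> borel_measurable M" if "0 \<le> t" for t
    using QV that unfolding quadratic_variation_def by auto
  have [measurable]: "Q q \<in> borel_measurable M" "Q t \<in> borel_measurable M" using Q q by auto
  have "AE \<omega> in M. \<forall>m. \<sigma> \<omega> \<le> q \<longrightarrow> \<bar>Q t \<omega> - Q q \<omega>\<bar> \<le> 2 / real (Suc m)"
    unfolding AE_all_countable
  proof (intro allI AE_I_small[OF R])
    fix m :: nat and \<eta> :: real assume \<eta>: "0 < \<eta>"
    define \<epsilon> where "\<epsilon> = 1 / real (Suc m)"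
    have \<epsilon>: "0 < \<epsilon>" by (simp add: \<epsilon>_def)
    from quadratic_variationD[OF QV less_imp_le[OF q(1)] \<epsilon> half_gt_zero[OF \<eta>]]
    obtain \<delta>1 where \<delta>1: "0 < \<delta>1" and D1: "\<forall>(n::nat) p. p 0 = 0 \<and> p n = q \<and> (\<forall>i. p i \<le> p (Suc i) \<and> p (Suc i) - p i < \<delta>1) \<longrightarrow>
        measure M {\<omega> \<in> space M. \<epsilon> < \<bar>(\<Sum>i<n. (\<xi> (p (Suc i)) \<omega> - \<xi> (p i) \<omega>)\<^sup>2) - Q q \<omega>\<bar>} < \<eta> / 2"
      by (elim exE conjE)
    from quadratic_variationD[OF QV order_trans[OF less_imp_le[OF q(1)] q(2)] \<epsilon> half_gt_zero[OF \<eta>]]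
    obtain \<delta>2 where \<delta>2: "0 < \<delta>2" and D2: "\<forall>(n::nat) p. p 0 = 0 \<and> p n = t \<and> (\<forall>i. p i \<le> p (Suc i) \<and> p (Suc i) - p i < \<delta>2) \<longrightarrow>
        measure M {\<omega> \<in> space M. \<epsilon> < \<bar>(\<Sum>i<n. (\<xi> (p (Suc i)) \<omega> - \<xi> (p i) \<omega>)\<^sup>2) - Q t \<omega>\<bar>} < \<eta> / 2"
      by (elim exE conjE)
    have "\<forall>\<^sub>F n in sequentially. t / real n < min \<delta>1 \<delta>2"
    proof (rule order_tendstoD(2))
      show "(\<lambda>n. t / real n) \<longlonglongrightarrow> 0" by real_asymp
      show "0 < min \<delta>1 \<delta>2" using \<delta>1 \<delta>2 by simp
    qed
    then have "\<forall>\<^sub>F n in sequentially. 0 < n \<and> t / real n < min \<delta>1 \<delta>2"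
      using eventually_gt_at_top[of 0] by eventually_elim simp
    from eventually_happens'[OF sequentially_bot this] obtain n where n: "0 < n" "t / real n < min \<delta>1 \<delta>2"
      by (elim exE conjE)
    \<comment> \<open>\<open>n\<close> equal steps up to \<open>q\<close>, then \<open>n\<close>
      equal steps up to \<open>t\<close>. The same partition approximates \<open>Q q\<close> by its
      first \<open>n\<close> terms and \<open>Q t\<close> by all \<open>2 * n\<close>, so the two
      sums can be compared term by term.\<close>
    define p where "p i = (if i \<le> n then real i * q / real n else q + real (i - n) * (t - q) / real n)" for i
    have p_end: "p 0 = 0" "p n = q" "p (n + n) = t" using n by (auto simp: p_def)
    have step: "0 \<le> p (Suc i) - p i \<and> p (Suc i) - p i \<le> t / real n" for i
    proof -
      consider "Suc i \<le> n" | "i = n" | "n < i" by linarith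
      then show ?thesis
      proof cases
        case 1
        then have "p (Suc i) - p i = q / real n" by (simp add: p_def add_divide_distrib algebra_simps)
        then show ?thesis using q n by (simp add: divide_right_mono)
      next
        case 2
        then have "p (Suc i) - p i = (t - q) / real n" using n by (simp add: p_def)
        then show ?thesis using q n by (simp add: divide_right_mono)
      next
        case 3
        then have "p (Suc i) - p i = (t - q) / real n" by (simp add: p_def Suc_diff_le add_divide_distrib distrib_right del: of_nat_diff)
        then show ?thesis using q n by (simp add: divide_right_mono)
      qed
    qed
    have p0: "0 \<le> p i" for i using q by (simp add: p_def)
    have pq: "q \<le> p i" if "n \<le> i" for i using that q n by (cases "i = n") (simp_all add: p_def)
    let ?V = "\<lambda>k \<omega>. \<Sum>i<k. (\<xi> (p (Suc i)) \<omega> - \<xi> (p i) \<omega>)\<^sup>2"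
    let ?H1 = "{\<omega> \<in> space M. \<epsilon> < \<bar>?V n \<omega> - Q q \<omega>\<bar>}"
    let ?H2 = "{\<omega> \<in> space M. \<epsilon> < \<bar>?V (n + n) \<omega> - Q t \<omega>\<bar>}"
    have [measurable]: "\<xi> (p i) \<in> borel_measurable M" for i using p0 by simp
    have H: "?H1 \<in> events" "?H2 \<in> events" by measurable
    have st1: "p i \<le> p (Suc i) \<and> p (Suc i) - p i < \<delta>1" for i using step[of i] n(2) by auto
    have st2: "p i \<le> p (Suc i) \<and> p (Suc i) - p i < \<delta>2" for i using step[of i] n(2) by auto
    show "\<exists>H\<in>events. prob H < \<eta> \<and> (\<forall>\<omega>\<in>space M. (\<forall>t\<ge>0. \<xi> t \<omega> = X (min t (\<sigma> \<omega>)) \<omega>) \<longrightarrow>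
        \<not> (\<sigma> \<omega> \<le> q \<longrightarrow> \<bar>Q t \<omega> - Q q \<omega>\<bar> \<le> 2 / real (Suc m)) \<longrightarrow> \<omega> \<in> H)"
    proof (intro bexI[of _ "?H1 \<union> ?H2"] conjI ballI impI)
      have "prob (?H1 \<union> ?H2) \<le> prob ?H1 + prob ?H2"
        by (rule measure_Un_le[OF H])
      moreover have "prob ?H1 < \<eta> / 2" by (rule D1[rule_format]) (simp only: p_end st1 simp_thms)
      moreover have "prob ?H2 < \<eta> / 2" by (rule D2[rule_format]) (simp only: p_end st2 simp_thms)
      ultimately show "prob (?H1 \<union> ?H2) < \<eta>" by linarith
    next
      fix \<omega> assume \<omega>: "\<omega> \<in> space M" "\<forall>t\<ge>0. \<xi> t \<omega> = X (min t (\<sigma> \<omega>)) \<omega>" "\<not> (\<sigma> \<omega> \<le> q \<longrightarrow> \<bar>Q t \<omega> - Q q \<omega>\<bar> \<le> 2 / real (Suc m))"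
      have "\<xi> (p i) \<omega> = X (\<sigma> \<omega>) \<omega>" if "n \<le> i" for i
        using \<omega> p0[of i] pq[OF that] by (simp add: min_absorb2)
      then have "?V (n + n) \<omega> = ?V n \<omega>"
        by (intro sum.mono_neutral_right) auto
      moreover have "2 * \<epsilon> < \<bar>Q t \<omega> - Q q \<omega>\<bar>" using \<omega>(3) by (simp add: \<epsilon>_def)
      ultimately show "\<omega> \<in> ?H1 \<union> ?H2" using \<omega>(1) by auto
    qed (use H in auto)
  qed
  then show ?thesis
  proof eventually_elim
    case (elim \<omega>)
    show ?case
    proof
      assume "\<sigma> \<omega> \<le> q"
      then have "\<bar>Q t \<omega> - Q q \<omega>\<bar> \<le> 2 * inverse (real (Suc m))" for m using elim by (simp add: divide_inverse)
      then have "\<bar>Q t \<omega> - Q q \<omega>\<bar> \<le> 2 * 0"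
        by (intro LIMSEQ_le_const[OF tendsto_mult_left[OF LIMSEQ_inverse_real_of_nat]]) auto
      then show "Q t \<omega> = Q q \<omega>" by simp
    qed
  qed
qed

lemma bracket_stopped:
  assumes QV: "quadratic_variation M \<xi> Q" and R: "AE \<omega> in M. \<forall>t\<ge>0. \<xi> t \<omega> = X (min t (\<sigma> \<omega>)) \<omega>"
    and \<sigma>: "AE \<omega> in M. 0 < \<sigma> \<omega>"
  shows "AE \<omega> in M. \<forall>t\<ge>0. Q t \<omega> = min t (\<sigma> \<omega>)"
proof -
  have 1: "AE \<omega> in M. \<forall>q\<in>\<rat>. 0 < q \<longrightarrow> q \<le> \<sigma> \<omega> \<longrightarrow> Q q \<omega> = q"
  proof (rule AE_ball_countable[OF countable_rat, THEN iffD2], rule ballI)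
    show "AE \<omega> in M. 0 < q \<longrightarrow> q \<le> \<sigma> \<omega> \<longrightarrow> Q q \<omega> = q" for q
      using bracket_before[OF QV R, of q] by (cases "0 < q") simp_all
  qed
  have 2: "AE \<omega> in M. \<forall>q\<in>\<rat>. \<forall>t\<in>\<rat>. 0 < q \<longrightarrow> q \<le> t \<longrightarrow> \<sigma> \<omega> \<le> q \<longrightarrow> Q t \<omega> = Q q \<omega>"
  proof (rule AE_ball_countable[OF countable_rat, THEN iffD2], rule ballI,
      rule AE_ball_countable[OF countable_rat, THEN iffD2], rule ballI)
    show "AE \<omega> in M. 0 < q \<longrightarrow> q \<le> t \<longrightarrow> \<sigma> \<omega> \<le> q \<longrightarrow> Q t \<omega> = Q q \<omega>" for q t
      using bracket_after[OF QV R, of q t] by (cases "0 < q \<and> q \<le> t") auto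
  qed
  have 3: "AE \<omega> in M. Q 0 \<omega> = 0 \<and> mono_on {0..} (\<lambda>t. Q t \<omega>) \<and> continuous_on {0..} (\<lambda>t. Q t \<omega>)"
    using QV unfolding quadratic_variation_def by (elim conjE)
  show ?thesis
    using 1 2 3 \<sigma>
  proof eventually_elim
    case (elim \<omega>)
    show ?case
    proof (intro allI impI)
      fix t :: real assume "0 \<le> t"
      then show "Q t \<omega> = min t (\<sigma> \<omega>)"
      proof (rule stopped_clock[of "\<lambda>t. Q t \<omega>", rotated -1])
        fix q r :: real assume "q \<in> \<rat>" "r \<in> \<rat>" "\<sigma> \<omega> \<le> q" "q \<le> r"
        moreover have "0 < q" using elim(4) \<open>\<sigma> \<omega> \<le> q\<close> by linarith
        ultimately show "Q r \<omega> = Q q \<omega>" using elim(2) by blast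
      qed (use elim in blast)+
    qed
  qed
qed

end

section \<open>Passage to the local time\<close>

context occupation_bump begin

lemma nn_integral_occ_total_power:
  assumes "0 < c"
  shows "(\<integral>\<^sup>+\<omega>. ennreal ((occ_total \<omega> / c) ^ k) \<partial>M) = ennreal (fact k / c ^ k) * occ_moment k"
proof -
  have "ennreal ((occ_total \<omega> / c) ^ k) = ennreal (fact k / c ^ k) * ennreal (occ_total \<omega> ^ k / fact k)" for \<omega>
    using assms by (subst ennreal_mult[symmetric]) (auto simp: occ_total_def power_divide)
  then show ?thesis
    unfolding occ_moment_def by (simp add: nn_integral_cmult)
qed

lemma occ_total_power_le:
  assumes "0 < c"
  shows "(\<integral>\<^sup>+\<omega>. ennreal ((occ_total \<omega> / c) ^ k) \<partial>M) \<le> ennreal (fact k / l ^ k)"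
proof (cases k)
  case 0
  then show ?thesis by (simp add: emeasure_space_1)
next
  case (Suc j)
  have "(\<integral>\<^sup>+\<omega>. ennreal ((occ_total \<omega> / c) ^ k) \<partial>M) \<le> ennreal (fact k / c ^ k) * ennreal ((c / l) ^ k)"
    unfolding nn_integral_occ_total_power[OF assms] unfolding Suc by (intro mult_left_mono occ_moment_le) simp
  also have "\<dots> = ennreal (fact k / l ^ k)"
    using assms l_pos by (simp add: ennreal_mult[symmetric] power_divide)
  finally show ?thesis .
qed

lemma occ_total_power_ge:
  assumes "0 < c"
  shows "ennreal (exp (- 2 * l * e) ^ k * (fact k / l ^ k)) \<le> (\<integral>\<^sup>+\<omega>. ennreal ((occ_total \<omega> / c) ^ k) \<partial>M)"
proof (cases k)
  case 0
  then show ?thesis by (simp add: emeasure_space_1)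
next
  case (Suc j)
  \<comment> \<open>\<open>occ_moment_ge\<close> has one factor fewer because the first moment is
    exact; giving this away makes the bound uniform in \<open>k\<close>.\<close>
  have "exp (- 2 * l * e) ^ Suc j \<le> exp (- 2 * l * e) ^ j"
    using l_pos e by (intro power_decreasing) auto
  then have "exp (- 2 * l * e) ^ k * (fact k / l ^ k) \<le> fact k / c ^ k * (exp (- 2 * l * e) ^ j * (c / l) ^ k)"
    using assms l_pos unfolding Suc by (simp add: power_divide divide_right_mono mult_right_mono del: power_Suc fact_Suc)
  then have "ennreal (exp (- 2 * l * e) ^ k * (fact k / l ^ k)) \<le> ennreal (fact k / c ^ k) * ennreal (exp (- 2 * l * e) ^ j * (c / l) ^ k)"
    using assms l_pos by (subst ennreal_mult[symmetric]) (auto intro!: ennreal_leI)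
  also have "\<dots> \<le> ennreal (fact k / c ^ k) * occ_moment k"
    unfolding Suc by (intro mult_left_mono occ_moment_ge) simp
  finally show ?thesis unfolding nn_integral_occ_total_power[OF assms] .
qed

end

text \<open>A parabola with zeros \<open>z - e\<close> and \<open>z\<close>, cut off at 0:
  continuous, of explicit mass \<open>e ^ 3 / 6\<close>, and lying to the left of \<open>z\<close>,
  so that the path contributes nothing after its last visit to \<open>z\<close>.\<close>

definition bump :: "real \<Rightarrow> real \<Rightarrow> real \<Rightarrow> real" where
  "bump z e x = max 0 ((x - (z - e)) * (z - x))"

lemma bump_nonneg: "0 \<le> bump z e x"
  by (simp add: bump_def)

lemma bump_continuous: "continuous_on S (bump z e)"
  unfolding bump_def by (intro continuous_intros)

lemma bump_support:
  assumes "0 < e" "bump z e x \<noteq> 0"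
  shows "x \<in> {z - e..z}"
proof -
  have "0 < (x - (z - e)) * (z - x)"
    using assms(2) unfolding bump_def by (metis linorder_not_less max.absorb1)
  then show ?thesis using assms(1) by (auto simp: zero_less_mult_iff)
qed

lemma nn_integral_bump:
  assumes e: "0 < e"
  shows "(\<integral>\<^sup>+x. ennreal (bump z e x) \<partial>lborel) = ennreal (e ^ 3 / 6)"
proof -
  let ?F = "\<lambda>x. e * (x - (z - e)) ^ 2 / 2 - (x - (z - e)) ^ 3 / 3"
  have "(\<integral>\<^sup>+x. ennreal (bump z e x) \<partial>lborel) = (\<integral>\<^sup>+x. ennreal (bump z e x) * indicator {z - e..z} x \<partial>lborel)"
  proof (rule nn_integral_cong)
    fix x
    show "ennreal (bump z e x) = ennreal (bump z e x) * indicator {z - e..z} x"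
      using bump_support[OF e, of z x] by (cases "bump z e x = 0") auto
  qed
  also have "\<dots> = ennreal (?F z - ?F (z - e))"
  proof (rule nn_integral_FTC_Icc)
    show "bump z e \<in> borel_measurable borel"
      by (rule borel_measurable_continuous_onI[OF bump_continuous])
    fix x assume x: "x \<in> {z - e..z}"
    have "bump z e x = e * (x - (z - e)) - (x - (z - e))\<^sup>2"
      using x by (simp add: bump_def max_def mult_le_0_iff) (simp add: power2_eq_square algebra_simps)
    then show "DERIV ?F x :> bump z e x"
      by (auto intro!: derivative_eq_intros simp: power2_eq_square)
  qed (use e bump_nonneg in auto)
  also have "?F z - ?F (z - e) = e ^ 3 / 6"
    by (simp add: power2_eq_square power3_eq_cube)
  finally show ?thesis .
qed

text \<open>Divided by their masses, the bumps form a one-sided approximate identity at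
  \<open>z\<close>, so continuity of \<open>g\<close> there suffices.\<close>

lemma bump_average_tendsto:
  fixes g :: "real \<Rightarrow> real"
  assumes g: "isCont g z" and g0: "\<And>x. 0 \<le> g x"
    and e: "\<And>n. 0 < e n" "e \<longlonglongrightarrow> 0"
    and A0: "\<And>n. 0 \<le> A n"
    and A: "\<And>n. ennreal (A n) = (\<integral>\<^sup>+x. ennreal (bump z (e n) x) * ennreal (g x) \<partial>lborel)"
  shows "(\<lambda>n. A n / (e n ^ 3 / 6)) \<longlonglongrightarrow> g z"
proof (rule LIMSEQ_I)
  fix r :: real assume "0 < r"
  define \<eta> where "\<eta> = r / 2"
  have \<eta>: "0 < \<eta>" "\<eta> < r" using \<open>0 < r\<close> by (simp_all add: \<eta>_def)
  obtain d where d: "0 < d" "\<And>x. \<bar>x - z\<bar> < d \<Longrightarrow> \<bar>g x - g z\<bar> < \<eta>"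
    using g \<eta>(1) unfolding continuous_at_eps_delta dist_real_def by metis
  have ev: "\<forall>\<^sub>F n in sequentially. e n < d"
    using order_tendstoD(2)[OF e(2) d(1)] .
  have const: "(\<integral>\<^sup>+x. ennreal (bump z (e n) x) * ennreal a \<partial>lborel) = ennreal (e n ^ 3 / 6) * ennreal a" for n a
    using nn_integral_bump[OF e(1)[of n], of z] borel_measurable_continuous_onI[OF bump_continuous]
    by (subst nn_integral_multc) auto
  have "norm (A n / (e n ^ 3 / 6) - g z) < r" if n: "e n < d" for n
  proof -
    define c where "c = e n ^ 3 / 6"
    have c: "0 < c" using e(1)[of n] by (simp add: c_def)
    have near: "\<bar>g x - g z\<bar> < \<eta>" if "bump z (e n) x \<noteq> 0" for x
      using bump_support[OF e(1) that] n by (intro d(2)) auto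
    have "ennreal (A n) \<le> (\<integral>\<^sup>+x. ennreal (bump z (e n) x) * ennreal (g z + \<eta>) \<partial>lborel)"
      unfolding A
    proof (rule nn_integral_mono)
      fix x
      show "ennreal (bump z (e n) x) * ennreal (g x) \<le> ennreal (bump z (e n) x) * ennreal (g z + \<eta>)"
        using near[of x] by (cases "bump z (e n) x = 0") (auto intro!: mult_left_mono ennreal_leI)
    qed
    also have "\<dots> = ennreal (c * (g z + \<eta>))"
      using c \<eta> g0[of z] unfolding const c_def[symmetric] by (simp add: ennreal_mult)
    finally have up: "A n \<le> c * (g z + \<eta>)"
      using c \<eta> g0[of z] by (simp add: ennreal_le_iff)
    have "(\<integral>\<^sup>+x. ennreal (bump z (e n) x) * ennreal (g z - \<eta>) \<partial>lborel) \<le> ennreal (A n)"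
      unfolding A
    proof (rule nn_integral_mono)
      fix x
      show "ennreal (bump z (e n) x) * ennreal (g z - \<eta>) \<le> ennreal (bump z (e n) x) * ennreal (g x)"
        using near[of x] by (cases "bump z (e n) x = 0") (auto intro!: mult_left_mono ennreal_leI)
    qed
    then have *: "ennreal c * ennreal (g z - \<eta>) \<le> ennreal (A n)"
      unfolding const c_def[symmetric] .
    \<comment> \<open>A negative \<open>g z - \<eta>\<close> is truncated to 0 by
      \<open>ennreal\<close> and the inequality above says nothing; then the sign of
      \<open>A n\<close> gives the bound.\<close>
    have low: "c * (g z - \<eta>) \<le> A n"
    proof (cases "0 \<le> g z - \<eta>")
      case True
      then show ?thesis using * c A0[of n] by (simp add: ennreal_mult[symmetric] ennreal_le_iff)
    next
      case False
      then have "c * (g z - \<eta>) \<le> 0" using c by (intro mult_nonneg_nonpos) auto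
      then show ?thesis using A0[of n] by linarith
    qed
    have "A n / c \<le> g z + \<eta>" "g z - \<eta> \<le> A n / c"
      using up low c by (simp_all add: pos_divide_le_eq pos_le_divide_eq mult.commute)
    then show ?thesis using \<eta> unfolding c_def[symmetric] by (simp add: abs_if)
  qed
  then show "\<exists>no. \<forall>n\<ge>no. norm (A n / (e n ^ 3 / 6) - g z) < r"
    using ev unfolding eventually_sequentially by blast
qed

context drifted_brownian_motion begin

lemma occupation_bump_bump:
  assumes "0 < e" "e < z"
  shows "occupation_bump M B l (bump z e) z e (e ^ 3 / 6)"
  by unfold_locales (use assms bump_continuous bump_nonneg bump_support nn_integral_bump in auto)

text \<open>The \<open>k\<close>-th moments of the averages lie between
  \<open>exp (- 2 * l * e n) ^ k * (fact k / l ^ k)\<close> and \<open>fact k / l ^ k\<close>. The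
  almost sure limit therefore has the moments of the exponential law, which determine it.\<close>

lemma exponential_limit:
  fixes e :: "nat \<Rightarrow> real"
  assumes e: "\<And>n. 0 < e n" "\<And>n. e n < z" "e \<longlonglongrightarrow> 0"
    and v[measurable]: "v \<in> borel_measurable M"
    and lim: "AE \<omega> in M. (\<lambda>n. occupation_bump.occ_total B l (bump z (e n)) \<omega> / (e n ^ 3 / 6)) \<longlonglongrightarrow> v \<omega>"
  shows "distributed M lborel v (exponential_density l)"
proof -
  define Y where "Y n \<omega> = occupation_bump.occ_total B l (bump z (e n)) \<omega> / (e n ^ 3 / 6)" for n \<omega>
  note ob = occupation_bump_bump[OF e(1,2)]
  have c: "0 < e n ^ 3 / 6" for n using e(1)[of n] by simp
  have Y[measurable]: "Y n \<in> borel_measurable M" for n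
    using occupation_bump.occ_total_measurable[OF ob[of n]] unfolding Y_def by measurable
  have Y0: "0 \<le> Y n \<omega>" for n \<omega>
    using c[of n] unfolding Y_def occupation_bump.occ_total_def[OF ob[of n]] by simp
  have v0: "AE \<omega> in M. 0 \<le> v \<omega>"
    using lim unfolding Y_def[symmetric] by eventually_elim (rule LIMSEQ_le_const, auto simp: Y0)
  have moment: "(\<integral>\<^sup>+\<omega>. ennreal (v \<omega> ^ k) \<partial>M) = ennreal (fact k / l ^ k)" for k
  proof (rule nn_integral_power_limit[OF Y v Y0 lim[folded Y_def]])
    \<comment> \<open>The uniform bound one order higher plays the part of uniform integrability for
      the \<open>k\<close>-th powers.\<close>
    show "(\<integral>\<^sup>+\<omega>. ennreal (Y n \<omega> ^ Suc k) \<partial>M) \<le> ennreal (fact (Suc k) / l ^ Suc k)" for n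
      unfolding Y_def by (rule occupation_bump.occ_total_power_le[OF ob c])
    have "(\<lambda>n. exp (- 2 * l * e n) ^ k * (fact k / l ^ k)) \<longlonglongrightarrow> exp (- 2 * l * 0) ^ k * (fact k / l ^ k)"
      by (intro tendsto_intros e(3))
    then have low: "(\<lambda>n. ennreal (exp (- 2 * l * e n) ^ k * (fact k / l ^ k))) \<longlonglongrightarrow> ennreal (fact k / l ^ k)"
      by (intro tendsto_ennrealI) simp
    show "(\<lambda>n. \<integral>\<^sup>+\<omega>. ennreal (Y n \<omega> ^ k) \<partial>M) \<longlonglongrightarrow> ennreal (fact k / l ^ k)"
    proof (rule tendsto_sandwich[OF _ _ low tendsto_const])
      show "\<forall>\<^sub>F n in sequentially. ennreal (exp (- 2 * l * e n) ^ k * (fact k / l ^ k)) \<le> (\<integral>\<^sup>+\<omega>. ennreal (Y n \<omega> ^ k) \<partial>M)"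
        unfolding Y_def by (intro always_eventually allI occupation_bump.occ_total_power_ge[OF ob c])
      show "\<forall>\<^sub>F n in sequentially. (\<integral>\<^sup>+\<omega>. ennreal (Y n \<omega> ^ k) \<partial>M) \<le> ennreal (fact k / l ^ k)"
        unfolding Y_def by (intro always_eventually allI occupation_bump.occ_total_power_le[OF ob c])
    qed
  qed (use l_pos in auto)
  define N1 where "N1 = distr M borel v"
  define N2 where "N2 = density lborel (exponential_density l)"
  have m1: "(\<integral>\<^sup>+x. ennreal (\<bar>x\<bar> ^ k) \<partial>N1) = ennreal (fact k / l ^ k)" for k
  proof -
    have "(\<integral>\<^sup>+x. ennreal (\<bar>x\<bar> ^ k) \<partial>N1) = (\<integral>\<^sup>+\<omega>. ennreal (\<bar>v \<omega>\<bar> ^ k) \<partial>M)"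
      unfolding N1_def by (subst nn_integral_distr) auto
    also have "\<dots> = (\<integral>\<^sup>+\<omega>. ennreal (v \<omega> ^ k) \<partial>M)"
      using v0 by (intro nn_integral_cong_AE) (auto elim!: eventually_mono)
    finally show ?thesis using moment by simp
  qed
  have m2: "(\<integral>\<^sup>+x. ennreal (\<bar>x\<bar> ^ k) \<partial>N2) = ennreal (fact k / l ^ k)" for k
  proof -
    have "(\<integral>\<^sup>+x. ennreal (\<bar>x\<bar> ^ k) \<partial>N2) = (\<integral>\<^sup>+x. ennreal (exponential_density l x * x ^ k) \<partial>lborel)"
      unfolding N2_def using l_pos
      by (subst nn_integral_density)
        (auto intro!: nn_integral_cong simp: ennreal_mult[symmetric] exponential_density_def)
    also have "\<dots> = ennreal (fact k / l ^ k)"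
      using nn_integral_erlang_ith_moment[OF l_pos, of 0 k] by simp
    finally show ?thesis .
  qed
  have p1: "AE x in N1. 0 \<le> x"
    unfolding N1_def using v0 by (subst AE_distr_iff) auto
  have p2: "AE x in N2. 0 \<le> x"
    unfolding N2_def by (subst AE_density) (auto simp: exponential_density_def intro!: AE_I2)
  have ex: "(\<integral>x. x ^ k \<partial>N) = fact k / l ^ k" if N: "sets N = sets borel" "AE x in N. 0 \<le> x"
    "(\<integral>\<^sup>+x. ennreal (\<bar>x\<bar> ^ k) \<partial>N) = ennreal (fact k / l ^ k)" for N k
  proof -
    have [measurable_cong]: "sets N = sets borel" by (rule N(1))
    have "(\<integral>x. x ^ k \<partial>N) = enn2real (\<integral>\<^sup>+x. ennreal (x ^ k) \<partial>N)"
      by (rule integral_eq_nn_integral) (use N(2) in \<open>auto elim!: eventually_mono\<close>)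
    also have "(\<integral>\<^sup>+x. ennreal (x ^ k) \<partial>N) = (\<integral>\<^sup>+x. ennreal (\<bar>x\<bar> ^ k) \<partial>N)"
      using N(2) by (intro nn_integral_cong_AE) (auto elim!: eventually_mono)
    finally show ?thesis using N(3) l_pos by simp
  qed
  have s: "sets N1 = sets borel" "sets N2 = sets borel" by (simp_all add: N1_def N2_def)
  have "N1 = N2"
  proof (rule real_distribution_eqI_moments[OF _ _ l_pos])
    show "real_distribution N1" unfolding N1_def by (rule real_distribution_distr[OF v])
    show "real_distribution N2" unfolding N2_def
      using prob_space_exponential_density[OF l_pos] by (simp add: real_distribution_def real_distribution_axioms_def)
  qed (use m1 m2 ex[OF s(1) p1 m1] ex[OF s(2) p2 m2] in auto)
  then show ?thesis
    unfolding distributed_def N1_def N2_def by (auto cong: distr_cong)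
qed

end

section \<open>Removing the exceptional null set from the Brownian paths\<close>

text \<open>Independence says that the joint law is the product of the marginal laws, and none of
  these laws changes under modification on null sets. This characterization concerns nonempty index
  sets, hence the case split.\<close>

lemma (in prob_space) indep_vars_cong_AE:
  fixes X Y :: "'i \<Rightarrow> 'a \<Rightarrow> 'b"
  assumes ind: "indep_vars N X I" and I: "finite I"
    and Y[measurable]: "\<And>i. i \<in> I \<Longrightarrow> Y i \<in> M \<rightarrow>\<^sub>M N i"
    and eq: "\<And>i. i \<in> I \<Longrightarrow> AE \<omega> in M. X i \<omega> = Y i \<omega>"
  shows "indep_vars N Y I"
proof (cases "I = {}")
  case True
  then show ?thesis by (simp add: indep_vars_def indep_sets_def)
next
  case False
  have X[measurable]: "\<And>i. i \<in> I \<Longrightarrow> X i \<in> M \<rightarrow>\<^sub>M N i" using ind by (auto simp: indep_vars_def)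
  have "distr M (PiM I N) (\<lambda>x. \<lambda>i\<in>I. X i x) = distr M (PiM I N) (\<lambda>x. \<lambda>i\<in>I. Y i x)"
  proof (rule distr_cong_AE)
    have "AE \<omega> in M. \<forall>i\<in>I. X i \<omega> = Y i \<omega>"
      using I eq by (subst AE_finite_all) auto
    then show "AE \<omega> in M. (\<lambda>i\<in>I. X i \<omega>) = (\<lambda>i\<in>I. Y i \<omega>)"
      by eventually_elim (auto simp: restrict_def)
  qed (auto intro!: measurable_restrict)
  moreover have "distr M (N i) (X i) = distr M (N i) (Y i)" if "i \<in> I" for i
    using that eq by (intro distr_cong_AE) auto
  then have "PiM I (\<lambda>i. distr M (N i) (X i)) = PiM I (\<lambda>i. distr M (N i) (Y i))"
    by (intro PiM_cong) auto
  moreover have "distr M (PiM I N) (\<lambda>x. \<lambda>i\<in>I. X i x) = PiM I (\<lambda>i. distr M (N i) (X i))"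
    by (rule indep_vars_iff_distr_eq_PiM'[OF False X, THEN iffD1, OF _ ind])
  ultimately show ?thesis
    by (intro indep_vars_iff_distr_eq_PiM'[OF False Y, THEN iffD2]) simp_all
qed

lemma continuous_modification:
  assumes "prob_space M" and B: "std_brownian_motion M B"
  obtains B' where "continuous_brownian_motion M B'" "AE \<omega> in M. \<forall>t\<ge>0. B' t \<omega> = B t \<omega>"
proof -
  interpret prob_space M by fact
  have Bm: "B t \<in> borel_measurable M" if "0 \<le> t" for t
    using B that unfolding std_brownian_motion_def by blast
  have "AE \<omega> in M. B 0 \<omega> = 0 \<and> continuous_on {0..} (\<lambda>t. B t \<omega>)"
    using B unfolding std_brownian_motion_def by (simp add: AE_conj_iff)
  from AE_E[OF this] obtain N where N: "{\<omega> \<in> space M. \<not> (B 0 \<omega> = 0 \<and> continuous_on {0..} (\<lambda>t. B t \<omega>))} \<subseteq> N"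
    "emeasure M N = 0" "N \<in> sets M" .
  note [measurable] = N(3)
  \<comment> \<open>Paths in a null event that covers all bad ones are replaced by 0. Negative
    times, where \<open>B\<close> is unconstrained, receive the value at time 0.\<close>
  define B' where "B' t \<omega> = (if \<omega> \<in> N then 0 else B (max 0 t) \<omega>)" for t \<omega>
  have "AE \<omega> in M. \<omega> \<notin> N" using N by (intro AE_not_in) auto
  then have eq: "AE \<omega> in M. \<forall>t\<ge>0. B' t \<omega> = B t \<omega>"
    by eventually_elim (auto simp: B'_def)
  have m[measurable]: "B' t \<in> borel_measurable M" for t
    using Bm[of "max 0 t"] unfolding B'_def by simp
  have inc: "AE \<omega> in M. B t \<omega> - B s \<omega> = B' t \<omega> - B' s \<omega>" if "0 \<le> s" "0 \<le> t" for s t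
    using eq by eventually_elim (use that in auto)
  have "continuous_brownian_motion M B'"
  proof unfold_locales
    show "continuous_on UNIV (\<lambda>t. B' t \<omega>)" if "\<omega> \<in> space M" for \<omega>
    proof (cases "\<omega> \<in> N")
      case False
      then have "continuous_on {0..} (\<lambda>t. B t \<omega>)" using N(1) that by auto
      then have "continuous_on UNIV (\<lambda>t. B (max 0 t) \<omega>)"
        by (rule continuous_on_compose2) (auto intro!: continuous_intros)
      then show ?thesis using False by (simp add: B'_def)
    qed (simp add: B'_def)
    show "B' 0 \<omega> = 0" if "\<omega> \<in> space M" for \<omega>
      using N(1) that by (auto simp: B'_def)
    show "distributed M lborel (\<lambda>\<omega>. B' t \<omega> - B' s \<omega>) (normal_density 0 (sqrt (t - s)))" if "0 \<le> s" "s < t" for s t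
    proof -
      have D: "distributed M lborel (\<lambda>\<omega>. B t \<omega> - B s \<omega>) (normal_density 0 (sqrt (t - s)))"
        using B that unfolding std_brownian_motion_def by blast
      have "distr M lborel (\<lambda>\<omega>. B' t \<omega> - B' s \<omega>) = distr M lborel (\<lambda>\<omega>. B t \<omega> - B s \<omega>)"
        using inc[of s t] that Bm[of s] Bm[of t] by (intro distr_cong_AE) auto
      then show ?thesis using D unfolding distributed_def by simp
    qed
    show "indep_vars (\<lambda>_. borel) (\<lambda>i \<omega>. B' (p (Suc i)) \<omega> - B' (p i) \<omega>) {..<n}"
      if p: "0 \<le> p 0" "\<And>i. i < n \<Longrightarrow> p i \<le> p (Suc i)" for p :: "nat \<Rightarrow> real" and n
    proof (rule indep_vars_cong_AE)
      show "indep_vars (\<lambda>_. borel) (\<lambda>i \<omega>. B (p (Suc i)) \<omega> - B (p i) \<omega>) {..<n}"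
        using B p unfolding std_brownian_motion_def by blast
      have p0: "0 \<le> p i" if "i \<le> n" for i
        using that
      proof (induction i)
        case (Suc i)
        then show ?case using p(2)[of i] by auto
      qed (use p in simp)
      show "AE \<omega> in M. B (p (Suc i)) \<omega> - B (p i) \<omega> = B' (p (Suc i)) \<omega> - B' (p i) \<omega>" if "i \<in> {..<n}" for i
        using that p0[of i] p0[of "Suc i"] by (intro inc) auto
    qed auto
  qed simp
  then show thesis using eq by (rule that)
qed

theorem proposition4p2:
  fixes M :: "'a measure" and B :: "real \<Rightarrow> 'a \<Rightarrow> real"
    and lam z :: real
    and \<sigma> :: "'a \<Rightarrow> real" and \<xi> :: "real \<Rightarrow> 'a \<Rightarrow> real"
    and L :: "real \<Rightarrow> real \<Rightarrow> 'a \<Rightarrow> real"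
  assumes "prob_space M" and "complete_measure M"
    and "std_brownian_motion M B"
    and "lam > 0" and "z > 0"
    and "\<sigma> = last_passage (drifted lam B) z"
    and "\<xi> = stopped (drifted lam B) \<sigma>"
    and "local_time M \<xi> L"
  shows "distributed M lborel (\<lambda>\<omega>. L (\<sigma> \<omega>) z \<omega>) (exponential_density lam) \<and>
    (\<forall>y\<ge>0. measure M {\<omega> \<in> space M. L (\<sigma> \<omega>) z \<omega> > y} = exp (- lam * y))"
proof -
  interpret complete_measure M by fact
  obtain B' where B': "continuous_brownian_motion M B'" and eq: "AE \<omega> in M. \<forall>t\<ge>0. B' t \<omega> = B t \<omega>"
    by (rule continuous_modification[OF assms(1,3)])
  interpret drifted_brownian_motion M B' lam
    using B' \<open>lam > 0\<close> by (simp add: drifted_brownian_motion_def drifted_brownian_motion_axioms_def)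
  have path: "AE \<omega> in M. 0 < \<sigma> \<omega> \<and> (\<forall>t>\<sigma> \<omega>. z < X t \<omega>) \<and> (\<forall>t\<ge>0. \<xi> t \<omega> = X (min t (\<sigma> \<omega>)) \<omega>)"
    using eq X_eventually_ge[of "z + 1"] AE_space
  proof eventually_elim
    case (elim \<omega>)
    then obtain T where T: "0 \<le> T" "\<And>t. T \<le> t \<Longrightarrow> z + 1 \<le> X t \<omega>" by blast
    have XB: "X t \<omega> = drifted lam B t \<omega>" if "0 \<le> t" for t
      using elim(1) that by (simp add: X_def drifted_def)
    have \<sigma>: "\<sigma> \<omega> = Sup {t. 0 < t \<and> X t \<omega> = z}"
      \<comment> \<open>Only positive times enter the supremum, and there the modified path agrees
        with the given one.\<close>
      unfolding assms(6) last_passage_def by (intro arg_cong[where f=Sup] Collect_cong) (auto simp: XB)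
    note lp = last_passage_path[OF X_continuous[OF elim(3)] X_0[OF elim(3)] \<open>z > 0\<close> T \<sigma>]
    have "\<xi> t \<omega> = X (min t (\<sigma> \<omega>)) \<omega>" if "0 \<le> t" for t
      using that lp(1) unfolding assms(7) stopped_def by (subst XB) auto
    then show ?case using lp by blast
  qed
  obtain Q where Q: "quadratic_variation M \<xi> Q" and occupation: "AE \<omega> in M. \<forall>t\<ge>0. \<forall>f :: real \<Rightarrow> ennreal. f \<in> borel_measurable borel \<longrightarrow>
      (\<integral>\<^sup>+s\<in>{0..t}. f (\<xi> s \<omega>) \<partial>interval_measure (\<lambda>s. Q (max 0 s) \<omega>)) = (\<integral>\<^sup>+x. f x * ennreal (L t x \<omega>) \<partial>lborel)"
    using assms(8) unfolding local_time_def by blast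
  have L_cont: "AE \<omega> in M. continuous_on ({0..} \<times> UNIV) (\<lambda>(t, x). L t x \<omega>)"
    and L_nonneg: "AE \<omega> in M. \<forall>t\<ge>0. \<forall>x. 0 \<le> L t x \<omega>"
    using assms(8) unfolding local_time_def by blast+
  have bracket: "AE \<omega> in M. \<forall>t\<ge>0. Q t \<omega> = min t (\<sigma> \<omega>)"
    by (rule bracket_stopped[OF Q]) (use path in \<open>auto elim!: eventually_mono\<close>)
  \<comment> \<open>The shift by 2 makes every width, including the one for \<open>n = 0\<close>,
    strictly smaller than \<open>z\<close>.\<close>
  define e where "e n = z / (real n + 2)" for n
  have e: "0 < e n" "e n < z" for n using \<open>z > 0\<close> by (auto simp: e_def divide_simps)
  have e_lim: "e \<longlonglongrightarrow> 0" unfolding e_def by real_asymp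
  note ob = occupation_bump_bump[OF e]
  define Y where "Y n \<omega> = occupation_bump.occ_total B' lam (bump z (e n)) \<omega> / (e n ^ 3 / 6)" for n \<omega>
  have Y[measurable]: "Y n \<in> borel_measurable M" for n
    using occupation_bump.occ_total_measurable[OF ob[of n]] unfolding Y_def by measurable
  have "AE \<omega> in M. \<forall>n. (\<integral>\<^sup>+s. ennreal (bump z (e n) (X s \<omega>)) * indicator {0<..} s \<partial>lborel) =
      ennreal (occupation_bump.occ_total B' lam (bump z (e n)) \<omega>)"
    unfolding AE_all_countable using occupation_bump.occ_total_finite[OF ob] by blast
  then have lim: "AE \<omega> in M. (\<lambda>n. Y n \<omega>) \<longlonglongrightarrow> L (\<sigma> \<omega>) z \<omega>"
    using path occupation L_cont L_nonneg bracket AE_space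
  proof eventually_elim
    case (elim \<omega>)
    have \<sigma>: "0 < \<sigma> \<omega>" using elim by blast
    have "(\<lambda>s. Q (max 0 s) \<omega>) = (\<lambda>s. min (max 0 s) (\<sigma> \<omega>))" using elim(6) by auto
    then have im: "interval_measure (\<lambda>s. Q (max 0 s) \<omega>) = density lborel (indicator {0..\<sigma> \<omega>})"
      using interval_measure_stopped_clock[of "\<sigma> \<omega>"] \<sigma> by simp
    have [measurable]: "(\<lambda>s. X s \<omega>) \<in> borel_measurable borel"
      by (rule borel_measurable_continuous_onI[OF X_continuous[OF elim(7)]])
    have [measurable]: "bump z (e n) \<in> borel_measurable borel" for n
      by (rule borel_measurable_continuous_onI[OF bump_continuous])
    have Lc: "continuous_on UNIV (\<lambda>x. L (\<sigma> \<omega>) x \<omega>)"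
    proof -
      have 1: "continuous_on UNIV (\<lambda>x::real. (\<sigma> \<omega>, x))" by (intro continuous_intros)
      have 2: "(\<lambda>x::real. (\<sigma> \<omega>, x)) ` UNIV \<subseteq> {0..} \<times> UNIV" using \<sigma> by auto
      show ?thesis using continuous_on_compose2[OF elim(4) 1 2] by simp
    qed
    show ?case
      unfolding Y_def
    proof (rule bump_average_tendsto[where g="\<lambda>x. L (\<sigma> \<omega>) x \<omega>" and z=z, OF _ _ e(1) e_lim])
      show "isCont (\<lambda>x. L (\<sigma> \<omega>) x \<omega>) z"
        using Lc by (simp add: continuous_on_eq_continuous_at)
      show "0 \<le> L (\<sigma> \<omega>) x \<omega>" for x using elim(5) \<sigma> by auto
      show "0 \<le> occupation_bump.occ_total B' lam (bump z (e n)) \<omega>" for n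
        unfolding occupation_bump.occ_total_def[OF ob] by simp
      fix n
      have "ennreal (occupation_bump.occ_total B' lam (bump z (e n)) \<omega>) =
          (\<integral>\<^sup>+s. ennreal (bump z (e n) (X s \<omega>)) * indicator {0<..} s \<partial>lborel)"
        using elim(1) by simp
      \<comment> \<open>One indicator is the density of the bracket measure, the other the domain of
        the occupation integral. \<open>max 0 s\<close> avoids the values of \<open>\<xi>\<close> at
        negative times, whose dependence on \<open>s\<close> is not controlled.\<close>
      also have "\<dots> = (\<integral>\<^sup>+s. indicator {0..\<sigma> \<omega>} s * (ennreal (bump z (e n) (\<xi> (max 0 s) \<omega>)) * indicator {0..\<sigma> \<omega>} s) \<partial>lborel)"
      proof (rule nn_integral_cong_AE)
        show "AE s in lborel. ennreal (bump z (e n) (X s \<omega>)) * indicator {0<..} s =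
          indicator {0..\<sigma> \<omega>} s * (ennreal (bump z (e n) (\<xi> (max 0 s) \<omega>)) * indicator {0..\<sigma> \<omega>} s)"
          using AE_lborel_singleton[of 0]
        proof eventually_elim
          case (elim s)
          consider "s < 0" | "0 < s" "s \<le> \<sigma> \<omega>" | "\<sigma> \<omega> < s" using elim by linarith
          then show ?case
          proof cases
            case 2
            then have "\<xi> (max 0 s) \<omega> = X s \<omega>" using \<open>_ \<and> _ \<and> (\<forall>t\<ge>0. \<xi> t \<omega> = _ t)\<close> by (simp add: min_absorb1)
            then show ?thesis using 2 by simp
          next
            case 3
            then have "z < X s \<omega>" using \<open>_ \<and> (\<forall>t>\<sigma> \<omega>. z < X t \<omega>) \<and> _\<close> by blast
            then have "bump z (e n) (X s \<omega>) = 0" using bump_support[OF e(1)[of n], of z "X s \<omega>"] by force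
            then show ?thesis using 3 by simp
          qed simp
        qed
      qed
      also have "\<dots> = (\<integral>\<^sup>+s. ennreal (bump z (e n) (\<xi> (max 0 s) \<omega>)) * indicator {0..\<sigma> \<omega>} s \<partial>density lborel (indicator {0..\<sigma> \<omega>}))"
      proof (rule nn_integral_density[symmetric])
        have \<xi>: "\<xi> (max 0 s) \<omega> = X (min (max 0 s) (\<sigma> \<omega>)) \<omega>" for s using elim(2) by auto
        have [measurable]: "(\<lambda>s. X (min (max 0 s) (\<sigma> \<omega>)) \<omega>) \<in> borel_measurable borel"
          by (intro borel_measurable_continuous_onI continuous_on_compose2[OF X_continuous[OF elim(7)]] continuous_intros) auto
        show "(\<lambda>s. ennreal (bump z (e n) (\<xi> (max 0 s) \<omega>)) * indicator {0..\<sigma> \<omega>} s) \<in> borel_measurable lborel"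
          unfolding \<xi> by measurable
      qed simp
      also have "\<dots> = (\<integral>\<^sup>+s\<in>{0..\<sigma> \<omega>}. ennreal (bump z (e n) (\<xi> s \<omega>)) \<partial>interval_measure (\<lambda>s. Q (max 0 s) \<omega>))"
        unfolding im by (intro nn_integral_cong) (auto simp: indicator_def max_def)
      also have "\<dots> = (\<integral>\<^sup>+x. ennreal (bump z (e n) x) * ennreal (L (\<sigma> \<omega>) x \<omega>) \<partial>lborel)"
        using elim(3)[rule_format, of "\<sigma> \<omega>" "\<lambda>x. ennreal (bump z (e n) x)"] \<sigma> by simp
      finally show "ennreal (occupation_bump.occ_total B' lam (bump z (e n)) \<omega>) =
          (\<integral>\<^sup>+x. ennreal (bump z (e n) x) * ennreal (L (\<sigma> \<omega>) x \<omega>) \<partial>lborel)" .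
    qed
  qed
  \<comment> \<open>\<open>L\<close> is assumed measurable at fixed times only. Here the value at
    \<open>\<sigma>\<close> agrees almost surely with the limit of the measurable
    \<open>Y n\<close>, and completeness of \<open>M\<close> makes it measurable.\<close>
  have v: "(\<lambda>\<omega>. L (\<sigma> \<omega>) z \<omega>) \<in> borel_measurable M"
  proof (rule measurableI)
    fix A :: "real set" assume [measurable]: "A \<in> sets borel"
    have 1: "{\<omega> \<in> space M. lim (\<lambda>n. Y n \<omega>) \<in> A} \<in> sets M" by measurable
    have "AE \<omega> in M. \<omega> \<in> {\<omega> \<in> space M. lim (\<lambda>n. Y n \<omega>) \<in> A} \<longleftrightarrow> \<omega> \<in> (\<lambda>\<omega>. L (\<sigma> \<omega>) z \<omega>) -` A \<inter> space M"
      using lim by eventually_elim (auto simp: limI)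
    then show "(\<lambda>\<omega>. L (\<sigma> \<omega>) z \<omega>) -` A \<inter> space M \<in> sets M"
      by (rule in_sets_AE[OF _ 1]) auto
  qed simp
  have D: "distributed M lborel (\<lambda>\<omega>. L (\<sigma> \<omega>) z \<omega>) (exponential_density lam)"
    by (rule exponential_limit[OF e e_lim v]) (use lim in \<open>simp add: Y_def\<close>)
  then show ?thesis
    using exponential_distributedD_gt[OF D _ \<open>lam > 0\<close>] by (simp add: mult.commute)
qed

end
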